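(* Let $\theta=\begin{pmatrix}0&-1\\1&0\end{pmatrix}$, let $n\in\mathbb{N}$, $n\ge1$, and let $\Sigma_{SE(2)_n}$ be a one-input linear control system on $SE(2)_n$ satisfying the LARC, with linear vector field $\mathcal{X}([t],v)=(0,Av+\Lambda_t^\theta\xi)$. Then: (i) If $\det A\neq 0$, then $\Sigma_{SE(2)_n}$ admits a unique control set with nonempty interior $\mathcal{C}_{SE(2)_n}$, and it satisfies $$\pi_n^{-1}\left(\mathcal{C}_{SE(2)_n}\right)=\mathcal{C}_{G(\theta)},$$ where $\pi_n:G(\theta)\to SE(2)_n$ is the canonical projection and $\mathcal{C}_{G(\theta)}$ is the unique control set with nonempty interior of the linear control system on $G(\theta)$ that is $\pi_n$-conjugated to $\Sigma_{SE(2)_n}$. (ii) If $\det A=0$, then $\Sigma_{SE(2)_n}$ admits an infinite number of control sets with empty interior.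
   Context: **Groups.** For $\theta=\begin{pmatrix}0&-1\\1&0\end{pmatrix}$ put $\rho_t=e^{t\theta}$ and $\Lambda_t^\theta w=\int_0^t e^{s\theta}w\,ds$. $G(\theta)$ is $\mathbb{R}\times\mathbb{R}^2$ with product $(t_1,v_1)(t_2,v_2)=(t_1+t_2,v_1+\rho_{t_1}v_2)$. $Z_n=\{(2kn\pi,0):k\in\mathbb{Z}\}$ is a discrete central subgroup, $SE(2)_n=Z_n\setminus G(\theta)$ (so $SE(2)_1=SE(2)$ is the group of proper motions of $\mathbb{R}^2$), and $\pi_n(t,v)=([t],v)$ with $[t]=t+2n\pi\mathbb{Z}$. **Linear control systems.** On $G(\theta)$: a linear vector field is $\mathcal{X}(t,v)=(0,Av+\Lambda_t^\theta\xi)$ with $\xi\in\mathbb{R}^2$, $A\in\mathfrak{gl}(2,\mathbb{R})$, $A\theta=\theta A$; a left-invariant vector field is $Y(t,v)=(\alpha,\rho_t\eta)$ with $(\alpha,\eta)\in\mathbb{R}\times\mathbb{R}^2$. On $SE(2)_n$ the linear and left-invariant vector fields are given by the same formulas, with $t$ replaced by $[t]$ in the argument (they are well defined there). A one-input linear control system is $\dot g=\mathcal{X}(g)+uY(g)$ with $u\in\Omega=[u^-,u^+]$, $u^-<0<u^+$. The LCS on $G(\theta)$ that is $\pi_n$-conjugated to $\Sigma_{SE(2)_n}$ is the one given by the same data $(A,\xi),(\alpha,\eta)$ (its vector fields are $\pi_n$-related to those of $\Sigma_{SE(2)_n}$). **Control systems.** For a system $\dot x=f_0(x)+u f_1(x)$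 on a manifold $M$, $\mathcal{U}$ is the set of piecewise constant functions $\mathbf{u}$ with values in $\Omega$, and $\phi(s,x,\mathbf{u})$ is the solution with $\phi(0,x,\mathbf{u})=x$ (defined for all $s\in\mathbb{R}$). $\mathcal{O}^+(x)=\{\phi(S,x,\mathbf{u}):S>0,\mathbf{u}\in\mathcal{U}\}$. The system satisfies the Lie algebra rank condition (LARC) if the smallest Lie algebra of vector fields containing $f_0,f_1$ spans $T_xM$ at every $x\in M$. A subset $D\subset M$ is a control set if (i) for every $x\in D$ there is $\mathbf{u}\in\mathcal{U}$ with $\phi(\mathbb{R}^+,x,\mathbf{u})\subset D$; (ii) $D\subset\overline{\mathcal{O}^+(x)}$ for every $x\in D$; (iii) $D$ is maximal with respect to (i) and (ii). *)

theory Defs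
  imports "HOL-Analysis.Analysis" "HOL-Algebra.Coset"
begin

section \<open>The groups\<close>

type_synonym pt = "real \<times> (real ^ 2)"

definition theta :: "real ^ 2 ^ 2" where
  "theta = vector [vector [0, -1], vector [1, 0]]"

text \<open>The multiplication of the type class on \<open>real ^ 2 ^ 2\<close> is componentwise, so the overloaded
  \<open>exp\<close> and \<open>^\<close> are not the matrix operations; this is the matrix exponential series.\<close>

definition mat_exp :: "real ^ 'n ^ 'n \<Rightarrow> real ^ 'n ^ 'n" where
  "mat_exp B = (\<Sum>k. (1 / fact k) *\<^sub>R (((**) B) ^^ k) (mat 1))"

definition rho :: "real \<Rightarrow> real ^ 2 ^ 2" where
  "rho t = mat_exp (t *\<^sub>R theta)"

definition Lambda :: "real \<Rightarrow> real ^ 2 \<Rightarrow> real ^ 2" where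
  "Lambda t w = (LBINT s=0..t. rho s *v w)"

definition Gtheta :: "pt monoid" where
  "Gtheta = \<lparr>carrier = UNIV,
             monoid.mult = (\<lambda>(t1, v1) (t2, v2). (t1 + t2, v1 + rho t1 *v v2)),
             one = (0, 0)\<rparr>"

definition Zn :: "nat \<Rightarrow> pt set" where
  "Zn n = {(2 * of_int k * real n * pi, 0) |k :: int. True}"

definition SE2 :: "nat \<Rightarrow> pt set monoid" where
  "SE2 n = Gtheta Mod Zn n"

text \<open>The coset of \<open>(t, v)\<close> is \<open>{t + 2 n k \<pi>} \<times> {v}\<close> with \<open>k\<close> ranging over the integers,
  which is what is written \<open>([t], v)\<close>; see \<open>proj_eq\<close> below.\<close>

definition proj :: "nat \<Rightarrow> pt \<Rightarrow> pt set" where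
  "proj n g = Zn n #>\<^bsub>Gtheta\<^esub> g"

section \<open>Vector fields on \<open>G(\<theta>)\<close>\<close>

definition linear_field :: "real ^ 2 ^ 2 \<Rightarrow> real ^ 2 \<Rightarrow> pt \<Rightarrow> pt" where
  "linear_field A \<xi> = (\<lambda>(t, v). (0, A *v v + Lambda t \<xi>))"

definition invariant_field :: "real \<Rightarrow> real ^ 2 \<Rightarrow> pt \<Rightarrow> pt" where
  "invariant_field \<alpha> \<eta> = (\<lambda>(t, v). (\<alpha>, rho t *v \<eta>))"

section \<open>Control systems\<close>

text \<open>The manifold is \<open>M = range p\<close>, where \<open>p\<close> maps a Euclidean space onto \<open>M\<close> and is a covering
  whose deck transformations are translations. It is used with \<open>p = id\<close>, giving \<open>G(\<theta>)\<close>, and with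
  \<open>p = proj n\<close>, giving \<open>SE(2)_n\<close>. The topology and the smooth structure of \<open>M\<close> are those
  making \<open>p\<close> a local diffeomorphism. The differential of \<open>p\<close> identifies each tangent space of \<open>M\<close>
  with the Euclidean space, and does so independently of the chosen point of the fibre, because
  translations have the identity as derivative. Hence a vector field on \<open>M\<close> is
  a function from \<open>M\<close> to the Euclidean space.\<close>

definition quot_top :: "('e::euclidean_space \<Rightarrow> 'm) \<Rightarrow> 'm topology" where
  "quot_top p = topology (\<lambda>U. U \<subseteq> range p \<and> open (p -` U))"

definition lift_pt :: "('e \<Rightarrow> 'm) \<Rightarrow> 'm \<Rightarrow> 'e" where
  "lift_pt p q = (SOME x. p x = q)"

text \<open>The vector field on \<open>M\<close> with the same formula as the field \<open>F\<close> upstairs, hence \<open>p\<close>-related to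
  it. It is meaningful for \<open>F\<close> constant on the fibres of \<open>p\<close>; see \<open>descend_linear_field\<close> and
  \<open>descend_invariant_field\<close> below.\<close>

definition descend :: "('e \<Rightarrow> 'm) \<Rightarrow> ('e \<Rightarrow> 'e) \<Rightarrow> 'm \<Rightarrow> 'e" where
  "descend p F q = F (lift_pt p q)"

text \<open>The tangent vector of a curve in \<open>M\<close>, computed on a local lift.\<close>

definition has_velocity :: "('e::euclidean_space \<Rightarrow> 'm) \<Rightarrow> (real \<Rightarrow> 'm) \<Rightarrow> 'e \<Rightarrow> real \<Rightarrow> bool" where
  "has_velocity p \<gamma> w s \<longleftrightarrow>
     (\<exists>\<sigma>. (\<forall>\<^sub>F r in nhds s. p (\<sigma> r) = \<gamma> r) \<and> (\<sigma> has_vector_derivative w) (at s))"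

definition euclidean_bracket :: "('e::euclidean_space \<Rightarrow> 'e) \<Rightarrow> ('e \<Rightarrow> 'e) \<Rightarrow> 'e \<Rightarrow> 'e" where
  "euclidean_bracket F H x =
     frechet_derivative H (at x) (F x) - frechet_derivative F (at x) (H x)"

definition bracket ::
  "('e::euclidean_space \<Rightarrow> 'm) \<Rightarrow> ('m \<Rightarrow> 'e) \<Rightarrow> ('m \<Rightarrow> 'e) \<Rightarrow> 'm \<Rightarrow> 'e" where
  "bracket p F H q = euclidean_bracket (F \<circ> p) (H \<circ> p) (lift_pt p q)"

inductive_set lie_algebra ::
  "('e::euclidean_space \<Rightarrow> 'm) \<Rightarrow> ('m \<Rightarrow> 'e) \<Rightarrow> ('m \<Rightarrow> 'e) \<Rightarrow> ('m \<Rightarrow> 'e) set"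
  for p f0 f1 where
  drift: "f0 \<in> lie_algebra p f0 f1"
| control: "f1 \<in> lie_algebra p f0 f1"
| add: "\<lbrakk>F \<in> lie_algebra p f0 f1; H \<in> lie_algebra p f0 f1\<rbrakk>
         \<Longrightarrow> (\<lambda>q. F q + H q) \<in> lie_algebra p f0 f1"
| scale: "F \<in> lie_algebra p f0 f1 \<Longrightarrow> (\<lambda>q. c *\<^sub>R F q) \<in> lie_algebra p f0 f1"
| bracket: "\<lbrakk>F \<in> lie_algebra p f0 f1; H \<in> lie_algebra p f0 f1\<rbrakk>
         \<Longrightarrow> bracket p F H \<in> lie_algebra p f0 f1"

definition LARC :: "('e::euclidean_space \<Rightarrow> 'm) \<Rightarrow> ('m \<Rightarrow> 'e) \<Rightarrow> ('m \<Rightarrow> 'e) \<Rightarrow> bool" where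
  "LARC p f0 f1 \<longleftrightarrow> (\<forall>q \<in> range p. span {F q |F. F \<in> lie_algebra p f0 f1} = UNIV)"

text \<open>Piecewise constant: finitely many jumps in each bounded interval; the values at the jumps are
  arbitrary elements of \<open>\<Omega>\<close>.\<close>

definition controls :: "real set \<Rightarrow> (real \<Rightarrow> real) set" where
  "controls \<Omega> = {u. range u \<subseteq> \<Omega> \<and>
     (\<exists>J. (\<forall>a b. finite (J \<inter> {a..b})) \<and> (\<forall>a b. a \<le> b \<longrightarrow> {a..b} \<inter> J = {} \<longrightarrow> u a = u b))}"

text \<open>\<open>solution p f0 f1 u x \<gamma>\<close>: the curve \<open>\<gamma>\<close> is \<open>\<phi>(\<cdot>, x, u)\<close>.\<close>

definition solution ::
  "('e::euclidean_space \<Rightarrow> 'm) \<Rightarrow> ('m \<Rightarrow> 'e) \<Rightarrow> ('m \<Rightarrow> 'e) \<Rightarrow> (real \<Rightarrow> real) \<Rightarrow> 'm \<Rightarrow> (real \<Rightarrow> 'm) \<Rightarrow> bool"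
where
  "solution p f0 f1 u x \<gamma> \<longleftrightarrow> \<gamma> 0 = x \<and> continuous_map euclideanreal (quot_top p) \<gamma> \<and>
     (\<forall>s. isCont u s \<longrightarrow> has_velocity p \<gamma> (f0 (\<gamma> s) + u s *\<^sub>R f1 (\<gamma> s)) s)"

definition pos_orbit ::
  "('e::euclidean_space \<Rightarrow> 'm) \<Rightarrow> ('m \<Rightarrow> 'e) \<Rightarrow> ('m \<Rightarrow> 'e) \<Rightarrow> real set \<Rightarrow> 'm \<Rightarrow> 'm set" where
  "pos_orbit p f0 f1 \<Omega> x =
     {\<gamma> S |\<gamma> S u. S > 0 \<and> u \<in> controls \<Omega> \<and> solution p f0 f1 u x \<gamma>}"

definition pre_control_set ::
  "('e::euclidean_space \<Rightarrow> 'm) \<Rightarrow> ('m \<Rightarrow> 'e) \<Rightarrow> ('m \<Rightarrow> 'e) \<Rightarrow> real set \<Rightarrow> 'm set \<Rightarrow> bool" where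
  "pre_control_set p f0 f1 \<Omega> D \<longleftrightarrow> D \<subseteq> range p \<and>
     (\<forall>x \<in> D. \<exists>u \<in> controls \<Omega>. \<exists>\<gamma>. solution p f0 f1 u x \<gamma> \<and> \<gamma> ` {0..} \<subseteq> D) \<and>
     (\<forall>x \<in> D. D \<subseteq> quot_top p closure_of pos_orbit p f0 f1 \<Omega> x)"

definition control_set ::
  "('e::euclidean_space \<Rightarrow> 'm) \<Rightarrow> ('m \<Rightarrow> 'e) \<Rightarrow> ('m \<Rightarrow> 'e) \<Rightarrow> real set \<Rightarrow> 'm set \<Rightarrow> bool" where
  "control_set p f0 f1 \<Omega> D \<longleftrightarrow> pre_control_set p f0 f1 \<Omega> D \<and>
     (\<forall>D'. pre_control_set p f0 f1 \<Omega> D' \<longrightarrow> D \<subseteq> D' \<longrightarrow> D' = D)"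

section \<open>Consistency of the encoding\<close>

lemma openin_quot_top: "openin (quot_top p) U \<longleftrightarrow> U \<subseteq> range p \<and> open (p -` U)"
proof -
  have "istopology (\<lambda>U. U \<subseteq> range p \<and> open (p -` U))"
    unfolding istopology_def by (auto simp: vimage_Union)
  then show ?thesis
    by (simp add: quot_top_def topology_inverse')
qed

lemma quot_top_id: "quot_top id = euclidean"
  by (simp add: topology_eq openin_quot_top)

lemma topspace_quot_top: "topspace (quot_top p) = range p"
  by (metis openin_quot_top openin_subset openin_topspace open_UNIV subset_antisym subset_refl
      vimage_UNIV surjI vimage_eq UNIV_eq_I rangeI)

lemma rho_eq: "rho t = vector [vector [cos t, - sin t], vector [sin t, cos t]]"
proof -
  define B where "B = t *\<^sub>R theta"
  have pow: "(((**) B) ^^ k) (mat 1) =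
      vector [vector [fact k * cos_coeff k * t ^ k, - (fact k * sin_coeff k * t ^ k)],
              vector [fact k * sin_coeff k * t ^ k, fact k * cos_coeff k * t ^ k]]" for k
  proof (induction k)
    case 0
    show ?case by (simp add: vec_eq_iff forall_2 mat_def)
  next
    case (Suc k)
    have "fact (Suc k) * cos_coeff (Suc k) = - (fact k * sin_coeff k)"
         "fact (Suc k) * sin_coeff (Suc k) = fact k * cos_coeff k"
      by (simp_all add: cos_coeff_Suc sin_coeff_Suc field_simps del: of_nat_Suc)
    moreover have "(((**) B) ^^ Suc k) (mat 1) = B ** (((**) B) ^^ k) (mat 1)"
      by simp
    moreover have "B ** vector [vector [c, - d], vector [d, c]] =
        (vector [vector [- t * d, - t * c], vector [t * c, - t * d]] :: real ^ 2 ^ 2)" for c d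
      by (simp add: vec_eq_iff forall_2 matrix_matrix_mult_def sum_2 B_def theta_def)
    ultimately show ?case
      by (simp only: Suc.IH) (simp add: ac_simps del: fact_Suc)
  qed
  have "(\<lambda>k. (1 / fact k) *\<^sub>R (((**) B) ^^ k) (mat 1)) sums
      vector [vector [cos t, - sin t], vector [sin t, cos t]]"
    unfolding sums_def
  proof (intro vec_tendstoI)
    fix i j :: 2
    have c: "(\<lambda>k. cos_coeff k * t ^ k) sums cos t" and s: "(\<lambda>k. sin_coeff k * t ^ k) sums sin t"
      using cos_converges[of t] sin_converges[of t] by simp_all
    have "(\<lambda>k. ((1 / fact k) *\<^sub>R (((**) B) ^^ k) (mat 1)) $ i $ j) sums
        (vector [vector [cos t, - sin t], vector [sin t, cos t]] :: real ^ 2 ^ 2) $ i $ j"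
      using exhaust_2[of i] exhaust_2[of j] c s sums_minus[OF s] by (auto simp: pow)
    then show "((\<lambda>m. (\<Sum>k<m. (1 / fact k) *\<^sub>R (((**) B) ^^ k) (mat 1)) $ i $ j) \<longlongrightarrow>
        (vector [vector [cos t, - sin t], vector [sin t, cos t]] :: real ^ 2 ^ 2) $ i $ j) sequentially"
      by (simp add: sums_def)
  qed
  then show ?thesis
    by (simp add: rho_def mat_exp_def B_def sums_iff)
qed

lemma rho_mult: "rho t *v w = vector [cos t * w $ 1 - sin t * w $ 2, sin t * w $ 1 + cos t * w $ 2]"
  by (simp add: rho_eq vec_eq_iff forall_2 matrix_vector_mult_def sum_2)

lemma Lambda_eq:
  "Lambda t w = vector [sin t * w $ 1 - (1 - cos t) * w $ 2, (1 - cos t) * w $ 1 + sin t * w $ 2]"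
proof -
  define F :: "real \<Rightarrow> real ^ 2" where
    "F s = vector [sin s * w $ 1 - (1 - cos s) * w $ 2, (1 - cos s) * w $ 1 + sin s * w $ 2]" for s
  have comb: "vector [a, b] = a *\<^sub>R axis 1 1 + b *\<^sub>R (axis 2 1 :: real ^ 2)" for a b
    by (simp add: vec_eq_iff forall_2 axis_def)
  have "(F has_vector_derivative rho s *v w) (at s within X)" for s X
    unfolding F_def rho_mult comb
    by (auto intro!: derivative_eq_intros)
  moreover have "continuous_on X (\<lambda>s. rho s *v w)" for X
    unfolding rho_mult comb by (intro continuous_intros)
  ultimately have "Lambda t w = F t - F 0"
    unfolding Lambda_def zero_ereal_def by (intro interval_integral_FTC_finite)
  then show ?thesis
    by (simp add: F_def vec_eq_iff forall_2)
qed

lemma group_Gtheta: "group Gtheta"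
proof (rule groupI)
  fix x assume "x \<in> carrier Gtheta"
  obtain t v where x: "x = (t, v)" by (cases x)
  have "(- t, - (rho (- t) *v v)) \<otimes>\<^bsub>Gtheta\<^esub> x = \<one>\<^bsub>Gtheta\<^esub>"
    by (simp add: Gtheta_def x)
  then show "\<exists>y\<in>carrier Gtheta. y \<otimes>\<^bsub>Gtheta\<^esub> x = \<one>\<^bsub>Gtheta\<^esub>"
    by (rule bexI) (simp add: Gtheta_def)
qed (auto simp: Gtheta_def rho_mult vec_eq_iff forall_2 cos_add sin_add algebra_simps)

lemma cos_sin_Zn:
  "cos (2 * of_int k * real n * pi) = 1" "sin (2 * of_int k * real n * pi) = 0"
  using cos_int_2pin[of "k * int n"] sin_int_2pin[of "k * int n"] by (simp_all add: ac_simps)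

lemma normal_Zn: "Zn n \<lhd> Gtheta"
proof -
  interpret group Gtheta by (rule group_Gtheta)
  have inv_Zn: "inv\<^bsub>Gtheta\<^esub> (2 * of_int k * real n * pi, 0) = (2 * of_int (- k) * real n * pi, 0)" for k
    by (rule inv_equality) (auto simp: Gtheta_def)
  have sub: "subgroup (Zn n) Gtheta"
  proof (rule subgroupI)
    show "Zn n \<subseteq> carrier Gtheta" by (simp add: Gtheta_def)
    show "Zn n \<noteq> {}" by (auto simp: Zn_def)
    show "inv\<^bsub>Gtheta\<^esub> a \<in> Zn n" if "a \<in> Zn n" for a
      using that inv_Zn unfolding Zn_def by blast
    show "a \<otimes>\<^bsub>Gtheta\<^esub> b \<in> Zn n" if ab: "a \<in> Zn n" "b \<in> Zn n" for a b
    proof -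
      obtain k l :: int where "a = (2 * of_int k * real n * pi, 0)" "b = (2 * of_int l * real n * pi, 0)"
        using ab by (auto simp: Zn_def)
      then show ?thesis
        by (auto simp: Zn_def Gtheta_def algebra_simps intro!: exI[of _ "k + l"])
    qed
  qed
  have comm: "z \<otimes>\<^bsub>Gtheta\<^esub> x = x \<otimes>\<^bsub>Gtheta\<^esub> z" if "z \<in> Zn n" for x z
    using that by (cases x) (auto simp: Gtheta_def Zn_def rho_mult cos_sin_Zn vec_eq_iff forall_2)
  show ?thesis
    by (intro normalI sub ballI) (auto simp: r_coset_def l_coset_def comm)
qed

lemma range_proj: "range (proj n) = carrier (SE2 n)"
  by (auto simp: proj_def[abs_def] SE2_def FactGroup_def RCOSETS_def Gtheta_def)

lemma proj_eq: "proj n (t, v) = {t + 2 * of_int k * real n * pi |k :: int. True} \<times> {v}"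
  by (auto simp: proj_def r_coset_def Gtheta_def Zn_def rho_mult cos_sin_Zn vec_eq_iff forall_2)

lemma descend_proj:
  assumes "\<And>t v k. F (t + 2 * of_int k * real n * pi, v) = F (t, v)"
  shows "descend (proj n) F (proj n g) = F g"
proof -
  obtain t v where g: "g = (t, v)" by (cases g)
  obtain t' v' where h: "lift_pt (proj n) (proj n g) = (t', v')" by fastforce
  have "proj n (lift_pt (proj n) (proj n g)) = proj n g"
    unfolding lift_pt_def by (rule someI[of _ g]) simp
  then have eq: "proj n (t', v') = proj n (t, v)" using h g by metis
  have "(t', v') \<in> proj n (t', v')"
    unfolding proj_eq by (auto intro!: exI[of _ 0])
  then have "(t', v') \<in> proj n (t, v)" using eq by simp
  then obtain k :: int where "t' = t + 2 * of_int k * real n * pi" "v' = v"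
    unfolding proj_eq by auto
  then show ?thesis using assms by (simp add: descend_def h[unfolded g] g)
qed

lemma descend_linear_field:
  "descend (proj n) (linear_field A \<xi>) (proj n (t, v)) = (0, A *v v + Lambda t \<xi>)"
  by (subst descend_proj) (simp_all add: linear_field_def Lambda_eq cos_add sin_add cos_sin_Zn)

lemma descend_invariant_field:
  "descend (proj n) (invariant_field \<alpha> \<eta>) (proj n (t, v)) = (\<alpha>, rho t *v \<eta>)"
  by (subst descend_proj) (simp_all add: invariant_field_def rho_mult cos_add sin_add cos_sin_Zn)

end

theory Submission
  imports Defs
begin

text \<open>Identify \<open>\<real>\<^sup>2\<close> with the complex plane. Then \<open>\<rho>\<^sub>t\<close> is multiplication by \<open>e\<^sup>\<i>\<^sup>t\<close>, and since \<open>A\<close> commutes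
  with \<open>\<theta>\<close> it is multiplication by a complex number \<open>lam\<close> with \<open>det A = \<bar>lam\<bar>\<^sup>2\<close>. The rank condition
  forces \<open>\<alpha> \<noteq> 0\<close> and \<open>\<alpha> \<xi> + lam \<eta> \<noteq> 0\<close> (\<open>LARC_nondegenerate\<close>). After subtracting the motion along the
  left-invariant field and rescaling, the system takes the normal form
  \<open>t' = w\<close>, \<open>z' = lam z + e\<^sup>\<i>\<^sup>t - 1\<close> with \<open>w = \<alpha> u\<close>, on the group as well as on its quotients; its
  solutions are unique and explicit (\<open>solution_iff\<close>).

  If \<open>lam = 0\<close>, the real part of \<open>z\<close> never increases along a trajectory, hence it is constant on every
  control set, and no control set has interior points. The points with \<open>t = 0\<close> are equilibria of the
  uncontrolled system. By Zorn's lemma each lies in a control set, and those with different real parts of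
  \<open>z\<close> lie in different ones (\<open>singular_control_sets\<close>).

  If \<open>lam \<noteq> 0\<close>, put \<open>r = e\<^sup>-\<^sup>\<i>\<^sup>t (z - 1 / lam)\<close>. Then \<open>r' = (lam - \<i> w) r + 1\<close>, where \<open>t\<close> has
  disappeared; in the coordinates \<open>(t, r)\<close> the group and its quotients differ only in the translations of
  \<open>t\<close> by which one divides. It is therefore enough to find one set \<open>C\<close> in the \<open>(t, r)\<close>-space that
  satisfies the first two conditions on a control set for every period and contains every such set with
  interior points (\<open>recurrent_core\<close>). Its images in \<open>G(\<theta>)\<close> and in \<open>SE(2)\<^sub>n\<close> are the two control sets, and
  one is the preimage of the other because \<open>C\<close> is invariant under all translations of \<open>t\<close>.

  For \<open>Re lam < 0\<close> the flow contracts the \<open>r\<close>-plane, and \<open>C\<close> is the closure of the orbit of the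
  equilibrium \<open>r = - 1 / lam\<close>: every trajectory can be steered to the equilibrium, and every point that
  returns near itself after long times is a limit of points reachable from there. For \<open>Re lam > 0\<close> time
  reversal leads back to this case, and \<open>C\<close> is the interior of the reversed attractor; here approximate
  reachability must be made exact, which follows from the fact that orbits have interior points arbitrarily
  close to their origin (\<open>accessibility\<close>). For \<open>Re lam = 0\<close> constant controls act on \<open>r\<close> as rotations
  about different centres, and these generate all motions needed to steer any point to any other
  (\<open>neutral_reaches_everything\<close>).\<close>

section \<open>Piecewise constant controls and their primitives\<close>

text \<open>The witness hidden in the definition of a piecewise constant control, kept explicit because it has to be
  transported along shifts, reflections and concatenations of controls.\<close>

definition jump_set :: "real set \<Rightarrow> (real \<Rightarrow> 'a) \<Rightarrow> bool" where
  "jump_set J u \<longleftrightarrow> (\<forall>a b. finite (J \<inter> {a..b})) \<and> (\<forall>a b. a \<le> b \<longrightarrow> {a..b} \<inter> J = {} \<longrightarrow> u a = u b)"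

lemma controls_iff: "u \<in> controls U \<longleftrightarrow> range u \<subseteq> U \<and> (\<exists>J. jump_set J u)"
  by (simp add: controls_def jump_set_def)

lemma jump_set_const: "jump_set {} (\<lambda>s. c)"
  by (simp add: jump_set_def)

lemma jump_set_comp: "jump_set J u \<Longrightarrow> jump_set J (\<lambda>s. f (u s))"
  unfolding jump_set_def by metis

lemma jump_set_shift:
  assumes "jump_set J u"
  shows "jump_set ((+) a -` J) (\<lambda>s. u (a + s))"
  unfolding jump_set_def
proof (intro conjI allI impI)
  fix c d :: real
  have "(+) a -` J \<inter> {c..d} = (+) a -` (J \<inter> {a + c..a + d})" by auto
  then show "finite ((+) a -` J \<inter> {c..d})"
    using assms by (simp add: jump_set_def finite_vimageI del: vimage_Int)
  assume *: "c \<le> d" "{c..d} \<inter> (+) a -` J = {}"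
  have "{a + c..a + d} \<inter> J = {}"
  proof (rule ccontr)
    assume "{a + c..a + d} \<inter> J \<noteq> {}"
    then obtain x where "x \<in> J" "a + c \<le> x" "x \<le> a + d" by auto
    then have "x - a \<in> {c..d} \<inter> (+) a -` J" by auto
    with * show False by blast
  qed
  then show "u (a + c) = u (a + d)"
    using assms * by (simp add: jump_set_def)
qed

lemma jump_set_reflect:
  assumes "jump_set J u"
  shows "jump_set ((-) a -` J) (\<lambda>s. u (a - s))"
  unfolding jump_set_def
proof (intro conjI allI impI)
  fix c d :: real
  have "(-) a -` J \<inter> {c..d} = (-) a -` (J \<inter> {a - d..a - c})" by auto
  then show "finite ((-) a -` J \<inter> {c..d})"
    using assms by (simp add: jump_set_def finite_vimageI inj_on_def del: vimage_Int)
  assume *: "c \<le> d" "{c..d} \<inter> (-) a -` J = {}"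
  have "{a - d..a - c} \<inter> J = {}"
  proof (rule ccontr)
    assume "{a - d..a - c} \<inter> J \<noteq> {}"
    then obtain x where "x \<in> J" "a - d \<le> x" "x \<le> a - c" by auto
    then have "a - x \<in> {c..d} \<inter> (-) a -` J" by auto
    with * show False by blast
  qed
  then have "u (a - d) = u (a - c)"
    using assms * by (simp add: jump_set_def)
  then show "u (a - c) = u (a - d)" ..
qed

lemma jump_set_concat:
  assumes "jump_set J u" "jump_set K w"
  shows "jump_set (insert S (J \<union> (\<lambda>s. s - S) -` K)) (\<lambda>s. if s < S then u s else w (s - S))"
  unfolding jump_set_def
proof (intro conjI allI impI)
  fix c d :: real
  have "(\<lambda>s. s - S) -` K \<inter> {c..d} = (\<lambda>s. s - S) -` (K \<inter> {c - S..d - S})" by auto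
  then have "finite ((\<lambda>s. s - S) -` K \<inter> {c..d})"
    using assms by (simp add: jump_set_def finite_vimageI inj_on_def del: vimage_Int)
  then show "finite (insert S (J \<union> (\<lambda>s. s - S) -` K) \<inter> {c..d})"
    using assms by (simp add: jump_set_def Int_Un_distrib2 Int_insert_left)
  assume *: "c \<le> d" "{c..d} \<inter> insert S (J \<union> (\<lambda>s. s - S) -` K) = {}"
  have "{c - S..d - S} \<inter> K = {}"
  proof (rule ccontr)
    assume "{c - S..d - S} \<inter> K \<noteq> {}"
    then obtain x where "x \<in> K" "c - S \<le> x" "x \<le> d - S" by auto
    then have "x + S \<in> {c..d} \<inter> (\<lambda>s. s - S) -` K" by auto
    with * show False by blast
  qed
  moreover have "{c..d} \<inter> J = {}" and S: "S \<notin> {c..d}" using * by auto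
  ultimately have "u c = u d" "w (c - S) = w (d - S)"
    using assms * by (simp_all add: jump_set_def)
  moreover have "d < S \<or> S < c" using S by auto
  ultimately show "(if c < S then u c else w (c - S)) = (if d < S then u d else w (d - S))"
    using * by auto
qed

text \<open>A multiple of \<open>S\<close> is always a possible jump, since there the two ends of a period are glued
  together; the other jumps are the translates of those within one period.\<close>

lemma jump_set_periodic:
  fixes u :: "real \<Rightarrow> 'a"
  assumes J: "jump_set J u" and S: "S > 0"
  shows "\<exists>K. jump_set K (\<lambda>s. u (s - S * of_int \<lfloor>s / S\<rfloor>))"
proof -
  define K where "K = (\<Union>k::int. (\<lambda>x. x + S * of_int k) ` insert 0 (J \<inter> {0..S}))"
  have bnd: "S * of_int \<lfloor>s / S\<rfloor> \<le> s" "s < S * of_int \<lfloor>s / S\<rfloor> + S" for s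
  proof -
    have "of_int \<lfloor>s / S\<rfloor> \<le> s / S" "s / S < of_int \<lfloor>s / S\<rfloor> + 1" by linarith+
    then show "S * of_int \<lfloor>s / S\<rfloor> \<le> s" "s < S * of_int \<lfloor>s / S\<rfloor> + S"
      using S by (simp_all only: pos_le_divide_eq pos_divide_less_eq) (simp_all add: algebra_simps)
  qed
  have "finite (K \<inter> {a..b})" for a b
  proof -
    have "K \<inter> {a..b} \<subseteq> (\<Union>k\<in>{\<lfloor>a / S\<rfloor> - 1..\<lfloor>b / S\<rfloor>}. (\<lambda>x. x + S * of_int k) ` insert 0 (J \<inter> {0..S}))"
    proof
      fix y assume y: "y \<in> K \<inter> {a..b}"
      then obtain k x where k: "y = x + S * of_int k" "x \<in> insert 0 (J \<inter> {0..S})"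
        unfolding K_def by fast
      then have x: "0 \<le> x" "x \<le> S" using S by auto
      have "S * of_int k \<le> b" "a \<le> S * of_int k + S" using x k y by auto
      then have "of_int k \<le> b / S" "a / S \<le> of_int k + 1" using S by (simp_all add: field_simps)
      then have "k \<in> {\<lfloor>a / S\<rfloor> - 1..\<lfloor>b / S\<rfloor>}" by (auto simp: le_floor_iff) linarith
      then show "y \<in> (\<Union>k\<in>{\<lfloor>a / S\<rfloor> - 1..\<lfloor>b / S\<rfloor>}. (\<lambda>x. x + S * of_int k) ` insert 0 (J \<inter> {0..S}))"
        using k by blast
    qed
    moreover have "finite (J \<inter> {0..S})" using J by (simp add: jump_set_def)
    ultimately show ?thesis by (auto intro: finite_subset)
  qed
  moreover have "u (a - S * of_int \<lfloor>a / S\<rfloor>) = u (b - S * of_int \<lfloor>b / S\<rfloor>)"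
    if ab: "a \<le> b" "{a..b} \<inter> K = {}" for a b
  proof -
    have "S * of_int \<lfloor>b / S\<rfloor> \<in> K" unfolding K_def by auto
    then have "S * of_int \<lfloor>b / S\<rfloor> \<notin> {a..b}" using ab by blast
    then have "S * of_int \<lfloor>b / S\<rfloor> < a" using bnd(1)[of b] by auto
    then have "of_int \<lfloor>b / S\<rfloor> < a / S" using S by (simp add: field_simps)
    moreover have "\<lfloor>a / S\<rfloor> \<le> \<lfloor>b / S\<rfloor>" using ab S by (intro floor_mono divide_right_mono) auto
    ultimately have eq: "\<lfloor>a / S\<rfloor> = \<lfloor>b / S\<rfloor>" by linarith
    have "{a - S * of_int \<lfloor>a / S\<rfloor>..b - S * of_int \<lfloor>a / S\<rfloor>} \<inter> J = {}"
    proof (rule ccontr)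
      assume "\<not> ?thesis"
      then obtain x where x: "x \<in> J" "a - S * of_int \<lfloor>a / S\<rfloor> \<le> x" "x \<le> b - S * of_int \<lfloor>a / S\<rfloor>" by auto
      then have "x \<in> J \<inter> {0..S}" using bnd[of a] bnd[of b] eq by auto
      then have "x + S * of_int \<lfloor>a / S\<rfloor> \<in> K" unfolding K_def by blast
      moreover have "x + S * of_int \<lfloor>a / S\<rfloor> \<in> {a..b}" using x by auto
      ultimately show False using ab by blast
    qed
    then show ?thesis using J ab eq by (simp add: jump_set_def)
  qed
  ultimately show ?thesis unfolding jump_set_def by blast
qed

text \<open>A locally finite set is closed, so a point outside it has a neighbourhood on which the control is
  constant.\<close>

lemma isCont_off_jumps:
  fixes u :: "real \<Rightarrow> 'a::topological_space"
  assumes "jump_set J u" "s \<notin> J"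
  shows "isCont u s"
proof -
  have "finite (J \<inter> {s - 1..s + 1})" using assms by (simp add: jump_set_def)
  then have "open (- (J \<inter> {s - 1..s + 1}))" by (intro open_Compl finite_imp_closed)
  then obtain e where e: "e > 0" "ball s e \<subseteq> - (J \<inter> {s - 1..s + 1})"
    using assms unfolding open_contains_ball by blast
  have const: "u x = u s" if x: "x \<in> ball s (min e 1)" for x
  proof -
    have nJ: "y \<notin> J" if "y \<in> ball s (min e 1)" for y
    proof
      assume "y \<in> J"
      moreover have "y \<in> {s - 1..s + 1}" using that by (auto simp: dist_real_def)
      ultimately show False using that e(2) by auto
    qed
    have "{min x s..max x s} \<subseteq> ball s (min e 1)"
      using x by (auto simp: dist_real_def)
    then have "{min x s..max x s} \<inter> J = {}" using nJ by blast
    then have "u (min x s) = u (max x s)" using assms by (auto simp: jump_set_def)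
    then show ?thesis by (auto simp: min_def max_def split: if_splits)
  qed
  have "open (ball s (min e 1))" "s \<in> ball s (min e 1)" using e by auto
  then have "eventually (\<lambda>x. u x = u s) (nhds s)"
    unfolding eventually_nhds using const by blast
  then show ?thesis by (subst isCont_cong[of u "\<lambda>_. u s"]) auto
qed

text \<open>Splitting the interval at an interior jump lowers the number of jumps inside each part; without any, the
  function is constant up to its two end values.\<close>

lemma jump_set_integrable:
  fixes u :: "real \<Rightarrow> real"
  assumes J: "jump_set J u"
  shows "u integrable_on {a..b}"
proof (induction "card (J \<inter> {a<..<b})" arbitrary: a b rule: less_induct)
  case less
  have fin: "finite (J \<inter> {a<..<b})"
    using J by (auto simp: jump_set_def intro: finite_subset[of _ "J \<inter> {a..b}"])
  show ?case
  proof (cases "J \<inter> {a<..<b} = {}")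
    case True
    have const: "u x = u ((a + b) / 2)" if x: "a < x" "x < b" for x
    proof -
      have "{min x ((a + b) / 2)..max x ((a + b) / 2)} \<subseteq> {a<..<b}"
        using x by (auto simp: min_def max_def split: if_splits)
      then have "{min x ((a + b) / 2)..max x ((a + b) / 2)} \<inter> J = {}" using True by blast
      then have "u (min x ((a + b) / 2)) = u (max x ((a + b) / 2))"
        using J by (auto simp: jump_set_def)
      then show ?thesis by (auto simp: min_def max_def split: if_splits)
    qed
    show ?thesis
    proof (rule integrable_spike_finite[of "{a, b}" _ u "\<lambda>x. u ((a + b) / 2)"])
      show "u x = u ((a + b) / 2)" if "x \<in> {a..b} - {a, b}" for x
        using that by (intro const) auto
    qed auto
  next
    case False
    then obtain j where j: "j \<in> J" "a < j" "j < b" by auto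
    have "J \<inter> {a<..<j} \<subset> J \<inter> {a<..<b}" "J \<inter> {j<..<b} \<subset> J \<inter> {a<..<b}"
      using j by auto
    then have "u integrable_on {a..j}" "u integrable_on {j..b}"
      using fin by (auto intro!: less psubset_card_mono)
    then show ?thesis using j by (intro Henstock_Kurzweil_Integration.integrable_combine[of a j b]) auto
  qed
qed

text \<open>The uniqueness principle for trajectories: at a jump of the control a trajectory is continuous, but it
  need not be differentiable there.\<close>

lemma zero_derivative_const:
  fixes f :: "real \<Rightarrow> 'a::banach"
  assumes J: "\<And>a b. finite (J \<inter> {a..b})"
    and c: "continuous_on UNIV f"
    and d: "\<And>s. s \<notin> J \<Longrightarrow> (f has_vector_derivative 0) (at s)"
  shows "f s = f 0"
proof (rule has_derivative_zero_unique_strong_convex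
    [of "{min 0 s..max 0 s}" "J \<inter> {min 0 s..max 0 s}" f 0 "f 0" s])
  show "continuous_on {min 0 s..max 0 s} f" using c continuous_on_subset by blast
  fix x assume "x \<in> {min 0 s..max 0 s} - J \<inter> {min 0 s..max 0 s}"
  then have "(f has_vector_derivative 0) (at x)" using d by auto
  then show "(f has_derivative (\<lambda>h. 0)) (at x within {min 0 s..max 0 s})"
    by (simp add: has_vector_derivative_def has_derivative_at_withinI)
qed (use J in auto)

text \<open>The two integrals, at most one of them nonzero, give a primitive on the whole line: solutions run
  through all real times.\<close>

definition prim :: "(real \<Rightarrow> 'a::banach) \<Rightarrow> real \<Rightarrow> 'a" where
  "prim f s = integral {0..s} f - integral {s..0} f"

lemma prim_0 [simp]: "prim f 0 = 0"
  by (simp add: prim_def)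

lemma prim_from:
  assumes f: "\<And>a b. f integrable_on {a..b}" and c: "c \<le> 0" "c \<le> s"
  shows "prim f s = integral {c..s} f - integral {c..0} f"
proof (cases "0 \<le> s")
  case True
  have "integral {c..0} f + integral {0..s} f = integral {c..s} f"
    using True c f by (intro Henstock_Kurzweil_Integration.integral_combine) auto
  moreover have "integral {s..0} f = 0"
    using True by (cases "s = 0") auto
  ultimately show ?thesis by (simp add: prim_def algebra_simps)
next
  case False
  have "integral {c..s} f + integral {s..0} f = integral {c..0} f"
    using False c f by (intro Henstock_Kurzweil_Integration.integral_combine) auto
  then show ?thesis using False by (simp add: prim_def algebra_simps)
qed

lemma prim_deriv:
  assumes f: "\<And>a b. f integrable_on {a..b}" and s: "isCont f s"
  shows "(prim f has_vector_derivative f s) (at s)"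
proof -
  define c where "c = min 0 s - 1"
  have "((\<lambda>x. integral {c..x} f) has_vector_derivative f s) (at s within {c..s + 1} - {})"
    using s by (intro integral_has_vector_derivative_continuous_at f)
      (auto simp: c_def intro: continuous_at_imp_continuous_at_within)
  then have "((\<lambda>x. integral {c..x} f) has_vector_derivative f s) (at s)"
    by (subst (asm) at_within_interior) (auto simp: c_def)
  then have "((\<lambda>x. integral {c..x} f - integral {c..0} f) has_vector_derivative f s) (at s)"
    by (auto intro!: derivative_eq_intros)
  then show ?thesis
    by (rule has_vector_derivative_transform_within_open[of _ _ _ "{c<..}"])
       (auto simp: c_def intro!: prim_from[OF f, symmetric])
qed

lemma prim_cont:
  assumes f: "\<And>a b. f integrable_on {a..b}"
  shows "continuous_on UNIV (prim f)"
proof -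
  have "isCont (prim f) s" for s
  proof -
    define c where "c = min 0 s - 1"
    have "continuous_on {c..s + 1} (\<lambda>x. integral {c..x} f - integral {c..0} f)"
      by (intro continuous_intros indefinite_integral_continuous_1 f)
    then have "continuous_on {c<..<s + 1} (prim f)"
      by (rule continuous_on_eq[OF continuous_on_subset]) (auto simp: c_def intro!: prim_from[OF f, symmetric])
    then show ?thesis
      by (rule continuous_on_interior) (auto simp: c_def)
  qed
  then show ?thesis by (simp add: continuous_at_imp_continuous_on)
qed

text \<open>Shift and reflection formulas for integrals of controls are obtained from this by comparing
  derivatives away from the jumps.\<close>

lemma prim_unique:
  assumes f: "\<And>a b. f integrable_on {a..b}" and J: "\<And>a b. finite (J \<inter> {a..b})"
    and s: "\<And>s. s \<notin> J \<Longrightarrow> isCont f s"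
    and g: "continuous_on UNIV g" "\<And>s. s \<notin> J \<Longrightarrow> (g has_vector_derivative f s) (at s)"
  shows "prim f s = g s - g 0"
proof -
  have "g s - prim f s = g 0 - prim f 0"
  proof (rule zero_derivative_const[OF J])
    show "continuous_on UNIV (\<lambda>s. g s - prim f s)"
      by (intro continuous_intros g prim_cont f)
    show "((\<lambda>s. g s - prim f s) has_vector_derivative 0) (at r)" if "r \<notin> J" for r
      by (rule derivative_eq_intros g prim_deriv f s that)+ simp
  qed
  then show ?thesis by (simp add: algebra_simps)
qed

lemma prim_unique_cont:
  assumes f: "continuous_on UNIV f"
    and g: "\<And>s. (g has_vector_derivative f s) (at s)"
  shows "prim f s = g s - g 0"
proof (rule prim_unique[of _ "{}"])
  show "f integrable_on {a..b}" for a b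
    using f by (meson continuous_on_subset integrable_continuous_real top_greatest)
  show "isCont f s" for s using f by (simp add: continuous_on_eq_continuous_at)
  show "continuous_on UNIV g"
    using g by (meson continuous_at_imp_continuous_on has_vector_derivative_continuous)
qed (use g in auto)

lemma prim_deriv_cont:
  assumes f: "continuous_on UNIV f"
  shows "(prim f has_vector_derivative f s) (at s)"
proof (rule prim_deriv)
  show "f integrable_on {a..b}" for a b
    using f by (meson continuous_on_subset integrable_continuous_real top_greatest)
  show "isCont f s" using f by (simp add: continuous_on_eq_continuous_at)
qed

lemma prim_cong:
  assumes "0 \<le> s" "\<And>x. 0 < x \<Longrightarrow> x < s \<Longrightarrow> f x = g x"
  shows "prim f s = prim g s"
proof -
  have "integral {0..s} f = integral {0..s} g"
    by (rule integral_spike[of "{0, s}"]) (use assms in auto)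
  moreover have "integral {s..0} f = 0" "integral {s..0} g = 0"
    using assms by (cases "s = 0"; auto)+
  ultimately show ?thesis by (simp add: prim_def)
qed

section \<open>The flow in rotating coordinates\<close>

text \<open>The propagator of the homogeneous equation \<open>r' = (lam - \<i> u) r\<close>.\<close>

definition multiplier :: "complex \<Rightarrow> (real \<Rightarrow> real) \<Rightarrow> real \<Rightarrow> complex" where
  "multiplier lam u s = exp (lam * of_real s - \<i> * of_real (prim u s))"

text \<open>Variation of constants for the system \<open>t' = u\<close>, \<open>r' = (lam - \<i> u) r + 1\<close>. The equations do not
  involve \<open>t\<close>, so the flow commutes with the translations of \<open>t\<close>; it is affine in \<open>r\<close> with linear part
  the multiplier, whose modulus depends on the time alone.\<close>

definition flow :: "complex \<Rightarrow> (real \<Rightarrow> real) \<Rightarrow> real \<Rightarrow> real \<times> complex \<Rightarrow> real \<times> complex" where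
  "flow lam u s x = (fst x + prim u s,
     multiplier lam u s * (snd x + prim (\<lambda>\<sigma>. inverse (multiplier lam u \<sigma>)) s))"

definition orb :: "complex \<Rightarrow> real set \<Rightarrow> real \<times> complex \<Rightarrow> (real \<times> complex) set" where
  "orb lam U x = {flow lam u S x |u S. 0 < S \<and> u \<in> controls U}"

lemma prim_jump_cont: "jump_set J u \<Longrightarrow> continuous_on UNIV (prim (u :: real \<Rightarrow> real))"
  by (intro prim_cont jump_set_integrable)

lemma multiplier_cont: "jump_set J u \<Longrightarrow> continuous_on UNIV (multiplier lam u)"
  unfolding multiplier_def by (intro continuous_intros prim_jump_cont)

lemma multiplier_nz [simp]: "multiplier lam u s \<noteq> 0"
  by (simp add: multiplier_def)

lemma norm_multiplier: "norm (multiplier lam u s) = exp (Re lam * s)"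
  by (simp add: multiplier_def)

lemma inverse_multiplier_cont:
  "jump_set J u \<Longrightarrow> continuous_on UNIV (\<lambda>s. inverse (multiplier lam u s))"
  by (intro continuous_intros multiplier_cont) auto

lemma multiplier_0 [simp]: "multiplier lam u 0 = 1"
  by (simp add: multiplier_def)

lemma flow_0 [simp]: "flow lam u 0 x = x"
  by (simp add: flow_def)

lemma jump_set_finite: "jump_set J u \<Longrightarrow> finite (J \<inter> {a..b})"
  by (simp add: jump_set_def)

lemma prim_add:
  fixes u :: "real \<Rightarrow> real"
  assumes J: "jump_set J u"
  shows "prim u (a + b) = prim u a + prim (\<lambda>s. u (a + s)) b"
proof -
  note J' = jump_set_shift[OF J, of a]
  have "prim (\<lambda>s. u (a + s)) b = prim u (a + b) - prim u (a + 0)"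
  proof (rule prim_unique[where J = "(+) a -` J"])
    show "(\<lambda>s. u (a + s)) integrable_on {c..d}" for c d
      by (rule jump_set_integrable[OF J'])
    show "finite ((+) a -` J \<inter> {c..d})" for c d by (rule jump_set_finite[OF J'])
    show "isCont (\<lambda>s. u (a + s)) s" if "s \<notin> (+) a -` J" for s
      by (rule isCont_off_jumps[OF J' that])
    show "continuous_on UNIV (\<lambda>b. prim u (a + b))"
      by (intro continuous_on_compose2[OF prim_jump_cont[OF J]] continuous_intros) auto
    show "((\<lambda>b. prim u (a + b)) has_vector_derivative u (a + s)) (at s)" if "s \<notin> (+) a -` J" for s
    proof -
      have "((\<lambda>b. a + b) has_real_derivative 1) (at s)"
        by (auto intro!: derivative_eq_intros)
      moreover have "(prim u has_vector_derivative u (a + s)) (at (a + s))"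
        using that by (intro prim_deriv jump_set_integrable[OF J] isCont_off_jumps[OF J]) auto
      ultimately show ?thesis
        using DERIV_chain2[of "prim u" "u (a + s)" "\<lambda>b. a + b" s 1 UNIV]
        by (simp add: has_real_derivative_iff_has_vector_derivative[symmetric])
    qed
  qed
  then show ?thesis by simp
qed

lemma multiplier_add:
  assumes J: "jump_set J u"
  shows "multiplier lam u (a + b) = multiplier lam u a * multiplier lam (\<lambda>s. u (a + s)) b"
  unfolding multiplier_def prim_add[OF J] by (simp add: exp_add[symmetric] algebra_simps)

lemma prim_inverse_multiplier_deriv:
  assumes J: "jump_set J u"
  shows "(prim (\<lambda>\<sigma>. inverse (multiplier lam u \<sigma>)) has_vector_derivative
    inverse (multiplier lam u s)) (at s)"
  using prim_deriv_cont[OF inverse_multiplier_cont[OF J]] .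

lemma flow_add:
  assumes J: "jump_set J u"
  shows "flow lam u (a + b) x = flow lam (\<lambda>s. u (a + s)) b (flow lam u a x)"
proof -
  note J' = jump_set_shift[OF J, of a]
  let ?P = "prim (\<lambda>\<sigma>. inverse (multiplier lam u \<sigma>))"
  have "prim (\<lambda>\<sigma>. inverse (multiplier lam (\<lambda>s. u (a + s)) \<sigma>)) b =
    multiplier lam u a * ?P (a + b) - multiplier lam u a * ?P (a + 0)"
  proof (rule prim_unique_cont[OF inverse_multiplier_cont[OF J']])
    fix s
    have "((\<lambda>b. a + b) has_vector_derivative 1) (at s)"
      by (auto intro!: derivative_eq_intros)
    from vector_diff_chain_at[OF this prim_inverse_multiplier_deriv[OF J]]
    have "((\<lambda>b. ?P (a + b)) has_vector_derivative inverse (multiplier lam u (a + s))) (at s)"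
      by (simp add: o_def)
    then have "((\<lambda>b. multiplier lam u a * ?P (a + b)) has_vector_derivative
        multiplier lam u a * inverse (multiplier lam u (a + s))) (at s)"
      by (intro derivative_intros)
    moreover have "multiplier lam u a * inverse (multiplier lam u (a + s)) =
        inverse (multiplier lam (\<lambda>s. u (a + s)) s)"
      by (simp add: multiplier_add[OF J] field_simps)
    ultimately show "((\<lambda>b. multiplier lam u a * ?P (a + b)) has_vector_derivative
        inverse (multiplier lam (\<lambda>s. u (a + s)) s)) (at s)"
      by simp
  qed
  then show ?thesis
    by (simp add: flow_def prim_add[OF J] multiplier_add[OF J] algebra_simps)
qed

lemma flow_cong:
  assumes "0 \<le> s" "\<And>\<sigma>. 0 < \<sigma> \<Longrightarrow> \<sigma> < s \<Longrightarrow> u \<sigma> = w \<sigma>"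
  shows "flow lam u s x = flow lam w s x"
proof -
  have p: "prim u \<sigma> = prim w \<sigma>" if "0 \<le> \<sigma>" "\<sigma> \<le> s" for \<sigma>
    using that assms by (intro prim_cong) auto
  then have m: "multiplier lam u \<sigma> = multiplier lam w \<sigma>" if "0 \<le> \<sigma>" "\<sigma> \<le> s" for \<sigma>
    using that by (simp add: multiplier_def)
  have "prim (\<lambda>\<sigma>. inverse (multiplier lam u \<sigma>)) s = prim (\<lambda>\<sigma>. inverse (multiplier lam w \<sigma>)) s"
    using assms(1) by (intro prim_cong) (auto simp: m)
  then show ?thesis using assms p m by (simp add: flow_def)
qed

lemma flow_translate: "flow lam u s (x + (a, 0)) = flow lam u s x + (a, 0)"
  by (simp add: flow_def algebra_simps)

lemma fst_flow: "fst (flow lam u s x) = fst x + prim u s"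
  by (simp add: flow_def)

lemma flow_diff:
  "snd (flow lam u s x) - snd (flow lam u s y) = multiplier lam u s * (snd x - snd y)"
  by (simp add: flow_def algebra_simps)

lemma continuous_flow: "continuous_on UNIV (flow lam u s)"
  unfolding flow_def by (intro continuous_intros)

lemma has_vector_derivative_exp_real:
  "((\<lambda>s. exp (c * complex_of_real s)) has_vector_derivative c * exp (c * of_real s)) (at s)"
  by (rule has_vector_derivative_real_field[of "\<lambda>z. exp (c * z)"])
    (auto intro!: derivative_eq_intros)

lemma prim_const: "prim (\<lambda>_. c :: real) s = c * s"
  by (subst prim_unique_cont[of _ "\<lambda>s. c * s"]) (auto intro!: derivative_eq_intros)

lemma flow_const:
  assumes nu: "nu = lam - \<i> * of_real c" "nu \<noteq> 0"
  shows "flow lam (\<lambda>_. c) s x = (fst x + c * s, exp (nu * of_real s) * (snd x + 1 / nu) - 1 / nu)"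
proof -
  have m: "multiplier lam (\<lambda>_. c) \<sigma> = exp (nu * of_real \<sigma>)" for \<sigma>
    by (simp add: multiplier_def prim_const nu algebra_simps)
  have "prim (\<lambda>\<sigma>. exp (- nu * of_real \<sigma>)) s =
      - exp (- nu * of_real s) / nu - - exp (- nu * of_real 0) / nu"
  proof (rule prim_unique_cont)
    show "continuous_on UNIV (\<lambda>\<sigma>. exp (- nu * complex_of_real \<sigma>))"
      by (intro continuous_intros)
    show "((\<lambda>s. - exp (- nu * of_real s) / nu) has_vector_derivative exp (- nu * of_real s)) (at s)" for s
      using has_vector_derivative_mult_right[OF has_vector_derivative_exp_real[of "- nu" s], of "- 1 / nu"]
        nu(2) by simp
  qed
  moreover have "inverse (exp (nu * of_real \<sigma>)) = exp (- nu * of_real \<sigma>)" for \<sigma>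
    by (simp add: exp_minus)
  moreover have "exp (nu * of_real s) * (y + (- exp (- nu * of_real s) / nu - - exp (- nu * of_real 0) / nu)) =
      exp (nu * of_real s) * (y + 1 / nu) - 1 / nu" for y
  proof -
    have "e * (y + (- f / nu - - 1 / nu)) = e * (y + 1 / nu) - e * f / nu" for e f :: complex
      by (simp add: algebra_simps add_divide_distrib)
    moreover have "exp (nu * of_real s) * exp (- nu * of_real s) = 1"
      by (simp add: exp_minus)
    ultimately show ?thesis by (metis exp_zero mult_zero_right of_real_0)
  qed
  ultimately show ?thesis
    by (simp only: flow_def m prim_const)
qed

text \<open>The reflected control is also negated, since reversing time reverses the direction of \<open>t\<close>.\<close>

lemma prim_reflect:
  fixes u :: "real \<Rightarrow> real"
  assumes J: "jump_set J u"
  shows "prim (\<lambda>s. - u (S - s)) s = prim u (S - s) - prim u S"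
proof -
  note J' = jump_set_comp[OF jump_set_reflect[OF J, of S], of uminus]
  have "prim (\<lambda>s. - u (S - s)) s = prim u (S - s) - prim u (S - 0)"
  proof (rule prim_unique[where J = "(-) S -` J"])
    show "(\<lambda>s. - u (S - s)) integrable_on {c..d}" for c d
      by (rule jump_set_integrable[OF J'])
    show "finite ((-) S -` J \<inter> {c..d})" for c d by (rule jump_set_finite[OF J'])
    show "isCont (\<lambda>s. - u (S - s)) s" if "s \<notin> (-) S -` J" for s
      by (rule isCont_off_jumps[OF J' that])
    show "continuous_on UNIV (\<lambda>b. prim u (S - b))"
      by (intro continuous_on_compose2[OF prim_jump_cont[OF J]] continuous_intros) auto
    show "((\<lambda>b. prim u (S - b)) has_vector_derivative - u (S - s)) (at s)" if "s \<notin> (-) S -` J" for s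
    proof -
      have "((\<lambda>b. S - b) has_real_derivative -1) (at s)"
        by (auto intro!: derivative_eq_intros)
      moreover have "(prim u has_vector_derivative u (S - s)) (at (S - s))"
        using that by (intro prim_deriv jump_set_integrable[OF J] isCont_off_jumps[OF J]) auto
      ultimately show ?thesis
        using DERIV_chain2[of "prim u" "u (S - s)" "\<lambda>b. S - b" s "-1" UNIV]
        by (simp add: has_real_derivative_iff_has_vector_derivative[symmetric])
    qed
  qed
  then show ?thesis by simp
qed

definition mirror :: "real \<times> complex \<Rightarrow> real \<times> complex" where
  "mirror x = (fst x, - snd x)"

lemma mirror_mirror [simp]: "mirror (mirror x) = x"
  by (simp add: mirror_def)

text \<open>Running a trajectory backwards and changing the sign of \<open>r\<close> gives a trajectory of the system with
  \<open>- lam\<close> in place of \<open>lam\<close>. In this way the expanding case is reduced to the contracting one.\<close>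

lemma flow_reverse:
  assumes J: "jump_set J u"
  shows "flow (- lam) (\<lambda>s. - u (S - s)) S (mirror (flow lam u S x)) = mirror x"
proof -
  note J' = jump_set_comp[OF jump_set_reflect[OF J, of S], of uminus]
  let ?P = "prim (\<lambda>\<sigma>. inverse (multiplier lam u \<sigma>))"
  have m: "multiplier (- lam) (\<lambda>s. - u (S - s)) s = multiplier lam u (S - s) / multiplier lam u S" for s
    unfolding multiplier_def prim_reflect[OF J] by (simp add: exp_diff[symmetric] algebra_simps)
  have "prim (\<lambda>\<sigma>. inverse (multiplier (- lam) (\<lambda>s. - u (S - s)) \<sigma>)) S =
      - (multiplier lam u S * ?P (S - S)) - - (multiplier lam u S * ?P (S - 0))"
  proof (rule prim_unique_cont[OF inverse_multiplier_cont[OF J']])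
    fix s
    have "((\<lambda>b. S - b) has_vector_derivative -1) (at s)"
      by (auto intro!: derivative_eq_intros)
    from vector_diff_chain_at[OF this prim_inverse_multiplier_deriv[OF J]]
    have "((\<lambda>b. ?P (S - b)) has_vector_derivative - inverse (multiplier lam u (S - s))) (at s)"
      by (simp add: o_def)
    then have "((\<lambda>b. - (multiplier lam u S * ?P (S - b))) has_vector_derivative
        - (multiplier lam u S * - inverse (multiplier lam u (S - s)))) (at s)"
      by (intro derivative_intros)
    then show "((\<lambda>b. - (multiplier lam u S * ?P (S - b))) has_vector_derivative
        inverse (multiplier (- lam) (\<lambda>s. - u (S - s)) s)) (at s)"
      by (simp add: m field_simps)
  qed
  then show ?thesis
    by (simp add: flow_def mirror_def prim_reflect[OF J] m) (simp add: field_simps)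
qed

lemma control_jumps: "u \<in> controls U \<Longrightarrow> \<exists>J. jump_set J u"
  by (simp add: controls_iff)

lemma const_control: "c \<in> U \<Longrightarrow> (\<lambda>_. c) \<in> controls U"
  by (auto simp: controls_iff intro: jump_set_const)

lemma shift_control:
  assumes "u \<in> controls U"
  shows "(\<lambda>s. u (a + s)) \<in> controls U"
proof -
  obtain J where "jump_set J u" using assms by (auto simp: controls_iff)
  from jump_set_shift[OF this, of a] show ?thesis using assms by (auto simp: controls_iff)
qed

lemma concat_control:
  assumes u: "u \<in> controls U" and w: "w \<in> controls U"
  shows "(\<lambda>s. if s < S then u s else w (s - S)) \<in> controls U"
proof -
  obtain J K where "jump_set J u" "jump_set K w" using assms by (auto simp: controls_iff)
  from jump_set_concat[OF this, of S] show ?thesis using assms by (auto simp: controls_iff)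
qed

lemma flow_concat:
  assumes u: "u \<in> controls U" and w: "w \<in> controls U" and "0 \<le> S" "0 \<le> s"
  shows "flow lam (\<lambda>s. if s < S then u s else w (s - S)) (S + s) x = flow lam w s (flow lam u S x)"
proof -
  obtain J where "jump_set J (\<lambda>s. if s < S then u s else w (s - S))"
    using control_jumps[OF concat_control[OF u w]] by blast
  note flow_add[OF this, of lam S s x]
  also have "flow lam (\<lambda>s. if s < S then u s else w (s - S)) S x = flow lam u S x"
    using assms by (intro flow_cong) auto
  also have "flow lam (\<lambda>s. if S + s < S then u (S + s) else w (S + s - S)) s (flow lam u S x) =
      flow lam w s (flow lam u S x)"
    using assms by (intro flow_cong) auto
  finally show ?thesis .
qed

lemma orb_flow: "u \<in> controls U \<Longrightarrow> 0 < S \<Longrightarrow> flow lam u S x \<in> orb lam U x"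
  unfolding orb_def by blast

lemma orb_trans:
  assumes "y \<in> orb lam U x" "z \<in> orb lam U y"
  shows "z \<in> orb lam U x"
proof -
  obtain u S w s where *: "0 < S" "u \<in> controls U" "y = flow lam u S x"
      "0 < s" "w \<in> controls U" "z = flow lam w s y"
    using assms unfolding orb_def by blast
  have "z = flow lam (\<lambda>s. if s < S then u s else w (s - S)) (S + s) x"
    using * by (simp add: flow_concat[of u U w])
  then show ?thesis
    using * orb_flow[OF concat_control[of u U w S], of "S + s" lam x] by simp
qed

lemma orb_translate: "y \<in> orb lam U x \<Longrightarrow> y + (a, 0) \<in> orb lam U (x + (a, 0))"
  unfolding orb_def by (force simp: flow_translate)

lemma orb_reverse1:
  assumes "y \<in> orb lam U x"
  shows "mirror x \<in> orb (- lam) (uminus ` U) (mirror y)"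
proof -
  obtain u S where *: "0 < S" "u \<in> controls U" "y = flow lam u S x"
    using assms unfolding orb_def by blast
  obtain J where J: "jump_set J u" using * control_jumps by blast
  have "(\<lambda>s. - u (S - s)) \<in> controls (uminus ` U)"
    using jump_set_comp[OF jump_set_reflect[OF J, of S], of uminus] *(2)
    by (auto simp: controls_iff)
  then show ?thesis
    using flow_reverse[OF J, of lam S x] * orb_flow by metis
qed

lemma orb_reverse: "y \<in> orb lam U x \<longleftrightarrow> mirror x \<in> orb (- lam) (uminus ` U) (mirror y)"
  using orb_reverse1[of y lam U x] orb_reverse1[of "mirror x" "- lam" "uminus ` U" "mirror y"]
  by (auto simp: image_image)

text \<open>The flow is continuous in the initial point, so positive invariance passes from an orbit to its
  closure.\<close>

lemma flow_closure_orb: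
  assumes "y \<in> closure (orb lam U x)" "u \<in> controls U" "0 \<le> S"
  shows "flow lam u S y \<in> closure (orb lam U x)"
proof (cases "S = 0")
  case False
  have "flow lam u S ` closure (orb lam U x) \<subseteq> closure (orb lam U x)"
  proof (rule image_closure_subset)
    show "continuous_on (closure (orb lam U x)) (flow lam u S)"
      using continuous_flow continuous_on_subset by blast
    show "flow lam u S ` orb lam U x \<subseteq> closure (orb lam U x)"
      using False assms orb_trans orb_flow closure_subset
      by (smt (verit, del_insts) image_subset_iff subsetD)
  qed simp
  then show ?thesis using assms by blast
qed (use assms in simp)

lemma closure_orb_trans:
  assumes "y \<in> closure (orb lam U x)" "z \<in> closure (orb lam U y)"
  shows "z \<in> closure (orb lam U x)"
proof -
  have "orb lam U y \<subseteq> closure (orb lam U x)"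
    unfolding orb_def[of lam U y] using flow_closure_orb[OF assms(1)] by auto
  then show ?thesis using assms(2) closure_minimal by blast
qed

section \<open>Accessibility\<close>

lemma flow_const_add:
  "flow lam (\<lambda>_. c) (a + b) x = flow lam (\<lambda>_. c) b (flow lam (\<lambda>_. c) a x)"
  using flow_add[OF jump_set_const] .

lemma flow_const_small:
  assumes nu: "lam - \<i> * of_real c \<noteq> 0" and e: "e > 0"
  shows "\<exists>\<tau>>0. \<forall>s. 0 < s \<longrightarrow> s < \<tau> \<longrightarrow> dist (flow lam (\<lambda>_. c) s x) x < e"
proof -
  define nu where "nu = lam - \<i> * of_real c"
  have "continuous_on UNIV (\<lambda>s. flow lam (\<lambda>_. c) s x)"
    using nu by (subst flow_const[OF nu_def]) (auto simp: nu_def intro!: continuous_intros)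
  then have "isCont (\<lambda>s. flow lam (\<lambda>_. c) s x) 0"
    by (simp add: continuous_on_eq_continuous_at)
  then obtain d where "d > 0" "\<And>s. dist s 0 < d \<Longrightarrow> dist (flow lam (\<lambda>_. c) s x) (flow lam (\<lambda>_. c) 0 x) < e"
    unfolding continuous_at_eps_delta using e by blast
  then show ?thesis by (intro exI[of _ d]) auto
qed

lemma derivative_zero_on_interval:
  fixes f :: "real \<Rightarrow> real"
  assumes d: "\<And>s. (f has_real_derivative f' s) (at s)"
    and z: "\<And>s. 0 < s \<Longrightarrow> s < \<tau> \<Longrightarrow> f s = 0" and s: "0 < s" "s < \<tau>"
  shows "f' s = 0"
proof -
  have "((\<lambda>_. 0) has_real_derivative f' s) (at s)"
    by (rule has_field_derivative_transform_within_open[OF d, of "{0<..<\<tau>}"]) (use z s in auto)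
  then show ?thesis using DERIV_unique DERIV_const by blast
qed

text \<open>Put \<open>w = lam r + 1\<close> and \<open>nu = lam - \<i> c\<close>; then \<open>w\<close> is an exponential \<open>k exp (nu s)\<close> plus the constant
  \<open>- \<i> c / nu\<close>. If its real part vanished on an interval, so would the real parts of \<open>w'\<close> and
  \<open>w'' = nu w'\<close>, and this forces \<open>w' = 0\<close> because \<open>nu\<close> is not real. But then \<open>w\<close> equals the
  constant, whose real part is not zero.\<close>

lemma generic_point:
  assumes c: "c \<noteq> 0" "c \<noteq> Im lam" and l: "lam \<noteq> 0" and \<tau>: "\<tau> > 0"
  shows "\<exists>s. 0 < s \<and> s < \<tau> \<and> Re (lam * snd (flow lam (\<lambda>_. c) s x) + 1) \<noteq> 0"
proof (rule ccontr)
  assume "\<not> ?thesis"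
  then have zero: "Re (lam * snd (flow lam (\<lambda>_. c) s x) + 1) = 0" if "0 < s" "s < \<tau>" for s
    using that by blast
  define nu where "nu = lam - \<i> * of_real c"
  have Imnu: "Im nu \<noteq> 0" using c by (simp add: nu_def)
  then have nu0: "nu \<noteq> 0" by auto
  define k where "k = lam * (snd x + 1 / nu)"
  have w: "lam * snd (flow lam (\<lambda>_. c) s x) + 1 = k * exp (nu * of_real s) - \<i> * of_real c / nu" for s
  proof -
    have "lam = nu + \<i> * of_real c" by (simp add: nu_def)
    then have "lam / nu = 1 + \<i> * of_real c / nu"
      using nu0 by (simp add: add_divide_distrib)
    moreover have "lam * snd (flow lam (\<lambda>_. c) s x) + 1 = k * exp (nu * of_real s) - lam / nu + 1"
      unfolding flow_const[OF nu_def nu0] by (simp add: k_def algebra_simps)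
    ultimately show ?thesis by simp
  qed
  have D: "((\<lambda>s. Re (q * exp (nu * of_real s) + b)) has_real_derivative
      Re (q * nu * exp (nu * of_real s))) (at s)" for q b s
  proof -
    have "((\<lambda>s. q * exp (nu * of_real s) + b) has_vector_derivative q * (nu * exp (nu * of_real s))) (at s)"
      by (intro has_vector_derivative_add_const[THEN iffD2] has_vector_derivative_mult_right
          has_vector_derivative_exp_real)
    then have "((\<lambda>s. Re (q * exp (nu * of_real s) + b)) has_vector_derivative
        Re (q * (nu * exp (nu * of_real s)))) (at s)"
      by (rule bounded_linear.has_vector_derivative[OF bounded_linear_Re])
    then show ?thesis by (simp add: has_real_derivative_iff_has_vector_derivative mult.assoc)
  qed
  have 1: "Re (k * nu * exp (nu * of_real s)) = 0" if "0 < s" "s < \<tau>" for s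
    by (rule derivative_zero_on_interval[OF D[of k "- \<i> * of_real c / nu"] _ that])
      (use zero w in auto)
  have 2: "Re (k * nu * nu * exp (nu * of_real s)) = 0" if "0 < s" "s < \<tau>" for s
    by (rule derivative_zero_on_interval[OF D[of "k * nu" 0] _ that]) (use 1 in auto)
  define z where "z = k * nu * exp (nu * of_real (\<tau> / 2))"
  have "Re z = 0" using 1[of "\<tau> / 2"] \<tau> by (simp add: z_def)
  moreover have "Re (nu * z) = 0" using 2[of "\<tau> / 2"] \<tau> by (simp add: z_def ac_simps)
  ultimately have "Im z = 0" using Imnu by simp
  with \<open>Re z = 0\<close> have "z = 0" by (simp add: complex_eq_iff)
  then have "k = 0" using nu0 by (simp add: z_def)
  then have "Re (- \<i> * of_real c / nu) = 0"
    using zero[of "\<tau> / 2"] w[of "\<tau> / 2"] \<tau> by simp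
  then have "c * Im nu / (norm nu)\<^sup>2 = 0"
    by (simp add: Re_divide cmod_def)
  then show False using c Imnu nu0 by simp
qed

lemma complex_real_basis:
  assumes "Im (cnj b * d) \<noteq> 0"
  shows "\<exists>h k. z = of_real h * b + of_real k * d"
proof -
  define \<Delta> where "\<Delta> = Re b * Im d - Im b * Re d"
  have "\<Delta> \<noteq> 0" using assms by (simp add: \<Delta>_def)
  then have "z = of_real ((Re z * Im d - Im z * Re d) / \<Delta>) * b + of_real ((Re b * Im z - Im b * Re z) / \<Delta>) * d"
    by (simp add: complex_eq_iff field_simps) (simp add: \<Delta>_def algebra_simps)
  then show ?thesis by blast
qed

lemma has_derivative_cexp:
  fixes g :: "'a::real_normed_vector \<Rightarrow> complex"
  assumes "(g has_derivative g') (at x)"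
  shows "((\<lambda>x. exp (g x)) has_derivative (\<lambda>h. exp (g x) * g' h)) (at x)"
  using has_derivative_compose[OF assms, of exp "\<lambda>h. exp (g x) * h"]
    DERIV_exp[of "g x"] by (simp add: has_field_derivative_def)

lemma three_leg_derivative:
  fixes nu lam :: complex and p t :: real
  shows "((\<lambda>(a, s, b). (t + p * a + p * b,
      exp (nu * of_real b) * (exp (lam * of_real s) * (exp (nu * of_real a) * q - c) + d) - m))
    has_derivative
      (\<lambda>(h, k, l). (p * (h + l), of_real h * (exp (lam * of_real s) * (nu * q))
        + of_real k * (exp (lam * of_real s) * (lam * (q - c)))
        + of_real l * (nu * (exp (lam * of_real s) * (q - c) + d)))))
    (at (0, s, 0))"
  unfolding case_prod_unfold
  by (auto intro!: derivative_eq_intros has_derivative_cexp ext simp: algebra_simps)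

lemma interior_flow_image:
  assumes J: "jump_set J u" and y: "y \<in> interior S"
  shows "flow lam u \<epsilon> y \<in> interior (flow lam u \<epsilon> ` S)"
proof -
  have inv: "flow lam (\<lambda>s. u (\<epsilon> + s)) (- \<epsilon>) (flow lam u \<epsilon> z) = z" for z
    using flow_add[OF J, of lam \<epsilon> "- \<epsilon>" z] by simp
  have inv': "flow lam u \<epsilon> (flow lam (\<lambda>s. u (\<epsilon> + s)) (- \<epsilon>) z) = z" for z
    using flow_add[OF jump_set_shift[OF J, of \<epsilon>], of lam "- \<epsilon>" \<epsilon> z] by simp
  let ?O = "flow lam (\<lambda>s. u (\<epsilon> + s)) (- \<epsilon>) -` interior S"
  have "open ?O" using continuous_flow by (simp add: open_vimage)
  moreover have "?O \<subseteq> flow lam u \<epsilon> ` S"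
  proof
    fix z assume "z \<in> ?O"
    then have "flow lam (\<lambda>s. u (\<epsilon> + s)) (- \<epsilon>) z \<in> S" using interior_subset by blast
    then show "z \<in> flow lam u \<epsilon> ` S" using inv'[of z] by (metis imageI)
  qed
  ultimately show ?thesis using y inv by (intro interiorI[of ?O]) auto
qed

text \<open>Apply the control \<open>p\<close>, then \<open>0\<close>, then \<open>p\<close> again, and vary the three durations. The two outer legs
  differentiate to directions whose difference is, up to the factor \<open>exp (lam s)\<close>, the vector \<open>- D s\<close> in the
  \<open>r\<close>-plane, and the inner leg contributes the drift \<open>lam r + 1\<close> with the same factor. Since \<open>D s\<close> is
  \<open>\<i> p s\<close> to first order, the two are linearly independent over the reals for small \<open>s\<close> as soon as
  the drift has a nonzero real part. The derivative of the end point is then onto, and the end point is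
  interior to the set of all end points.

  The outer durations range over a neighbourhood of \<open>0\<close>; they become positive once such legs are
  placed between two further pieces with control \<open>p\<close>.\<close>

lemma three_leg_interior:
  assumes lam: "lam \<noteq> 0" and p: "p \<noteq> 0" "p \<noteq> Im lam" and g: "Re (lam * snd x + 1) \<noteq> 0"
    and \<tau>: "\<tau> > 0"
  shows "\<exists>s. 0 < s \<and> s < \<tau> \<and> (\<forall>\<delta>>0. flow lam (\<lambda>_. 0) s x \<in> interior
    {flow lam (\<lambda>_. p) b (flow lam (\<lambda>_. 0) s' (flow lam (\<lambda>_. p) a x)) |a s' b.
      -\<delta> < a \<and> -\<delta> < b \<and> 0 < s'})"
proof -
  define nu where "nu = lam - \<i> * of_real p"
  have nu0: "nu \<noteq> 0" using p by (auto simp: nu_def complex_eq_iff)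
  define r where "r = snd x"
  define q where "q = r + 1 / nu"
  define c where "c = 1 / nu - 1 / lam"
  define \<Phi> where "\<Phi> = (\<lambda>(a, s, b). (fst x + p * a + p * b,
      exp (nu * of_real b) * (exp (lam * of_real s) * (exp (nu * of_real a) * q - c) + c) - 1 / nu))"
  have \<Phi>: "flow lam (\<lambda>_. p) b (flow lam (\<lambda>_. 0) s (flow lam (\<lambda>_. p) a x)) = \<Phi> (a, s, b)" for a s b
    using flow_const[OF nu_def nu0] flow_const[of lam lam 0, OF _ lam]
    by (simp add: \<Phi>_def q_def c_def r_def algebra_simps)
  \<comment> \<open>up to sign and the factor \<open>exp (lam s)\<close>, the difference of the directions of the two outer legs\<close>
  define D where "D s = of_real p * (\<i> * (1 - exp (- lam * of_real s)) / lam)" for s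
  define h where "h s = Im (cnj (lam * r + 1) * D s)" for s
  have "(D has_vector_derivative \<i> * of_real p) (at 0)"
  proof -
    have "((\<lambda>s. of_real p * (\<i> / lam) * exp (- lam * of_real s)) has_vector_derivative
       of_real p * (\<i> / lam) * (- lam * exp (- lam * of_real 0))) (at 0)"
      by (intro has_vector_derivative_mult_right has_vector_derivative_exp_real)
    then have "((\<lambda>s. of_real p * (\<i> / lam) - of_real p * (\<i> / lam) * exp (- lam * of_real s)) has_vector_derivative
       0 - of_real p * (\<i> / lam) * (- lam * exp (- lam * of_real 0))) (at 0)"
      by (intro has_vector_derivative_diff has_vector_derivative_const)
    then show ?thesis
      using lam by (simp add: D_def[abs_def] algebra_simps diff_divide_distrib)
  qed
  then have "((\<lambda>s. cnj (lam * r + 1) * D s) has_vector_derivative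
      cnj (lam * r + 1) * (\<i> * of_real p)) (at 0)"
    by (rule has_vector_derivative_mult_right)
  from bounded_linear.has_vector_derivative[OF bounded_linear_Im this]
  have hd: "(h has_real_derivative p * Re (lam * r + 1)) (at 0)"
    by (simp add: h_def[abs_def] has_real_derivative_iff_has_vector_derivative mult.commute)
  have h0: "h 0 = 0" by (simp add: h_def D_def)
  have "p * Re (lam * r + 1) \<noteq> 0" using p g by (simp add: r_def)
  then consider "p * Re (lam * r + 1) > 0" | "p * Re (lam * r + 1) < 0" by linarith
  then obtain d where d: "d > 0" "\<And>s. 0 < s \<Longrightarrow> s < d \<Longrightarrow> h s \<noteq> 0"
  proof cases
    case 1
    with DERIV_pos_inc_right[OF hd] h0 that show ?thesis by force
  next
    case 2
    with DERIV_neg_dec_right[OF hd] h0 that show ?thesis by force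
  qed
  define s where "s = min (\<tau> / 2) (d / 2)"
  have s: "0 < s" "s < \<tau>" "h s \<noteq> 0" using d \<tau> by (auto simp: s_def)
  define E where "E = exp (lam * of_real s)"
  have E0: "E \<noteq> 0" by (simp add: E_def)
  define v1 where "v1 = E * (nu * q)"
  define v2 where "v2 = E * (lam * (q - c))"
  define v3 where "v3 = nu * (E * (q - c) + c)"
  define \<Phi>' where "\<Phi>' = (\<lambda>(h, k, l). (p * (h + l), of_real h * v1 + of_real k * v2 + of_real l * v3))"
  have der: "(\<Phi> has_derivative \<Phi>') (at (0, s, 0))"
    unfolding \<Phi>_def \<Phi>'_def v1_def v2_def v3_def E_def by (rule three_leg_derivative)
  have cc: "lam * (q - c) = lam * r + 1" using lam by (simp add: q_def c_def algebra_simps)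
  have v2: "v2 = E * (lam * r + 1)" by (simp add: v2_def cc)
  have v31: "v3 - v1 = - (E * D s)"
  proof -
    define K where "K = \<i> * of_real p / lam"
    have "nu * c = K"
      using nu0 lam by (simp add: c_def nu_def K_def field_simps)
    then have "v3 - v1 = - ((E - 1) * K)" by (simp add: v3_def v1_def algebra_simps)
    moreover have "E * exp (- lam * of_real s) = 1" by (simp add: E_def exp_minus)
    then have "E * D s = (E - 1) * K"
      by (simp add: D_def K_def algebra_simps diff_divide_distrib)
    ultimately show ?thesis by simp
  qed
  have det: "Im (cnj v2 * (v3 - v1)) \<noteq> 0"
  proof -
    have "cnj v2 * (v3 - v1) = - (cnj E * E) * (cnj (lam * r + 1) * D s)"
      unfolding v2 v31 by simp
    also have "cnj E * E = of_real ((norm E)\<^sup>2)" by (metis complex_norm_square mult.commute)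
    finally have "Im (cnj v2 * (v3 - v1)) = - ((norm E)\<^sup>2 * h s)" by (simp add: h_def)
    then show ?thesis using s E0 by simp
  qed
  have "surj \<Phi>'"
    unfolding surj_def
  proof
    fix y :: "real \<times> complex"
    obtain k l where kl: "snd y - of_real (fst y / p) * v1 = of_real k * v2 + of_real l * (v3 - v1)"
      using complex_real_basis[OF det] by blast
    have "y = \<Phi>' (fst y / p - l, k, l)"
      using kl p by (simp add: \<Phi>'_def prod_eq_iff algebra_simps)
    then show "\<exists>x. y = \<Phi>' x" by blast
  qed
  then obtain g' where g': "linear g'" "\<Phi>' \<circ> g' = id"
    using linear_surjective_right_inverse[of \<Phi>'] der has_derivative_linear by blast
  have "\<Phi> (0, s, 0) \<in> interior
    {flow lam (\<lambda>_. p) b (flow lam (\<lambda>_. 0) s' (flow lam (\<lambda>_. p) a x)) |a s' b.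
      -\<delta> < a \<and> -\<delta> < b \<and> 0 < s'}" (is "_ \<in> interior ?S") if \<delta>: "\<delta> > 0" for \<delta>
  proof -
    let ?T = "{-\<delta><..} \<times> {0::real<..} \<times> {-\<delta><..}"
    have "open ?T" by (intro open_Times open_greaterThan)
    have "\<Phi> (0, s, 0) \<in> interior (\<Phi> ` ?T)"
    proof (rule sussmann_open_mapping[OF open_UNIV _ _ der _ g'(2)])
      show "continuous_on UNIV \<Phi>"
        unfolding \<Phi>_def case_prod_unfold by (intro continuous_intros)
      show "bounded_linear g'" using g' linear_conv_bounded_linear by blast
      show "(0, s, 0) \<in> interior ?T"
        using \<open>open ?T\<close> s \<delta> by (subst interior_open) auto
    qed auto
    moreover have "\<Phi> ` ?T \<subseteq> ?S" by (auto simp: \<Phi>[symmetric]) blast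
    ultimately show ?thesis using interior_mono by blast
  qed
  moreover have "\<Phi> (0, s, 0) = flow lam (\<lambda>_. 0) s x" using \<Phi>[of 0 s 0] by simp
  ultimately show ?thesis using s by auto
qed

text \<open>The quantitative content of the rank condition: a first leg with control \<open>p\<close> makes the drift generic,
  and a last leg with control \<open>p\<close> absorbs the negative durations of the three-leg manoeuvre.\<close>

theorem accessibility:
  assumes lam: "lam \<noteq> 0" and d: "0 < d" "{-d..d} \<subseteq> U" and e: "e > 0"
  shows "\<exists>y \<in> interior (orb lam U x). dist y x < e"
proof -
  \<comment> \<open>the control \<open>Im lam\<close> is resonant: with it the growth rate \<open>lam - \<i> p\<close> is real\<close>
  obtain p where p: "p \<in> U" "p \<noteq> 0" "p \<noteq> Im lam"
  proof (cases "d = Im lam")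
    case True then show ?thesis using d by (intro that[of "d / 2"]) auto
  next
    case False then show ?thesis using d by (intro that[of d]) auto
  qed
  have 0: "0 \<in> U" using d by auto
  have nu0: "lam - \<i> * of_real p \<noteq> 0" using p by (auto simp: complex_eq_iff)
  have l0: "lam - \<i> * of_real 0 \<noteq> 0" using lam by simp
  have e3: "e / 3 > 0" using e by simp
  obtain \<tau>1 where \<tau>1: "\<tau>1 > 0" "\<And>s. 0 < s \<Longrightarrow> s < \<tau>1 \<Longrightarrow> dist (flow lam (\<lambda>_. p) s x) x < e / 3"
    using flow_const_small[OF nu0 e3, of x] by blast
  obtain \<sigma> where \<sigma>: "0 < \<sigma>" "\<sigma> < \<tau>1" "Re (lam * snd (flow lam (\<lambda>_. p) \<sigma> x) + 1) \<noteq> 0"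
    using generic_point[OF p(2,3) lam \<tau>1(1)] by blast
  define x1 where "x1 = flow lam (\<lambda>_. p) \<sigma> x"
  have d1: "dist x1 x < e / 3" using \<sigma> \<tau>1 by (simp add: x1_def)
  obtain \<tau>2 where \<tau>2: "\<tau>2 > 0" "\<And>s. 0 < s \<Longrightarrow> s < \<tau>2 \<Longrightarrow> dist (flow lam (\<lambda>_. 0) s x1) x1 < e / 3"
    using flow_const_small[OF l0 e3, of x1] by blast
  obtain s where s: "0 < s" "s < \<tau>2" and int: "\<And>\<delta>. \<delta> > 0 \<Longrightarrow> flow lam (\<lambda>_. 0) s x1 \<in> interior
    {flow lam (\<lambda>_. p) b (flow lam (\<lambda>_. 0) s' (flow lam (\<lambda>_. p) a x1)) |a s' b.
      -\<delta> < a \<and> -\<delta> < b \<and> 0 < s'}"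
    using three_leg_interior[OF lam p(2,3) \<sigma>(3)[folded x1_def] \<tau>2(1)] by blast
  define x2 where "x2 = flow lam (\<lambda>_. 0) s x1"
  have d2: "dist x2 x1 < e / 3" using s \<tau>2 by (simp add: x2_def)
  obtain \<tau>3 where \<tau>3: "\<tau>3 > 0" "\<And>s. 0 < s \<Longrightarrow> s < \<tau>3 \<Longrightarrow> dist (flow lam (\<lambda>_. p) s x2) x2 < e / 3"
    using flow_const_small[OF nu0 e3, of x2] by blast
  define \<epsilon> where "\<epsilon> = \<tau>3 / 2"
  have \<epsilon>: "0 < \<epsilon>" "\<epsilon> < \<tau>3" using \<tau>3 by (auto simp: \<epsilon>_def)
  let ?y = "flow lam (\<lambda>_. p) \<epsilon> x2"
  have d3: "dist ?y x2 < e / 3" using \<epsilon> \<tau>3 by simp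
  let ?S = "{flow lam (\<lambda>_. p) b (flow lam (\<lambda>_. 0) s' (flow lam (\<lambda>_. p) a x1)) |a s' b.
      - min \<sigma> \<epsilon> < a \<and> - min \<sigma> \<epsilon> < b \<and> 0 < s'}"
  have "?y \<in> interior (flow lam (\<lambda>_. p) \<epsilon> ` ?S)"
    unfolding x2_def using \<sigma> \<epsilon> by (intro interior_flow_image[OF jump_set_const] int) auto
  moreover have "flow lam (\<lambda>_. p) \<epsilon> ` ?S \<subseteq> orb lam U x"
  proof
    fix z assume "z \<in> flow lam (\<lambda>_. p) \<epsilon> ` ?S"
    then obtain a s' b where *: "- min \<sigma> \<epsilon> < a" "- min \<sigma> \<epsilon> < b" "0 < s'"
      and z: "z = flow lam (\<lambda>_. p) \<epsilon> (flow lam (\<lambda>_. p) b (flow lam (\<lambda>_. 0) s' (flow lam (\<lambda>_. p) a x1)))"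
      by blast
    let ?z1 = "flow lam (\<lambda>_. p) (\<sigma> + a) x" and ?z2 = "flow lam (\<lambda>_. 0) s' (flow lam (\<lambda>_. p) (\<sigma> + a) x)"
    have "?z1 \<in> orb lam U x" "?z2 \<in> orb lam U ?z1" "flow lam (\<lambda>_. p) (b + \<epsilon>) ?z2 \<in> orb lam U ?z2"
      using * p 0 by (intro orb_flow const_control; simp)+
    then have "flow lam (\<lambda>_. p) (b + \<epsilon>) ?z2 \<in> orb lam U x" using orb_trans by blast
    then show "z \<in> orb lam U x"
      by (simp add: z x1_def flow_const_add)
  qed
  ultimately have "?y \<in> interior (orb lam U x)" using interior_mono by blast
  moreover have "dist ?y x < e"
    using d1 d2 d3 dist_triangle[of ?y x x2] dist_triangle[of x2 x x1] by linarith
  ultimately show ?thesis by blast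
qed

section \<open>Recurrent sets\<close>

text \<open>The full preimage of the image of \<open>S\<close> under a covering whose deck transformations are the translations
  of \<open>t\<close> by multiples of \<open>T\<close>.\<close>

definition saturate :: "real \<Rightarrow> (real \<times> complex) set \<Rightarrow> (real \<times> complex) set" where
  "saturate T S = {x + (T * of_int k, 0) |x k. x \<in> S}"

text \<open>Conditions (i) and (ii) in the definition of a control set, pulled back along such a covering. For
  \<open>T = 0\<close> the covering is injective, which is the case of the group \<open>G(\<theta>)\<close>.\<close>

definition recurrent :: "complex \<Rightarrow> real set \<Rightarrow> real \<Rightarrow> (real \<times> complex) set \<Rightarrow> bool" where
  "recurrent lam U T B \<longleftrightarrow>
     (\<forall>x\<in>B. \<exists>u\<in>controls U. \<forall>s\<ge>0. flow lam u s x \<in> B) \<and>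
     (\<forall>x\<in>B. B \<subseteq> closure (saturate T (orb lam U x)))"

lemma subset_saturate: "S \<subseteq> saturate T S"
proof
  fix x assume "x \<in> S"
  moreover have "x = x + (T * of_int 0, 0)" by (simp add: prod_eq_iff)
  ultimately show "x \<in> saturate T S" unfolding saturate_def by blast
qed

text \<open>By (i) one can stay in \<open>B\<close> beyond any given time, and by (ii) return from there to any
  neighbourhood of the starting point, up to a translation of \<open>t\<close>.\<close>

lemma recurrent_return:
  assumes B: "recurrent lam U T B" "x \<in> B" and e: "e > 0"
  shows "\<exists>S u a. S0 < S \<and> u \<in> controls U \<and> dist (flow lam u S x + (a, 0)) x < e"
proof -
  define S1 where "S1 = max S0 0"
  obtain u where u: "u \<in> controls U" "flow lam u S1 x \<in> B"
    using B unfolding recurrent_def S1_def by (meson max.cobounded2)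
  then have "x \<in> closure (saturate T (orb lam U (flow lam u S1 x)))"
    using B unfolding recurrent_def by blast
  then obtain y where y: "y \<in> saturate T (orb lam U (flow lam u S1 x))" "dist y x < e"
    using e closure_approachable by blast
  then obtain w S k where w: "w \<in> controls U" "0 < S"
      "y = flow lam w S (flow lam u S1 x) + (T * of_int k, 0)"
    unfolding saturate_def orb_def by blast
  let ?v = "\<lambda>s. if s < S1 then u s else w (s - S1)"
  have "y = flow lam ?v (S1 + S) x + (T * of_int k, 0)"
    using w u by (subst flow_concat[of u U w]) (auto simp: S1_def)
  moreover have "?v \<in> controls U" using concat_control u w by blast
  moreover have "S0 < S1 + S" using w by (simp add: S1_def)
  ultimately show ?thesis using y by blast
qed

lemma exp_decay:
  assumes "m < 0" "e > 0"
  shows "\<exists>S0\<ge>0. \<forall>S\<ge>S0. exp (m * S) * (b :: real) < e"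
proof -
  have "((\<lambda>S. exp (m * S) * b) \<longlongrightarrow> 0 * b) at_top"
    by (intro tendsto_mult tendsto_const filterlim_compose[OF exp_at_bot]
        filterlim_tendsto_neg_mult_at_bot[OF tendsto_const assms(1)] filterlim_ident)
  then have "eventually (\<lambda>S. exp (m * S) * b < e) at_top"
    using assms by (auto dest: order_tendstoD)
  then obtain N where "\<forall>S\<ge>N. exp (m * S) * b < e"
    unfolding eventually_at_top_linorder by blast
  then show ?thesis by (intro exI[of _ "max N 0"]) auto
qed

lemma dist_same_fst: "fst x = fst y \<Longrightarrow> dist x y = norm (snd x - snd y)"
  by (cases x, cases y) (simp add: dist_Pair_Pair dist_norm)

lemma closure_translate:
  fixes c :: "'a::real_normed_vector"
  assumes "x \<in> closure S"
  shows "x + c \<in> closure ((\<lambda>y. y + c) ` S)"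
proof -
  have "(\<lambda>y. y + c) ` closure S \<subseteq> closure ((\<lambda>y. y + c) ` S)"
    by (rule image_closure_subset) (auto intro!: continuous_intros closure_subset)
  then show ?thesis using assms by blast
qed

section \<open>The contracting case\<close>

text \<open>Steer \<open>t\<close> to the desired value with a constant control, and then switch the control off: what remains
  is \<open>r' = lam r + 1\<close>, which converges to its equilibrium.\<close>

lemma equilibrium_in_closure:
  assumes lam: "Re lam < 0" and d: "0 < d" "{-d..d} \<subseteq> U"
  shows "(t', - 1 / lam) \<in> closure (orb lam U x)"
proof -
  have lam0: "lam \<noteq> 0" using lam by auto
  have 0: "0 \<in> U" using d by auto
  obtain y where y: "y = x \<or> y \<in> orb lam U x" "fst y = t'"
  proof (cases "t' = fst x")
    case True then show ?thesis using that[of x] by simp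
  next
    case False
    define c where "c = (if t' > fst x then d else - d)"
    define s where "s = (t' - fst x) / c"
    have "c \<in> U" "s > 0" "c * s = t' - fst x"
      using False d by (auto simp: c_def s_def field_simps)
    then show ?thesis
      by (intro that[of "flow lam (\<lambda>_. c) s x"])
         (auto intro!: orb_flow const_control simp: fst_flow prim_const)
  qed
  show ?thesis
    unfolding closure_approachable
  proof (intro allI impI)
    fix e :: real assume "e > 0"
    then obtain S0 where S0: "S0 \<ge> 0" "\<And>S. S \<ge> S0 \<Longrightarrow> exp (Re lam * S) * norm (snd y + 1 / lam) < e"
      using exp_decay[OF lam, of e "norm (snd y + 1 / lam)"] by blast
    define S where "S = S0 + 1"
    let ?z = "flow lam (\<lambda>_. 0) S y"
    have "?z \<in> orb lam U y" using S0 0 by (intro orb_flow const_control) (auto simp: S_def)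
    then have "?z \<in> orb lam U x" using y orb_trans by blast
    moreover have "?z = (t', exp (lam * of_real S) * (snd y + 1 / lam) - 1 / lam)"
      using y by (subst flow_const[of lam]) (auto simp: lam0)
    then have "dist ?z (t', - 1 / lam) = exp (Re lam * S) * norm (snd y + 1 / lam)"
      by (simp add: dist_same_fst norm_mult)
    moreover have "\<dots> < e" by (intro S0) (simp add: S_def)
    ultimately show "\<exists>z\<in>orb lam U x. dist z (t', - 1 / lam) < e" by force
  qed
qed

definition attractor :: "complex \<Rightarrow> real set \<Rightarrow> (real \<times> complex) set" where
  "attractor lam U = closure (orb lam U (0, - 1 / lam))"

context
  fixes lam :: complex and U :: "real set" and d :: real
  assumes lam: "Re lam < 0" and d: "0 < d" "{-d..d} \<subseteq> U"
begin

lemma attractor_subset_closure_orb: "attractor lam U \<subseteq> closure (orb lam U x)"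
  unfolding attractor_def using closure_orb_trans equilibrium_in_closure[OF lam d] by blast

lemma equilibrium_in_attractor: "(t, - 1 / lam) \<in> attractor lam U"
  unfolding attractor_def by (rule equilibrium_in_closure[OF lam d])

lemma attractor_flow: "x \<in> attractor lam U \<Longrightarrow> u \<in> controls U \<Longrightarrow> 0 \<le> s \<Longrightarrow> flow lam u s x \<in> attractor lam U"
  unfolding attractor_def by (rule flow_closure_orb)

text \<open>The translate of the orbit of one equilibrium is the orbit of another equilibrium, and all equilibria
  lie in the closures of each other's orbits.\<close>

lemma attractor_translate:
  assumes "x \<in> attractor lam U"
  shows "x + (a, 0) \<in> attractor lam U"
proof -
  have "x + (a, 0) \<in> closure ((\<lambda>y. y + (a, 0)) ` orb lam U (0, - 1 / lam))"
    using assms closure_translate unfolding attractor_def by blast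
  also have "\<dots> \<subseteq> closure (orb lam U (a, - 1 / lam))"
    using orb_translate[of _ lam U "(0, - 1 / lam)" a] by (intro closure_mono) auto
  also have "\<dots> \<subseteq> attractor lam U"
    using closure_orb_trans[OF equilibrium_in_closure[OF lam d]] unfolding attractor_def by blast
  finally show ?thesis .
qed

lemma interior_attractor: "interior (attractor lam U) \<noteq> {}"
proof -
  have "lam \<noteq> 0" using lam by auto
  then obtain y where "y \<in> interior (orb lam U (0, - 1 / lam))"
    using accessibility[OF _ d, of lam 1 "(0, - 1 / lam)"] by auto
  then show ?thesis
    unfolding attractor_def using interior_mono[OF closure_subset] by blast
qed

lemma recurrent_attractor: "recurrent lam U T (attractor lam U)"
  unfolding recurrent_def
proof (intro conjI ballI)
  fix x assume "x \<in> attractor lam U"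
  moreover have "(\<lambda>_. 0) \<in> controls U" using d by (intro const_control) auto
  ultimately show "\<exists>u\<in>controls U. \<forall>s\<ge>0. flow lam u s x \<in> attractor lam U"
    using attractor_flow by blast
  show "attractor lam U \<subseteq> closure (saturate T (orb lam U x))"
    using attractor_subset_closure_orb closure_mono[OF subset_saturate] by blast
qed

text \<open>Trajectories with the same control and the same initial \<open>t\<close> approach each other exponentially. A point
  of \<open>B\<close> comes back near itself after arbitrarily long times; by then its trajectory is shadowed by the
  one that started in the equilibrium on the same level \<open>t\<close>, and the latter never leaves the attractor.\<close>

lemma recurrent_subset_attractor:
  assumes B: "recurrent lam U T B"
  shows "B \<subseteq> attractor lam U"
proof
  fix x assume x: "x \<in> B"
  have "x \<in> closure (attractor lam U)"
    unfolding closure_approachable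
  proof (intro allI impI)
    fix e :: real assume e: "e > 0"
    let ?n = "norm (snd x + 1 / lam)"
    obtain S0 where S0: "S0 \<ge> 0" "\<And>S. S \<ge> S0 \<Longrightarrow> exp (Re lam * S) * ?n < e / 2"
      using exp_decay[OF lam, of "e / 2" ?n] e by auto
    obtain S u a where S: "S0 < S" "u \<in> controls U" "dist (flow lam u S x + (a, 0)) x < e / 2"
      using recurrent_return[OF B x, of "e / 2" S0] e by auto
    let ?g = "flow lam u S (fst x, - 1 / lam) + (a, 0)"
    have "?g \<in> attractor lam U"
      using S S0 by (intro attractor_translate attractor_flow equilibrium_in_attractor) auto
    moreover have "dist ?g (flow lam u S x + (a, 0)) = exp (Re lam * S) * ?n"
      using flow_diff[of lam u S "(fst x, - 1 / lam)" x]
      by (simp add: dist_same_fst fst_flow norm_mult norm_multiplier norm_minus_commute[of "- 1 / lam"])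
        (metis norm_minus_cancel minus_add_distrib add.commute diff_conv_add_uminus)
    moreover have "\<dots> < e / 2" using S by (intro S0) auto
    ultimately show "\<exists>y\<in>attractor lam U. dist y x < e"
      using S(3) dist_triangle[of ?g x "flow lam u S x + (a, 0)"] by (intro bexI[of _ ?g]) auto
  qed
  then show "x \<in> attractor lam U" by (simp add: attractor_def)
qed

end

section \<open>The expanding case\<close>

text \<open>Repeating a control that leads from \<open>x\<close> back to \<open>x\<close> gives a trajectory from each of whose points \<open>x\<close>
  can be reached again.\<close>

lemma periodic_return:
  assumes u: "u \<in> controls U" and S: "0 < S" and x: "flow lam u S x = x"
  shows "\<exists>w\<in>controls U. \<forall>s\<ge>0. x \<in> orb lam U (flow lam w s x)"
proof -
  define w where "w = (\<lambda>s. u (s - S * of_int \<lfloor>s / S\<rfloor>))"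
  obtain J where "jump_set J u" using u control_jumps by blast
  then obtain K where K: "jump_set K w"
    using jump_set_periodic S unfolding w_def by blast
  then have w: "w \<in> controls U" using u by (auto simp: controls_iff w_def)
  have per: "(\<lambda>s. w (S + s)) = w"
    using S by (simp add: w_def add_divide_distrib fun_eq_iff algebra_simps)
  have wS: "flow lam w S x = x"
  proof -
    have "flow lam w S x = flow lam u S x"
    proof (rule flow_cong)
      fix \<sigma> assume "0 < \<sigma>" "\<sigma> < S"
      then have "\<lfloor>\<sigma> / S\<rfloor> = 0" by (intro floor_unique) auto
      then show "w \<sigma> = u \<sigma>" by (simp add: w_def)
    qed (use S in auto)
    then show ?thesis using x by simp
  qed
  have k: "flow lam w (real k * S) x = x" for k
  proof (induction k)
    case (Suc k)
    have "flow lam w (S + real k * S) x = flow lam w (real k * S) x"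
      using flow_add[OF K, of lam S "real k * S" x] by (simp add: per wS)
    then show ?case using Suc by (simp add: algebra_simps)
  qed simp
  have "x \<in> orb lam U (flow lam w s x)" if "s \<ge> 0" for s
  proof -
    obtain k where "s < real k * S" using reals_Archimedean3[OF S] by blast
    then have "flow lam (\<lambda>r. w (s + r)) (real k * S - s) (flow lam w s x) \<in> orb lam U (flow lam w s x)"
      using w by (intro orb_flow shift_control) auto
    moreover have "flow lam (\<lambda>r. w (s + r)) (real k * S - s) (flow lam w s x) = x"
      using flow_add[OF K, of lam s "real k * S - s" x] k[of k] by simp
    ultimately show ?thesis by simp
  qed
  then show ?thesis using w by blast
qed

text \<open>The attractor of the reversed system: the closure of the set of points from which the equilibrium at
  \<open>t = 0\<close> can be reached. Its interior will be the control set.\<close>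

definition repeller :: "complex \<Rightarrow> real set \<Rightarrow> (real \<times> complex) set" where
  "repeller lam U = mirror -` attractor (- lam) (uminus ` U)"

lemma continuous_mirror: "continuous_on S mirror"
  unfolding mirror_def by (intro continuous_intros)

lemma mirror_closure:
  assumes "mirror x \<in> closure S"
  shows "x \<in> closure (mirror ` S)"
proof -
  have "mirror ` closure S \<subseteq> closure (mirror ` S)"
    by (rule image_closure_subset[OF continuous_mirror closed_closure closure_subset])
  then show ?thesis using assms by (metis image_subset_iff mirror_mirror)
qed

context
  fixes lam :: complex and U :: "real set" and d :: real
  assumes lam: "Re lam > 0" and d: "0 < d" "{-d..d} \<subseteq> U"
begin

lemma reversed: "Re (- lam) < 0" "0 < d" "{-d..d} \<subseteq> uminus ` U"
proof -
  have "x \<in> uminus ` U" if "x \<in> {-d..d}" for x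
  proof -
    have "- x \<in> U" using that d by auto
    then show ?thesis by (metis image_eqI minus_minus)
  qed
  then show "{-d..d} \<subseteq> uminus ` U" by blast
qed (use lam d in auto)

lemma repeller_subset: "repeller lam U \<subseteq> closure {z. y \<in> orb lam U z}"
proof
  fix x assume "x \<in> repeller lam U"
  then have "mirror x \<in> closure (orb (- lam) (uminus ` U) (mirror y))"
    unfolding repeller_def using attractor_subset_closure_orb[OF reversed] by blast
  then have "x \<in> closure (mirror ` orb (- lam) (uminus ` U) (mirror y))" by (rule mirror_closure)
  also have "\<dots> \<subseteq> closure {z. y \<in> orb lam U z}"
    by (intro closure_mono) (auto simp: orb_reverse[of y lam U])
  finally show "x \<in> closure {z. y \<in> orb lam U z}" .
qed

lemma repeller_backward:
  assumes "x \<in> repeller lam U" "x \<in> orb lam U z"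
  shows "z \<in> repeller lam U"
proof -
  have "mirror z \<in> orb (- lam) (uminus ` U) (mirror x)" using assms orb_reverse by blast
  then show ?thesis
    using assms attractor_flow[OF reversed] unfolding repeller_def orb_def by force
qed

lemma repeller_translate: "x \<in> repeller lam U \<Longrightarrow> x + (a, 0) \<in> repeller lam U"
  using attractor_translate[OF reversed, of "mirror x" a]
  by (simp add: repeller_def mirror_def)

lemma interior_repeller: "interior (repeller lam U) \<noteq> {}"
proof -
  have "open (mirror -` interior (attractor (- lam) (uminus ` U)))"
    using continuous_mirror by (simp add: open_vimage)
  moreover have "mirror -` interior (attractor (- lam) (uminus ` U)) \<subseteq> repeller lam U"
    using interior_subset unfolding repeller_def by blast
  moreover obtain y where "y \<in> interior (attractor (- lam) (uminus ` U))"
    using interior_attractor[OF reversed] by blast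
  then have "mirror y \<in> mirror -` interior (attractor (- lam) (uminus ` U))" by simp
  ultimately show ?thesis using interior_maximal by blast
qed

lemma interior_repeller_backward:
  assumes x: "x \<in> interior (repeller lam U)" "x \<in> orb lam U z"
  shows "z \<in> interior (repeller lam U)"
proof -
  obtain u S where u: "0 < S" "u \<in> controls U" "x = flow lam u S z"
    using x unfolding orb_def by blast
  let ?O = "flow lam u S -` interior (repeller lam U)"
  have "open ?O" using continuous_flow by (simp add: open_vimage)
  moreover have "?O \<subseteq> repeller lam U"
  proof
    fix w assume "w \<in> ?O"
    then have "flow lam u S w \<in> repeller lam U" using interior_subset by auto
    then show "w \<in> repeller lam U" using repeller_backward u orb_flow by blast
  qed
  ultimately show ?thesis using x u by (intro interiorI[of ?O]) auto
qed

lemma interior_repeller_translate: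
  assumes "x \<in> interior (repeller lam U)"
  shows "x + (a, 0) \<in> interior (repeller lam U)"
proof (rule interiorI[of "(\<lambda>y. y + (a, 0)) ` interior (repeller lam U)"])
  show "open ((\<lambda>y. y + (a, 0)) ` interior (repeller lam U))"
    using open_translation[OF open_interior, of "(a, 0)" "repeller lam U"] by (simp add: add.commute)
  show "(\<lambda>y. y + (a, 0)) ` interior (repeller lam U) \<subseteq> repeller lam U"
    using repeller_translate interior_subset by blast
qed (use assms in blast)

text \<open>Accessibility puts an open part of the orbit of \<open>x\<close> inside the repeller, where the points that can be
  steered to \<open>y\<close> are dense; so one of them lies in that part. This upgrades approximate to exact
  reachability.\<close>

lemma interior_repeller_reaches:
  assumes x: "x \<in> interior (repeller lam U)"
  shows "y \<in> orb lam U x"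
proof -
  have lam0: "lam \<noteq> 0" using lam by auto
  obtain e where e: "e > 0" "ball x e \<subseteq> interior (repeller lam U)"
    using x open_interior openE by blast
  obtain v where v: "v \<in> interior (orb lam U x)" "dist v x < e"
    using accessibility[OF lam0 d e(1)] by blast
  then have "v \<in> interior (repeller lam U)" using e by (auto simp: dist_commute)
  then have "v \<in> closure {z. y \<in> orb lam U z}"
    using repeller_subset interior_subset by blast
  then obtain z where "z \<in> interior (orb lam U x)" "y \<in> orb lam U z"
    using v by (auto simp: closure_iff_nhds_not_empty dest!: spec[of _ "interior (orb lam U x)"])
  then show ?thesis using interior_subset orb_trans by blast
qed

lemma recurrent_interior_repeller: "recurrent lam U T (interior (repeller lam U))"
  unfolding recurrent_def
proof (intro conjI ballI)
  fix x assume x: "x \<in> interior (repeller lam U)"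
  obtain u S where "0 < S" "u \<in> controls U" "flow lam u S x = x"
    using interior_repeller_reaches[OF x, of x] unfolding orb_def by force
  then obtain w where "w \<in> controls U" "\<forall>s\<ge>0. x \<in> orb lam U (flow lam w s x)"
    using periodic_return by meson
  then show "\<exists>u\<in>controls U. \<forall>s\<ge>0. flow lam u s x \<in> interior (repeller lam U)"
    using interior_repeller_backward[OF x] by (intro bexI[of _ w]) auto
  show "interior (repeller lam U) \<subseteq> closure (saturate T (orb lam U x))"
    using interior_repeller_reaches[OF x] closure_subset[of "saturate T (orb lam U x)"]
      subset_saturate[of "orb lam U x" T] by (meson subsetD subsetI)
qed

text \<open>The flow contracts backwards in time. Follow a long return of \<open>x\<close> to its own neighbourhood, replace
  the end point by the equilibrium on the same level \<open>t\<close>, and go back with the same control: the result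
  is close to \<open>x\<close> and can be steered to an equilibrium.\<close>

lemma recurrent_subset_repeller:
  assumes B: "recurrent lam U T B"
  shows "B \<subseteq> repeller lam U"
proof
  fix x assume x: "x \<in> B"
  have "x \<in> closure (repeller lam U)"
    unfolding closure_approachable
  proof (intro allI impI)
    fix e :: real assume e: "e > 0"
    let ?n = "norm (snd x) + 1 + norm (1 / lam)"
    obtain S0 where S0: "S0 \<ge> 0" "\<And>S. S \<ge> S0 \<Longrightarrow> exp (Re (- lam) * S) * ?n < e"
      using exp_decay[OF reversed(1) e, of ?n] by blast
    obtain S u a where S: "S0 < S" "u \<in> controls U" "dist (flow lam u S x + (a, 0)) x < 1"
      using recurrent_return[OF B x, of 1 S0] by auto
    define z where "z = snd (flow lam u S x)"
    have "norm (z - snd x) < 1"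
      using S(3) dist_snd_le[of "flow lam u S x + (a, 0)" x] by (simp add: z_def dist_norm)
    then have zn: "norm (z + 1 / lam) \<le> ?n"
      using norm_triangle_ineq[of "z - snd x" "snd x"] norm_triangle_ineq[of z "1 / lam"] by simp
    define y where "y = (fst x, snd x - (z + 1 / lam) / multiplier lam u S)"
    have "snd (flow lam u S y) = - 1 / lam"
      using flow_diff[of lam u S y x] by (simp add: y_def z_def)
    then have "flow lam u S y = (fst x + prim u S, - 1 / lam)"
      by (simp add: prod_eq_iff fst_flow) (simp add: y_def)
    moreover have "(t, - 1 / lam) \<in> repeller lam U" for t
      using equilibrium_in_attractor[OF reversed, of t] by (simp add: repeller_def mirror_def)
    ultimately have "y \<in> repeller lam U"
      using repeller_backward[of "flow lam u S y" y] orb_flow[of u U S lam y] S S0 by simp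
    moreover have "dist y x = exp (Re (- lam) * S) * norm (z + 1 / lam)"
      unfolding dist_commute[of y x]
      by (simp add: y_def dist_same_fst norm_divide norm_multiplier exp_minus field_simps)
    then have "dist y x \<le> exp (Re (- lam) * S) * ?n" using zn by simp
    then have "dist y x < e" using S0(2)[of S] S by simp
    ultimately show "\<exists>y\<in>repeller lam U. dist y x < e" by blast
  qed
  moreover have "closed (repeller lam U)"
    unfolding repeller_def attractor_def
    by (rule closed_vimage[OF closed_closure continuous_mirror])
  ultimately show "x \<in> repeller lam U" by simp
qed

text \<open>An interior point of \<open>B\<close> lies in the interior of the repeller, and every point of \<open>B\<close> can be steered
  into that open set, which is invariant backwards in time.\<close>

lemma recurrent_subset_interior_repeller:
  assumes B: "recurrent lam U T B" and int: "interior B \<noteq> {}"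
  shows "B \<subseteq> interior (repeller lam U)"
proof
  fix x assume x: "x \<in> B"
  obtain w where "w \<in> interior B" using int by blast
  then have w: "w \<in> B" "w \<in> interior (repeller lam U)"
    using interior_subset interior_mono[OF recurrent_subset_repeller[OF B]] by blast+
  then have "w \<in> closure (saturate T (orb lam U x))" using B x unfolding recurrent_def by blast
  then obtain z where "z \<in> saturate T (orb lam U x)" "z \<in> interior (repeller lam U)"
    using w by (auto simp: closure_iff_nhds_not_empty dest!: spec[of _ "interior (repeller lam U)"])
  then obtain v k where v: "v \<in> orb lam U x" "v + (T * of_int k, 0) \<in> interior (repeller lam U)"
    unfolding saturate_def by blast
  have "v = (v + (T * of_int k, 0)) + (- (T * of_int k), 0)" by (simp add: prod_eq_iff)
  then have "v \<in> interior (repeller lam U)" using interior_repeller_translate[OF v(2)] by metis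
  then show "x \<in> interior (repeller lam U)" using interior_repeller_backward v by blast
qed

end

section \<open>The neutral case\<close>

lemma exp_period: "exp (\<i> * of_real (\<phi> + 2 * pi * of_int n)) = exp (\<i> * of_real \<phi>)"
proof -
  show ?thesis
    unfolding exp_eq by (intro exI[of _ n]) (simp add: algebra_simps)
qed

text \<open>For purely imaginary \<open>lam = \<i> \<beta>\<close> there is neither contraction nor expansion: the constant control
  \<open>c\<close> rotates \<open>r\<close> with angular velocity \<open>\<beta> - c\<close> about the centre \<open>\<i> / (\<beta> - c)\<close>. Rotations about
  two different centres generate all translations, so every point can be reached from every other.

  The controls used are \<open>c = m \<beta>\<^sup>2 / (2 + m \<beta>)\<close>, chosen so that the centre lies exactly \<open>\<i> m / 2\<close> away
  from the centre for \<open>c = 0\<close>. The bound \<open>m0\<close> on \<open>\<bar>m\<bar>\<close> keeps the denominator positive and the control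
  within \<open>[-d, d]\<close>.\<close>

context
  fixes \<beta> d :: real and U :: "real set" and lam :: complex and m0 :: real
  assumes \<beta>: "\<beta> \<noteq> 0" and lam: "lam = \<i> * of_real \<beta>" and d: "0 < d" "{-d..d} \<subseteq> U"
    and m0: "m0 = min (1 / \<bar>\<beta>\<bar>) (d / \<beta>\<^sup>2)"
begin

definition centre :: "real \<Rightarrow> complex" where
  "centre m = \<i> * of_real ((2 + m * \<beta>) / (2 * \<beta>))"

lemma m0_pos: "0 < m0"
  using \<beta> d by (simp add: m0)

lemma rotation_bounds:
  assumes "\<bar>m\<bar> \<le> m0"
  shows "2 + m * \<beta> > 0" "m * \<beta>\<^sup>2 / (2 + m * \<beta>) \<in> U"
proof -
  have "\<bar>m\<bar> \<le> 1 / \<bar>\<beta>\<bar>" "\<bar>m\<bar> \<le> d / \<beta>\<^sup>2" using assms by (auto simp: m0)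
  then have "\<bar>m * \<beta>\<bar> \<le> 1" and *: "\<bar>m * \<beta>\<^sup>2\<bar> \<le> d"
    using \<beta> by (simp_all add: field_simps abs_mult)
  then have ge: "2 + m * \<beta> \<ge> 1" by linarith
  then show "2 + m * \<beta> > 0" by linarith
  have "\<bar>m * \<beta>\<^sup>2 / (2 + m * \<beta>)\<bar> \<le> \<bar>m * \<beta>\<^sup>2\<bar> / 1"
    unfolding abs_divide using ge by (intro divide_left_mono) auto
  then have "\<bar>m * \<beta>\<^sup>2 / (2 + m * \<beta>)\<bar> \<le> d" using * by linarith
  then have "m * \<beta>\<^sup>2 / (2 + m * \<beta>) \<in> {-d..d}"
    unfolding abs_le_iff atLeastAtMost_iff by linarith
  then show "m * \<beta>\<^sup>2 / (2 + m * \<beta>) \<in> U" using d by blast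
qed

lemma rotation_step:
  assumes m: "\<bar>m\<bar> \<le> m0" and s: "0 < s"
  shows "(fst x + m * \<beta>\<^sup>2 / (2 + m * \<beta>) * s,
    centre m + exp (\<i> * of_real (2 * \<beta> / (2 + m * \<beta>) * s)) * (snd x - centre m)) \<in> orb lam U x"
proof -
  note b = rotation_bounds[OF m]
  define c where "c = m * \<beta>\<^sup>2 / (2 + m * \<beta>)"
  define nu where "nu = lam - \<i> * of_real c"
  have om: "\<beta> - c = 2 * \<beta> / (2 + m * \<beta>)"
    using b by (simp add: c_def field_simps power2_eq_square)
  have nu: "nu = \<i> * of_real (2 * \<beta> / (2 + m * \<beta>))"
    unfolding om[symmetric] by (simp add: nu_def lam algebra_simps)
  have "2 * \<beta> / (2 + m * \<beta>) \<noteq> 0" using b \<beta> by simp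
  then have nu0: "nu \<noteq> 0"
    unfolding nu by (simp only: mult_eq_0_iff of_real_eq_0_iff complex_i_not_zero simp_thms)
  have "1 / (\<i> * of_real w) = - (\<i> * of_real (1 / w))" for w :: real
    by (simp add: divide_inverse)
  from this[of "2 * \<beta> / (2 + m * \<beta>)"] have "1 / nu = - centre m"
    unfolding nu centre_def by simp
  moreover have "flow lam (\<lambda>_. c) s x \<in> orb lam U x"
    using b s by (intro orb_flow const_control) (auto simp: c_def)
  moreover have "nu * of_real s = \<i> * of_real (2 * \<beta> / (2 + m * \<beta>) * s)"
    by (simp add: nu)
  ultimately show ?thesis
    unfolding flow_const[OF nu_def nu0] c_def[symmetric] by (simp add: add.commute)
qed

text \<open>Every angle is attained after a positive time, whatever the sense of rotation, because full turns may
  be added.\<close>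

lemma rotation:
  assumes m: "\<bar>m\<bar> \<le> m0"
  shows "\<exists>t. (t, centre m + exp (\<i> * of_real \<phi>) * (snd x - centre m)) \<in> orb lam U x"
proof -
  define \<omega> where "\<omega> = 2 * \<beta> / (2 + m * \<beta>)"
  have \<omega>: "\<omega> \<noteq> 0" using rotation_bounds[OF m] \<beta> by (simp add: \<omega>_def)
  obtain n :: int where n: "(\<phi> + 2 * pi * of_int n) / \<omega> > 0"
  proof (cases "\<omega> > 0")
    case True
    obtain n :: int where "- \<phi> / (2 * pi) < of_int n" using ex_less_of_int by blast
    then have "\<phi> + 2 * pi * of_int n > 0" using pi_gt_zero by (simp add: field_simps)
    then show ?thesis using True that divide_pos_pos by blast
  next
    case False
    obtain n :: int where "of_int n < - \<phi> / (2 * pi)" using ex_of_int_less by blast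
    then have "\<phi> + 2 * pi * of_int n < 0" using pi_gt_zero by (simp add: field_simps)
    moreover have "\<omega> < 0" using False \<omega> by simp
    ultimately show ?thesis using that divide_neg_neg by blast
  qed
  from rotation_step[OF m n, of x, folded \<omega>_def] show ?thesis
    using \<omega> exp_period[of \<phi> n] by auto
qed

text \<open>A full turn brings \<open>r\<close> back to its place while \<open>t\<close> moves at the constant speed \<open>c\<close>.\<close>

lemma full_turn:
  assumes m: "\<bar>m\<bar> \<le> m0"
  shows "x + (pi * \<bar>\<beta>\<bar> * m, 0) \<in> orb lam U x"
proof -
  note b = rotation_bounds(1)[OF m]
  define s where "s = pi * (2 + m * \<beta>) / \<bar>\<beta>\<bar>"
  have s: "s > 0" using b \<beta> by (simp add: s_def)
  have "2 * \<beta> / (2 + m * \<beta>) * s = 0 + 2 * pi * of_int (if \<beta> > 0 then 1 else - 1)"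
    using b \<beta> by (simp add: s_def)
  then have "exp (\<i> * of_real (2 * \<beta> / (2 + m * \<beta>) * s)) = 1"
    using exp_period[of 0] by (metis exp_zero mult_zero_right of_real_0)
  moreover have "m * \<beta>\<^sup>2 / (2 + m * \<beta>) * s = pi * \<bar>\<beta>\<bar> * m"
  proof -
    have "m * \<beta>\<^sup>2 / (2 + m * \<beta>) * s = m * \<beta>\<^sup>2 * pi / \<bar>\<beta>\<bar>" using b by (simp add: s_def)
    also have "\<dots> = pi * \<bar>\<beta>\<bar> * m"
      using \<beta> by (cases "\<beta> > 0") (simp_all add: power2_eq_square)
    finally show ?thesis .
  qed
  ultimately show ?thesis
    using rotation_step[OF m s, of x] by (simp add: plus_prod_def)
qed

text \<open>A half turn about \<open>centre m\<close>, between two rotations about \<open>centre 0\<close> whose angles add up to \<open>\<pi>\<close>, has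
  total angle \<open>2 \<pi>\<close>, so it is a translation. Its length is twice the distance of the centres, that is
  \<open>m\<close>, and its direction is governed by the angle \<open>\<psi>\<close> of the last rotation.\<close>

lemma small_translation:
  assumes w: "norm w \<le> m0"
  shows "\<exists>t. (t, snd x + w) \<in> orb lam U x"
proof (cases "w = 0")
  case True
  then show ?thesis using full_turn[of 0 x] m0_pos
    by (intro exI[of _ "fst x"]) (simp add: zero_prod_def[symmetric])
next
  case False
  define m where "m = norm w"
  have m: "\<bar>m\<bar> \<le> m0" "m > 0" using w False by (auto simp: m_def)
  have "norm (w / (\<i> * of_real m)) = 1" using False by (simp add: norm_divide m_def norm_mult)
  then have "exp (\<i> * of_real (Arg2pi (w / (\<i> * of_real m)))) = w / (\<i> * of_real m)"
    by (rule complex_norm_eq_1_exp[THEN iffD1])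
  then obtain \<psi> where \<psi>: "w / (\<i> * of_real m) = exp (\<i> * of_real \<psi>)"
    by metis
  then have ww: "w = exp (\<i> * of_real \<psi>) * (\<i> * of_real m)" using m by (simp add: field_simps)
  have exp\<psi>: "exp (\<i> * of_real \<psi>) * exp (\<i> * of_real (pi - \<psi>)) = -1"
  proof -
    have "exp (\<i> * of_real \<psi>) * exp (\<i> * of_real (pi - \<psi>)) = exp (\<i> * of_real pi)"
      by (simp add: exp_add[symmetric] algebra_simps)
    then show ?thesis by simp
  qed
  have z: "\<bar>0\<bar> \<le> m0" using m0_pos by simp
  obtain t1 where 1: "(t1, centre 0 + exp (\<i> * of_real (pi - \<psi>)) * (snd x - centre 0)) \<in> orb lam U x"
      (is "?x1 \<in> _") using rotation[OF z] by blast
  obtain t2 where 2: "(t2, centre m + exp (\<i> * of_real pi) * (snd ?x1 - centre m)) \<in> orb lam U ?x1"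
      (is "?x2 \<in> _") using rotation[OF m(1)] by blast
  obtain t3 where 3: "(t3, centre 0 + exp (\<i> * of_real \<psi>) * (snd ?x2 - centre 0)) \<in> orb lam U ?x2"
    using rotation[OF z] by blast
  have cm: "centre m = centre 0 + \<i> * of_real m / 2"
    using \<beta> by (simp add: centre_def add_divide_distrib algebra_simps)
  have "centre 0 + exp (\<i> * of_real \<psi>) * (snd ?x2 - centre 0) =
      centre 0 + exp (\<i> * of_real \<psi>) * (2 * (centre m - centre 0))
        - exp (\<i> * of_real \<psi>) * exp (\<i> * of_real (pi - \<psi>)) * (snd x - centre 0)"
    by (simp add: algebra_simps)
  also have "\<dots> = snd x + w"
    unfolding exp\<psi> by (simp add: cm ww)
  finally have "(t3, snd x + w) \<in> orb lam U x"
    using orb_trans[OF orb_trans[OF 1 2] 3] by simp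
  then show ?thesis by blast
qed

text \<open>First reach the right \<open>r\<close> by equal small translations, which move \<open>t\<close> in some way; then correct \<open>t\<close> by
  full turns.\<close>

lemma neutral_reaches_everything: "y \<in> orb lam U x"
proof -
  obtain N :: nat where "norm (snd y - snd x) / m0 < of_nat N" using reals_Archimedean2 by blast
  then have N: "norm (snd y - snd x) / m0 \<le> of_nat (Suc N)" by simp
  define v where "v = (snd y - snd x) / of_nat (Suc N)"
  have v: "norm v \<le> m0"
    using N m0_pos by (simp add: v_def norm_divide field_simps del: of_nat_Suc)
  have "\<exists>t. (t, snd x + of_nat (Suc n) * v) \<in> orb lam U x" for n
  proof (induction n)
    case 0 show ?case using small_translation[OF v] by simp
  next
    case (Suc n)
    then obtain t where t: "(t, snd x + of_nat (Suc n) * v) \<in> orb lam U x" by blast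
    obtain t' where "(t', snd x + of_nat (Suc n) * v + v) \<in> orb lam U (t, snd x + of_nat (Suc n) * v)"
      using small_translation[OF v] by (metis snd_conv)
    with t have "(t', snd x + of_nat (Suc n) * v + v) \<in> orb lam U x" using orb_trans by blast
    moreover have "snd x + of_nat (Suc n) * v + v = snd x + of_nat (Suc (Suc n)) * v"
      by (simp add: algebra_simps)
    ultimately show ?case by metis
  qed
  moreover have "snd x + of_nat (Suc N) * v = snd y" by (simp add: v_def del: of_nat_Suc)
  ultimately obtain t where t: "(t, snd y) \<in> orb lam U x" by metis
  have per: "pi * \<bar>\<beta>\<bar> * m0 > 0" using m0_pos \<beta> by simp
  obtain N :: nat where "\<bar>fst y - t\<bar> / (pi * \<bar>\<beta>\<bar> * m0) < of_nat N" using reals_Archimedean2 by blast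
  then have N: "\<bar>fst y - t\<bar> / (pi * \<bar>\<beta>\<bar> * m0) \<le> of_nat (Suc N)" by simp
  define m where "m = (fst y - t) / (of_nat (Suc N) * (pi * \<bar>\<beta>\<bar>))"
  have "\<bar>m\<bar> = \<bar>fst y - t\<bar> / (of_nat (Suc N) * (pi * \<bar>\<beta>\<bar>))"
    by (simp add: m_def abs_divide abs_mult del: of_nat_Suc)
  also have "\<dots> \<le> m0"
  proof -
    have "\<bar>fst y - t\<bar> \<le> of_nat (Suc N) * (pi * \<bar>\<beta>\<bar> * m0)"
      using N per by (simp only: pos_divide_le_eq)
    then show ?thesis
      using \<beta> by (subst pos_divide_le_eq) (simp_all add: ac_simps del: of_nat_Suc)
  qed
  finally have m: "\<bar>m\<bar> \<le> m0" .
  have "(t, snd y) + (of_nat (Suc n) * (pi * \<bar>\<beta>\<bar> * m), 0) \<in> orb lam U (t, snd y)" for n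
  proof (induction n)
    case 0 show ?case using full_turn[OF m, of "(t, snd y)"] by simp
  next
    case (Suc n)
    let ?x = "(t, snd y) + (of_nat (Suc n) * (pi * \<bar>\<beta>\<bar> * m), 0)"
    have "?x + (pi * \<bar>\<beta>\<bar> * m, 0) \<in> orb lam U (t, snd y)"
      using orb_trans[OF Suc full_turn[OF m]] .
    moreover have "?x + (pi * \<bar>\<beta>\<bar> * m, 0) =
        (t, snd y) + (of_nat (Suc (Suc n)) * (pi * \<bar>\<beta>\<bar> * m), 0)"
      by (simp add: algebra_simps)
    ultimately show ?case by (simp only:)
  qed
  moreover have "(t, snd y) + (of_nat (Suc N) * (pi * \<bar>\<beta>\<bar> * m), 0) = y"
    using \<beta> by (simp add: m_def prod_eq_iff del: of_nat_Suc)
  ultimately have "y \<in> orb lam U (t, snd y)" by metis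
  then show ?thesis using orb_trans[OF t] by blast
qed

end

text \<open>The set \<open>C\<close> is chosen before the period \<open>T\<close>; this is why the control sets of the group and of its
  quotients correspond to each other. For \<open>Re lam < 0\<close> the set is the attractor, for \<open>Re lam > 0\<close> the
  interior of the repeller, and for \<open>Re lam = 0\<close> everything.\<close>

theorem recurrent_core:
  assumes lam: "lam \<noteq> 0" and d: "0 < d" "{-d..d} \<subseteq> U"
  shows "\<exists>C. interior C \<noteq> {} \<and> (\<forall>x\<in>C. \<forall>a. x + (a, 0) \<in> C) \<and>
    (\<forall>T. recurrent lam U T C \<and> (\<forall>B. recurrent lam U T B \<longrightarrow> interior B \<noteq> {} \<longrightarrow> B \<subseteq> C))"
proof -
  consider "Re lam < 0" | "Re lam > 0" | "Re lam = 0" by linarith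
  then show ?thesis
  proof cases
    case 1
    note l = this d
    show ?thesis
      using interior_attractor[OF l] attractor_translate[OF l] recurrent_attractor[OF l]
        recurrent_subset_attractor[OF l] by (intro exI[of _ "attractor lam U"]) blast
  next
    case 2
    note l = this d
    show ?thesis
      using interior_repeller[OF l] interior_repeller_translate[OF l] recurrent_interior_repeller[OF l]
        recurrent_subset_interior_repeller[OF l]
      by (intro exI[of _ "interior (repeller lam U)"]) (simp only: interior_interior, blast)
  next
    case 3
    then have "lam = \<i> * of_real (Im lam)" "Im lam \<noteq> 0"
      using lam by (auto simp: complex_eq_iff)
    from neutral_reaches_everything[OF this(2,1) d refl]
    have orb: "orb lam U x = UNIV" for x by blast
    have "(\<lambda>_. 0) \<in> controls U" using d by (intro const_control) auto
    moreover have "saturate T UNIV = UNIV" for T using subset_saturate[of UNIV T] by blast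
    ultimately have "recurrent lam U T UNIV" for T
      unfolding recurrent_def orb by (simp add: bexI[of _ "\<lambda>_. 0"]) blast
    then show ?thesis by (intro exI[of _ UNIV]) simp
  qed
qed

section \<open>Affine fields and the rank condition\<close>

definition cx :: "real ^ 2 \<Rightarrow> complex" where
  "cx v = Complex (v $ 1) (v $ 2)"

definition vec_of :: "complex \<Rightarrow> real ^ 2" where
  "vec_of z = vector [Re z, Im z]"

lemma cx_vec_of [simp]: "cx (vec_of z) = z"
  by (simp add: cx_def vec_of_def)

lemma vec_of_cx [simp]: "vec_of (cx v) = v"
  by (simp add: cx_def vec_of_def vec_eq_iff forall_2)

lemma linear_cx: "linear cx"
  by (rule linearI) (simp_all add: cx_def complex_eq_iff)

lemma linear_vec_of: "linear vec_of"
  by (rule linearI) (simp_all add: vec_of_def vec_eq_iff forall_2)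

lemmas bounded_linear_cx = linear_cx[THEN linear_linear[THEN iffD2]]
lemmas bounded_linear_vec_of = linear_vec_of[THEN linear_linear[THEN iffD2]]

lemma cx_rho: "cx (rho t *v w) = exp (\<i> * of_real t) * cx w"
  by (simp add: rho_mult cx_def complex_eq_iff Re_exp Im_exp)

lemma cx_Lambda: "cx (Lambda t w) = - \<i> * (exp (\<i> * of_real t) - 1) * cx w"
  by (simp add: Lambda_eq cx_def complex_eq_iff Re_exp Im_exp algebra_simps)

text \<open>The matrices commuting with a rotation by a right angle are the complex multiplications.\<close>

lemma commutes_theta:
  assumes "A ** theta = theta ** A"
  shows "cx (A *v v) = Complex (A $ 1 $ 1) (A $ 2 $ 1) * cx v"
    and "det A = (norm (Complex (A $ 1 $ 1) (A $ 2 $ 1)))\<^sup>2"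
proof -
  have "(A ** theta) $ 1 $ 1 = (theta ** A) $ 1 $ 1" "(A ** theta) $ 1 $ 2 = (theta ** A) $ 1 $ 2"
    using assms by simp_all
  then have "A $ 1 $ 2 = - A $ 2 $ 1" "A $ 2 $ 2 = A $ 1 $ 1"
    by (simp_all add: matrix_matrix_mult_def sum_2 theta_def)
  then show "cx (A *v v) = Complex (A $ 1 $ 1) (A $ 2 $ 1) * cx v"
    and "det A = (norm (Complex (A $ 1 $ 1) (A $ 2 $ 1)))\<^sup>2"
    by (simp_all add: cx_def complex_eq_iff matrix_vector_mult_def sum_2 det_2 cmod_def power2_eq_square)
qed

type_synonym coeffs = "real \<times> complex \<times> complex \<times> complex"

text \<open>A family containing the linear and the left-invariant fields and closed under sums, multiples and
  brackets, so that the whole Lie algebra can be described by coefficients.\<close>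

definition affine_field :: "coeffs \<Rightarrow> pt \<Rightarrow> pt" where
  "affine_field = (\<lambda>(\<tau>, m, b, c) (t, v). (\<tau>, vec_of (m * cx v + exp (\<i> * of_real t) * b + c)))"

definition coeff_bracket :: "coeffs \<Rightarrow> coeffs \<Rightarrow> coeffs" where
  "coeff_bracket = (\<lambda>(\<tau>, m, b, c) (\<tau>', m', b', c').
     (0, 0, m' * b - m * b' + \<i> * (of_real \<tau> * b' - of_real \<tau>' * b), m' * c - m * c'))"

lemma linear_field_affine:
  assumes "\<And>v. cx (A *v v) = lam * cx v"
  shows "linear_field A \<xi> = affine_field (0, lam, - \<i> * cx \<xi>, \<i> * cx \<xi>)"
proof
  fix x :: pt
  obtain t v where x: "x = (t, v)" by (cases x)
  have "cx (A *v v + Lambda t \<xi>) = lam * cx v + exp (\<i> * of_real t) * (- \<i> * cx \<xi>) + \<i> * cx \<xi>"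
    using assms linear_add[OF linear_cx] by (simp add: cx_Lambda algebra_simps)
  then show "linear_field A \<xi> x = affine_field (0, lam, - \<i> * cx \<xi>, \<i> * cx \<xi>) x"
    by (simp add: linear_field_def affine_field_def x) (metis vec_of_cx)
qed

lemma invariant_field_affine: "invariant_field \<alpha> \<eta> = affine_field (\<alpha>, 0, cx \<eta>, 0)"
  by (auto simp: invariant_field_def affine_field_def fun_eq_iff cx_rho[symmetric])

lemma affine_field_derivative:
  "(affine_field (\<tau>, m, b, c) has_derivative
     (\<lambda>(h, w). (0, vec_of (m * cx w + \<i> * of_real h * exp (\<i> * of_real t) * b)))) (at (t, v))"
proof -
  have "((\<lambda>x. m * cx (snd x) + exp (\<i> * of_real (fst x)) * b + c) has_derivative
     (\<lambda>x. m * cx (snd x) + \<i> * of_real (fst x) * exp (\<i> * of_real t) * b)) (at (t, v))"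
    by (auto intro!: derivative_eq_intros has_derivative_cexp bounded_linear.has_derivative[OF bounded_linear_cx]
        simp: algebra_simps)
  from has_derivative_Pair[OF has_derivative_const[of \<tau>] bounded_linear.has_derivative[OF bounded_linear_vec_of this]]
  show ?thesis
    by (simp add: affine_field_def case_prod_unfold)
qed

lemma affine_field_bracket:
  "euclidean_bracket (affine_field q) (affine_field q') x = affine_field (coeff_bracket q q') x"
proof -
  obtain \<tau> m b c \<tau>' m' b' c' t v where q: "q = (\<tau>, m, b, c)" "q' = (\<tau>', m', b', c')" "x = (t, v)"
    by (metis prod.exhaust)
  have *: "vec_of y - vec_of z = vec_of (y - z)" for y z
    by (simp add: linear_diff[OF linear_vec_of])
  show ?thesis
    unfolding euclidean_bracket_def q frechet_derivative_at[OF affine_field_derivative, symmetric]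
    by (simp add: affine_field_def coeff_bracket_def * algebra_simps)
qed

lemma affine_field_add: "affine_field (q + q') x = affine_field q x + affine_field q' x"
  by (simp add: affine_field_def case_prod_unfold linear_add[OF linear_vec_of, symmetric] algebra_simps)

lemma affine_field_scale: "affine_field (r *\<^sub>R q) x = r *\<^sub>R affine_field q x"
  by (simp add: affine_field_def case_prod_unfold linear_scale[OF linear_vec_of, symmetric] algebra_simps)

lemma affine_field_periodic:
  "affine_field q (t + 2 * of_int k * real n * pi, v) = affine_field q (t, v)"
proof -
  have "t + 2 * of_int k * real n * pi = t + 2 * pi * of_int (k * int n)" by simp
  then have "exp (\<i> * of_real (t + 2 * of_int k * real n * pi)) = exp (\<i> * of_real t)"
    by (simp only: exp_period)
  then show ?thesis by (simp add: affine_field_def case_prod_unfold)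
qed

lemma descend_affine_field: "descend (proj n) (affine_field q) (proj n x) = affine_field q x"
  by (rule descend_proj) (rule affine_field_periodic)

lemma lie_algebra_affine:
  assumes F: "F \<in> lie_algebra (proj n) (descend (proj n) (affine_field q)) (descend (proj n) (affine_field q'))"
    and S: "q \<in> S" "q' \<in> S"
    and add: "\<And>a b. a \<in> S \<Longrightarrow> b \<in> S \<Longrightarrow> a + b \<in> S"
    and scale: "\<And>a r. a \<in> S \<Longrightarrow> r *\<^sub>R a \<in> S"
    and br: "\<And>a b. a \<in> S \<Longrightarrow> b \<in> S \<Longrightarrow> coeff_bracket a b \<in> S"
  shows "\<exists>a\<in>S. \<forall>x. F (proj n x) = affine_field a x"
  using F
proof induction
  case drift
  then show ?case using S descend_affine_field by blast
next
  case control
  then show ?case using S descend_affine_field by blast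
next
  case (add F H)
  then obtain a b where "a \<in> S" "b \<in> S" "\<And>x. F (proj n x) = affine_field a x"
      "\<And>x. H (proj n x) = affine_field b x" by blast
  then show ?case using assms(4) by (intro bexI[of _ "a + b"]) (simp_all add: affine_field_add)
next
  case (scale F c)
  then obtain a where "a \<in> S" "\<And>x. F (proj n x) = affine_field a x" by blast
  then show ?case using assms(5) by (intro bexI[of _ "c *\<^sub>R a"]) (simp_all add: affine_field_scale)
next
  case (bracket F H)
  then obtain a b where ab: "a \<in> S" "b \<in> S" "\<And>x. F (proj n x) = affine_field a x"
      "\<And>x. H (proj n x) = affine_field b x" by blast
  then have "F \<circ> proj n = affine_field a" "H \<circ> proj n = affine_field b" by auto
  then have "bracket (proj n) F H (proj n x) = affine_field (coeff_bracket a b) x" for x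
    unfolding bracket_def using descend_affine_field[of n "coeff_bracket a b" x]
    by (simp add: affine_field_bracket descend_def)
  then show ?case using ab br by blast
qed

text \<open>If \<open>\<alpha> = 0\<close>, every field in the Lie algebra has first component zero. If
  \<open>\<alpha> xi + lam eta = 0\<close>, the two generating fields commute, so they span the Lie algebra, which has
  dimension at most two. In both cases the rank condition fails in the three-dimensional group.\<close>

lemma LARC_nondegenerate:
  assumes LARC: "LARC (proj n) (descend (proj n) (affine_field (0, lam, - \<i> * xi, \<i> * xi)))
    (descend (proj n) (affine_field (\<alpha>, 0, eta, 0)))"
  shows "\<alpha> \<noteq> 0" and "of_real \<alpha> * xi + lam * eta \<noteq> 0"
proof -
  let ?q = "(0, lam, - \<i> * xi, \<i> * xi) :: coeffs" and ?q' = "(\<alpha>, 0, eta, 0) :: coeffs"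
  let ?L = "lie_algebra (proj n) (descend (proj n) (affine_field ?q)) (descend (proj n) (affine_field ?q'))"
  have span: "span {F (proj n 0) |F. F \<in> ?L} = UNIV"
    using LARC unfolding LARC_def by blast
  show \<alpha>: "\<alpha> \<noteq> 0"
  proof
    assume [simp]: "\<alpha> = 0"
    have "{F (proj n 0) |F. F \<in> ?L} \<subseteq> {x. fst x = 0}"
    proof
      fix y assume "y \<in> {F (proj n 0) |F. F \<in> ?L}"
      then obtain F where y: "y = F (proj n 0)" and F: "F \<in> ?L" by blast
      have "\<exists>a\<in>{q. fst q = 0}. \<forall>x. F (proj n x) = affine_field a x"
        by (rule lie_algebra_affine[OF F]) (auto simp: coeff_bracket_def case_prod_unfold)
      then obtain a where "a \<in> {q. fst q = 0}" "\<forall>x. F (proj n x) = affine_field a x" by blast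
      then have "fst (F (proj n 0)) = fst (affine_field a 0)" "fst a = 0" by (simp_all del: split_paired_All)
      then show "y \<in> {x. fst x = 0}" by (simp add: y affine_field_def case_prod_unfold)
    qed
    then have "span {F (proj n 0) |F. F \<in> ?L} \<subseteq> {x. fst x = 0}"
      by (rule span_minimal) (auto simp: subspace_def)
    then have "(1, 0) \<in> {x :: pt. fst x = 0}" using span by blast
    then show False by simp
  qed
  show "of_real \<alpha> * xi + lam * eta \<noteq> 0"
  proof
    assume 0: "of_real \<alpha> * xi + lam * eta = 0"
    let ?S = "{k *\<^sub>R ?q + l *\<^sub>R ?q' |k l. True}"
    \<comment> \<open>the combinations of the two generators are closed under brackets because the bracket of the generators is zero\<close>
    have in_span: "F (proj n 0) \<in> span {affine_field ?q 0, affine_field ?q' 0}" if F: "F \<in> ?L" for F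
    proof -
      have "\<exists>a\<in>?S. \<forall>x. F (proj n x) = affine_field a x"
      proof (rule lie_algebra_affine[OF F])
        have "?q = 1 *\<^sub>R ?q + 0 *\<^sub>R ?q'" "?q' = 0 *\<^sub>R ?q + 1 *\<^sub>R ?q'" by simp_all
        then show "?q \<in> ?S" "?q' \<in> ?S" by blast+
        show "a + b \<in> ?S" if ab: "a \<in> ?S" "b \<in> ?S" for a b
        proof -
          obtain k l k' l' where "a = k *\<^sub>R ?q + l *\<^sub>R ?q'" "b = k' *\<^sub>R ?q + l' *\<^sub>R ?q'" using ab by blast
          then have "a + b = (k + k') *\<^sub>R ?q + (l + l') *\<^sub>R ?q'" by (simp add: algebra_simps)
          then show ?thesis by blast
        qed
        show "r *\<^sub>R a \<in> ?S" if ab: "a \<in> ?S" for a r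
        proof -
          obtain k l where "a = k *\<^sub>R ?q + l *\<^sub>R ?q'" using ab by blast
          then have "r *\<^sub>R a = (r * k) *\<^sub>R ?q + (r * l) *\<^sub>R ?q'" by (simp add: algebra_simps)
          then show ?thesis by blast
        qed
        show "coeff_bracket a b \<in> ?S" if ab: "a \<in> ?S" "b \<in> ?S" for a b
        proof -
          obtain k l k' l' where *: "a = k *\<^sub>R ?q + l *\<^sub>R ?q'" "b = k' *\<^sub>R ?q + l' *\<^sub>R ?q'" using ab by blast
          have "coeff_bracket a b = (0, 0, of_real (k' * l - k * l') * (of_real \<alpha> * xi + lam * eta), 0)"
            unfolding * by (simp add: coeff_bracket_def scaleR_conv_of_real algebra_simps)
          also have "\<dots> = 0 *\<^sub>R ?q + 0 *\<^sub>R ?q'" by (simp add: 0)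
          finally show ?thesis by blast
        qed
      qed
      then obtain a where a: "a \<in> ?S" "F (proj n 0) = affine_field a 0" by blast
      then obtain k l where "a = k *\<^sub>R ?q + l *\<^sub>R ?q'" by blast
      with a have "F (proj n 0) = affine_field (k *\<^sub>R ?q + l *\<^sub>R ?q') 0" by (simp only:)
      then show ?thesis
        unfolding affine_field_add affine_field_scale
        by (simp add: span_add span_scale span_base)
    qed
    have "span {F (proj n 0) |F. F \<in> ?L} \<subseteq> span {affine_field ?q 0, affine_field ?q' 0}"
      using in_span by (intro span_minimal subspace_span) blast
    then have "span {affine_field ?q 0, affine_field ?q' 0} = UNIV"
      using span by blast
    then have "dim (UNIV :: pt set) \<le> card {affine_field ?q 0, affine_field ?q' 0}"
      using dim_le_card[of UNIV "{affine_field ?q 0, affine_field ?q' 0}"] by simp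
    also have "\<dots> \<le> 2" by (simp add: card_insert_if)
    finally show False by simp
  qed
qed

section \<open>Normal form of the trajectories\<close>

text \<open>Variation of constants for the normal form \<open>t' = w\<close>, \<open>z' = lam z + e\<^sup>\<i>\<^sup>t - 1\<close>, which makes sense for
  every \<open>lam\<close>.\<close>

definition zflow :: "complex \<Rightarrow> (real \<Rightarrow> real) \<Rightarrow> real \<Rightarrow> real \<times> complex \<Rightarrow> real \<times> complex" where
  "zflow lam w s x = (fst x + prim w s, exp (lam * of_real s) *
     (snd x + prim (\<lambda>\<sigma>. exp (- lam * of_real \<sigma>) * (exp (\<i> * of_real (fst x + prim w \<sigma>)) - 1)) s))"

lemma zflow_0 [simp]: "zflow lam w 0 x = x"
  by (simp add: zflow_def)

lemma zflow_integrand_cont: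
  "jump_set J w \<Longrightarrow> continuous_on UNIV (\<lambda>\<sigma>. exp (- lam * of_real \<sigma>) * (exp (\<i> * of_real (t + prim w \<sigma>)) - 1))"
  by (intro continuous_intros prim_jump_cont)

lemma fst_zflow_deriv:
  assumes "jump_set J w" "isCont w s"
  shows "((\<lambda>s. fst (zflow lam w s x)) has_vector_derivative w s) (at s)"
  using has_vector_derivative_add[OF has_vector_derivative_const
      prim_deriv[OF jump_set_integrable[OF assms(1)] assms(2)], of "fst x"]
  by (simp add: zflow_def)

lemma fst_zflow_cont: "jump_set J w \<Longrightarrow> continuous_on UNIV (\<lambda>s. fst (zflow lam w s x))"
  by (simp add: zflow_def prim_jump_cont continuous_on_add)

lemma snd_zflow_deriv:
  assumes J: "jump_set J w"
  shows "((\<lambda>s. snd (zflow lam w s x)) has_vector_derivative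
    lam * snd (zflow lam w s x) + exp (\<i> * of_real (fst (zflow lam w s x))) - 1) (at s)"
proof -
  let ?f = "\<lambda>\<sigma>. exp (- lam * of_real \<sigma>) * (exp (\<i> * of_real (fst x + prim w \<sigma>)) - 1)"
  have "((\<lambda>s. snd x + prim ?f s) has_vector_derivative ?f s) (at s)"
    using has_vector_derivative_add[OF has_vector_derivative_const
        prim_deriv_cont[OF zflow_integrand_cont[OF J]], of "snd x"] by simp
  from has_vector_derivative_mult[OF has_vector_derivative_exp_real[of lam s] this]
  have D: "((\<lambda>s. exp (lam * of_real s) * (snd x + prim ?f s)) has_vector_derivative
      exp (lam * of_real s) * ?f s + lam * exp (lam * of_real s) * (snd x + prim ?f s)) (at s)" .
  have "exp (lam * of_real s) * ?f s = exp (\<i> * of_real (fst x + prim w s)) - 1"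
    by (simp add: exp_minus)
  then have "exp (lam * of_real s) * ?f s + lam * exp (lam * of_real s) * (snd x + prim ?f s) =
      lam * (exp (lam * of_real s) * (snd x + prim ?f s)) + exp (\<i> * of_real (fst x + prim w s)) - 1"
    by (simp only: mult.assoc add_diff_eq diff_add_eq add.commute)
  with D show ?thesis by (simp only: zflow_def fst_conv snd_conv)
qed

lemma snd_zflow_cont: "jump_set J w \<Longrightarrow> continuous_on UNIV (\<lambda>s. snd (zflow lam w s x))"
  using snd_zflow_deriv
  by (meson continuous_at_imp_continuous_on has_vector_derivative_continuous)

lemma snd_zflow_unique:
  assumes J: "jump_set J w" and g: "continuous_on UNIV g"
    and d: "\<And>s. s \<notin> J \<Longrightarrow>
      (g has_vector_derivative lam * g s + exp (\<i> * of_real (fst (zflow lam w s x))) - 1) (at s)"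
    and 0: "g 0 = snd x"
  shows "g s = snd (zflow lam w s x)"
proof -
  let ?h = "\<lambda>s. exp (- lam * of_real s) * (g s - snd (zflow lam w s x))"
  have "?h s = ?h 0"
  proof (rule zero_derivative_const[OF jump_set_finite[OF J]])
    have "continuous_on UNIV (\<lambda>s. exp (- lam * complex_of_real s))"
      by (intro continuous_intros)
    then show "continuous_on UNIV ?h"
      by (rule continuous_on_mult[OF _ continuous_on_diff[OF g snd_zflow_cont[OF J]]])
    fix s assume "s \<notin> J"
    from has_vector_derivative_mult[OF has_vector_derivative_exp_real[of "- lam" s]
        has_vector_derivative_diff[OF d[OF this] snd_zflow_deriv[OF J, of lam x]]]
    show "(?h has_vector_derivative 0) (at s)" by (simp add: algebra_simps)
  qed
  then show ?thesis using 0 by simp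
qed

text \<open>The group and its quotients at once: \<open>p\<close> identifies the points that differ by \<open>2 \<pi> m k\<close> in \<open>t\<close>. It will
  be \<open>id\<close> for \<open>m = 0\<close>, and \<open>proj m\<close> for positive \<open>m\<close>. The number \<open>kappa\<close> is the drift that remains when the
  motion along the left-invariant field has been subtracted; by the rank condition it is not zero and can
  be scaled to \<open>1\<close>.\<close>

locale planar_lcs =
  fixes p :: "pt \<Rightarrow> 'm" and m :: nat and f0 f1 :: "'m \<Rightarrow> pt"
    and \<alpha> :: real and lam xi eta kappa :: complex
  assumes fibre: "p x = p y \<longleftrightarrow> (\<exists>k::int. x = y + (2 * pi * real m * of_int k, 0))"
    and f0: "f0 (p x) = affine_field (0, lam, - \<i> * xi, \<i> * xi) x"
    and f1: "f1 (p x) = affine_field (\<alpha>, 0, eta, 0) x"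
    and \<alpha>: "\<alpha> \<noteq> 0"
    and kappa: "kappa = - \<i> * (xi + lam * eta / of_real \<alpha>)"
    and kappa0: "kappa \<noteq> 0"
begin

text \<open>Along the left-invariant field the sum of \<open>v\<close> and the offset is constant. Dividing it by \<open>kappa\<close> gives
  the coordinate \<open>z\<close> of the normal form.\<close>

definition offset :: "real \<Rightarrow> complex" where
  "offset t = \<i> * (exp (\<i> * of_real t) - 1) * (eta / of_real \<alpha>)"

definition zcoord :: "pt \<Rightarrow> complex" where
  "zcoord x = (cx (snd x) + offset (fst x)) / kappa"

definition up :: "real \<times> complex \<Rightarrow> pt" where
  "up x = (fst x, vec_of (kappa * snd x - offset (fst x)))"

lemma fst_up [simp]: "fst (up x) = fst x"
  by (simp add: up_def)

lemma zcoord_up [simp]: "zcoord (up x) = snd x"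
  using kappa0 by (simp add: up_def zcoord_def)

lemma up_zcoord [simp]: "up (fst x, zcoord x) = x"
  using kappa0 by (simp add: up_def zcoord_def)

lemma exp_multiple: "exp (\<i> * of_real (t + 2 * pi * real m * of_int k)) = exp (\<i> * of_real t)"
  using exp_period[of t "int m * k"] by (simp add: algebra_simps)

lemma offset_periodic: "offset (t + 2 * pi * real m * of_int k) = offset t"
  unfolding offset_def exp_multiple ..

lemma offset_kappa:
  "lam * offset t + kappa * (exp (\<i> * of_real t) - 1) = - \<i> * (exp (\<i> * of_real t) - 1) * xi"
  by (simp add: offset_def kappa algebra_simps diff_divide_distrib)

lemma up_translate: "up (x + (2 * pi * real m * of_int k, 0)) = up x + (2 * pi * real m * of_int k, 0)"
  by (simp add: up_def offset_periodic)

lemma zcoord_translate: "zcoord (x + (2 * pi * real m * of_int k, 0)) = zcoord x"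
  by (simp add: zcoord_def offset_periodic)

lemma p_lift: "q \<in> range p \<Longrightarrow> p (lift_pt p q) = q"
  unfolding lift_pt_def by (auto intro: someI)

lemma continuous_offset: "continuous_on S g \<Longrightarrow> continuous_on S (\<lambda>x. offset (g x))"
  unfolding offset_def by (intro continuous_intros)

lemma continuous_up: "continuous_on S g \<Longrightarrow> continuous_on S (\<lambda>x. up (g x))"
  unfolding up_def
  by (intro continuous_intros continuous_offset bounded_linear.continuous_on[OF bounded_linear_vec_of])

lemma continuous_zcoord: "continuous_on S zcoord"
  unfolding zcoord_def using kappa0
  by (intro continuous_intros continuous_offset bounded_linear.continuous_on[OF bounded_linear_cx]) auto

lemma offset_has_derivative:
  fixes g :: "'a::real_normed_vector \<Rightarrow> real"
  assumes "(g has_derivative g') (at x)"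
  shows "((\<lambda>x. offset (g x)) has_derivative
     (\<lambda>h. - (of_real (g' h) * exp (\<i> * of_real (g x)) * (eta / of_real \<alpha>)))) (at x)"
proof -
  have "((\<lambda>x. \<i> * (exp (\<i> * of_real (g x)) - 1) * b) has_derivative
     (\<lambda>h. \<i> * (exp (\<i> * of_real (g x)) * (\<i> * of_real (g' h))) * b)) (at x)" for b
    by (auto intro!: derivative_eq_intros has_derivative_cexp assms)
  moreover have "\<i> * (e * (\<i> * a)) * b = - (a * e * b)" for e a b :: complex
    by (simp add: algebra_simps)
  ultimately show ?thesis unfolding offset_def by (simp only:)
qed

text \<open>Functions that are constant on the fibres are used to observe curves in the quotient without lifting
  them.\<close>

lemma invariant_continuous:
  fixes g :: "pt \<Rightarrow> complex"
  assumes inv: "\<And>x k. g (x + (2 * pi * real m * of_int k, 0)) = g x" and g: "continuous_on UNIV g"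
  shows "continuous_map (quot_top p) euclidean (g \<circ> lift_pt p)"
  unfolding continuous_map_def
proof (intro conjI allI impI)
  fix V :: "complex set" assume "openin euclidean V"
  then have "open (g -` V)" using g by (simp add: open_vimage)
  have "g (lift_pt p (p x)) = g x" for x
  proof -
    have "p (lift_pt p (p x)) = p x" by (rule p_lift) simp
    then show ?thesis using inv fibre by metis
  qed
  then have "p -` {q \<in> topspace (quot_top p). (g \<circ> lift_pt p) q \<in> V} = g -` V"
    by (auto simp: topspace_quot_top)
  then show "openin (quot_top p) {q \<in> topspace (quot_top p). (g \<circ> lift_pt p) q \<in> V}"
    using \<open>open (g -` V)\<close> by (auto simp: openin_quot_top topspace_quot_top)
qed simp

text \<open>The local lift in the definition of a velocity may depend on the point \<open>s\<close>, and away from \<open>s\<close> it need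
  not even be continuous. Composed with a function constant on the fibres it agrees near \<open>s\<close> with the
  globally defined observation of the curve, which therefore inherits the derivative.\<close>

lemma invariant_derivative:
  assumes v: "has_velocity p \<gamma> w s"
  shows "\<exists>x. p x = \<gamma> s \<and> (\<forall>(g :: pt \<Rightarrow> complex) g'.
    (\<forall>x k. g (x + (2 * pi * real m * of_int k, 0)) = g x) \<longrightarrow> (g has_derivative g') (at x) \<longrightarrow>
    ((\<lambda>r. g (lift_pt p (\<gamma> r))) has_vector_derivative g' w) (at s))"
proof -
  obtain \<sigma> where \<sigma>: "\<forall>\<^sub>F r in nhds s. p (\<sigma> r) = \<gamma> r" "(\<sigma> has_vector_derivative w) (at s)"
    using v unfolding has_velocity_def by blast
  show ?thesis
  proof (intro exI[of _ "\<sigma> s"] conjI allI impI)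
    show "p (\<sigma> s) = \<gamma> s" using \<sigma>(1) by (rule eventually_nhds_x_imp_x)
    fix g :: "pt \<Rightarrow> complex" and g'
    assume inv: "\<forall>x k. g (x + (2 * pi * real m * of_int k, 0)) = g x" and g: "(g has_derivative g') (at (\<sigma> s))"
    have eq: "g (\<sigma> r) = g (lift_pt p (\<gamma> r))" if "p (\<sigma> r) = \<gamma> r" for r
    proof -
      have "\<gamma> r \<in> range p" using that by (metis rangeI)
      then have "p (lift_pt p (\<gamma> r)) = p (\<sigma> r)" using p_lift that by simp
      then show ?thesis using inv fibre by metis
    qed
    have "((\<lambda>r. g (\<sigma> r)) has_derivative (\<lambda>h. g' (h *\<^sub>R w))) (at s)"
      using has_derivative_compose[OF \<sigma>(2)[unfolded has_vector_derivative_def] g] .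
    then have D: "((\<lambda>r. g (\<sigma> r)) has_vector_derivative g' w) (at s)"
      using has_derivative_linear[OF g] by (simp add: has_vector_derivative_def linear_scale)
    obtain A where A: "open A" "s \<in> A" "\<And>r. r \<in> A \<Longrightarrow> p (\<sigma> r) = \<gamma> r"
      using \<sigma>(1) unfolding eventually_nhds by blast
    show "((\<lambda>r. g (lift_pt p (\<gamma> r))) has_vector_derivative g' w) (at s)"
      by (rule has_vector_derivative_transform_within_open[OF D A(1,2)]) (use A(3) eq in blast)
  qed
qed

lemma continuous_map_p: "continuous_map euclidean (quot_top p) p"
  by (auto simp: continuous_map_def openin_quot_top topspace_quot_top vimage_def)

lemma field_sum:
  "f0 (p x) + u *\<^sub>R f1 (p x) = (u * \<alpha>, vec_of (lam * cx (snd x)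
     - \<i> * (exp (\<i> * of_real (fst x)) - 1) * xi + of_real u * exp (\<i> * of_real (fst x)) * eta))"
proof -
  have "u *\<^sub>R vec_of z = vec_of (of_real u * z)" for z
    by (metis linear_scale linear_vec_of scaleR_conv_of_real)
  then show ?thesis
    unfolding f0 f1
    by (simp add: affine_field_def case_prod_unfold linear_add[OF linear_vec_of, symmetric] algebra_simps)
qed

text \<open>Existence: the explicit solution of the normal form, written in the original coordinates and
  projected, has the prescribed velocity wherever the control is continuous.\<close>

lemma solution_zflow:
  assumes J: "jump_set J u"
  shows "solution p f0 f1 u (p (up x)) (\<lambda>s. p (up (zflow lam (\<lambda>s. \<alpha> * u s) s x)))"
  unfolding solution_def
proof (intro conjI allI impI)
  let ?w = "\<lambda>s. \<alpha> * u s"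
  let ?\<sigma> = "\<lambda>s. up (zflow lam ?w s x)"
  note Jw = jump_set_comp[OF J, of "\<lambda>x. \<alpha> * x"]
  have "continuous_on UNIV (\<lambda>s. (fst (zflow lam ?w s x), snd (zflow lam ?w s x)))"
    by (rule continuous_on_Pair[OF fst_zflow_cont[OF Jw] snd_zflow_cont[OF Jw]])
  then have "continuous_on UNIV ?\<sigma>" by (intro continuous_up) simp
  then have "continuous_map euclideanreal (quot_top p) (p \<circ> ?\<sigma>)"
    by (intro continuous_map_compose[OF _ continuous_map_p]) simp
  then show "continuous_map euclideanreal (quot_top p) (\<lambda>s. p (?\<sigma> s))" by (simp add: o_def)
  fix s assume "isCont u s"
  then have "isCont ?w s" by (intro continuous_intros)
  let ?t = "fst (zflow lam ?w s x)" and ?z = "snd (zflow lam ?w s x)"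
  let ?e = "exp (\<i> * of_real (fst (zflow lam ?w s x)))"
  have dt: "((\<lambda>s. fst (zflow lam ?w s x)) has_vector_derivative ?w s) (at s)"
    by (rule fst_zflow_deriv[OF Jw \<open>isCont ?w s\<close>])
  have "((\<lambda>s. offset (fst (zflow lam ?w s x))) has_vector_derivative
      - (of_real (?w s) * ?e * (eta / of_real \<alpha>))) (at s)"
    using offset_has_derivative[OF dt[unfolded has_vector_derivative_def]]
    by (simp add: has_vector_derivative_def scaleR_conv_of_real algebra_simps)
  from has_vector_derivative_diff[OF has_vector_derivative_mult_right[OF snd_zflow_deriv[OF Jw], of kappa] this]
  have "((\<lambda>s. kappa * snd (zflow lam ?w s x) - offset (fst (zflow lam ?w s x))) has_vector_derivative
      kappa * (lam * ?z + ?e - 1) - - (of_real (?w s) * ?e * (eta / of_real \<alpha>))) (at s)" .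
  moreover have "kappa * (lam * ?z + ?e - 1) - - (of_real (?w s) * ?e * (eta / of_real \<alpha>)) =
      lam * cx (snd (?\<sigma> s)) - \<i> * (?e - 1) * xi + of_real (u s) * ?e * eta"
  proof -
    have "lam * offset ?t + kappa * (?e - 1) = - \<i> * (?e - 1) * xi"
      by (rule offset_kappa)
    moreover have "of_real (?w s) * ?e * (eta / of_real \<alpha>) = of_real (u s) * ?e * eta"
      using \<alpha> by simp
    moreover have "lam * cx (snd (?\<sigma> s)) = kappa * lam * ?z - lam * offset ?t"
      by (simp add: up_def algebra_simps)
    moreover have "kappa * (lam * ?z + ?e - 1) - - b =
        (kappa * lam * ?z - lam * offset ?t) + (lam * offset ?t + kappa * (?e - 1)) + b" for b
      by (simp add: algebra_simps)
    ultimately show ?thesis by simp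
  qed
  ultimately have "((\<lambda>s. (fst (zflow lam ?w s x), vec_of (kappa * snd (zflow lam ?w s x) - offset (fst (zflow lam ?w s x)))))
      has_vector_derivative (?w s, vec_of (lam * cx (snd (?\<sigma> s)) - \<i> * (?e - 1) * xi + of_real (u s) * ?e * eta))) (at s)"
    by (intro has_vector_derivative_Pair dt bounded_linear.has_vector_derivative[OF bounded_linear_vec_of]) simp
  then have "(?\<sigma> has_vector_derivative f0 (p (?\<sigma> s)) + u s *\<^sub>R f1 (p (?\<sigma> s))) (at s)"
    unfolding field_sum by (simp add: up_def mult.commute)
  then show "has_velocity p (\<lambda>s. p (?\<sigma> s)) (f0 (p (?\<sigma> s)) + u s *\<^sub>R f1 (p (?\<sigma> s))) s"
    unfolding has_velocity_def by (intro exI[of _ ?\<sigma>]) simp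
qed simp

end

lemma has_vector_derivative_phase:
  assumes "(g has_vector_derivative g') (at s)"
  shows "((\<lambda>s. exp (\<i> * complex_of_real (g s))) has_vector_derivative
    \<i> * of_real g' * exp (\<i> * of_real (g s))) (at s)"
proof -
  have "((\<lambda>s. \<i> * complex_of_real (g s)) has_derivative (\<lambda>h. \<i> * of_real (h *\<^sub>R g'))) (at s)"
    using assms unfolding has_vector_derivative_def by (auto intro!: derivative_eq_intros)
  from has_derivative_cexp[OF this] show ?thesis
    by (simp add: has_vector_derivative_def scaleR_conv_of_real algebra_simps)
qed

context planar_lcs
begin

lemma solution_invariant_continuous:
  fixes g :: "pt \<Rightarrow> complex"
  assumes sol: "solution p f0 f1 u q \<gamma>"
    and inv: "\<And>x k. g (x + (2 * pi * real m * of_int k, 0)) = g x" and g: "continuous_on UNIV g"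
  shows "continuous_on UNIV (\<lambda>s. g (lift_pt p (\<gamma> s)))"
proof -
  have "continuous_map euclideanreal (quot_top p) \<gamma>"
    using sol unfolding solution_def by blast
  from continuous_map_compose[OF this invariant_continuous[OF inv g]]
  show ?thesis by (simp add: o_def)
qed

lemma solution_range: "solution p f0 f1 u q \<gamma> \<Longrightarrow> \<gamma> s \<in> range p"
  unfolding solution_def using continuous_map_image_subset_topspace[of euclideanreal "quot_top p" \<gamma>]
  by (auto simp: topspace_quot_top)

lemma invariant_eq:
  assumes inv: "\<And>x k. g (x + (2 * pi * real m * of_int k, 0)) = g x" and "p x = p y"
  shows "g x = g y"
  using assms fibre by metis

text \<open>The quotient of the two phases is continuous, and its derivative vanishes off the jumps. The
  hypothesis on \<open>\<omega>\<close> says that the phase is constant on the fibres.\<close>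

lemma solution_phase:
  assumes J: "jump_set J u" and sol: "solution p f0 f1 u (p (up x)) \<gamma>"
    and inv: "\<And>t k. exp (\<i> * of_real (\<omega> * (t + 2 * pi * real m * of_int k))) = exp (\<i> * of_real (\<omega> * t))"
  shows "exp (\<i> * of_real (\<omega> * fst (lift_pt p (\<gamma> s)))) =
    exp (\<i> * of_real (\<omega> * (fst x + prim (\<lambda>s. \<alpha> * u s) s)))"
proof -
  let ?w = "\<lambda>s. \<alpha> * u s"
  let ?g = "\<lambda>y :: pt. exp (\<i> * of_real (\<omega> * fst y)) :: complex"
  let ?G = "\<lambda>s. ?g (lift_pt p (\<gamma> s))"
  let ?E = "\<lambda>s. exp (\<i> * of_real (- \<omega> * prim ?w s))"
  note Jw = jump_set_comp[OF J, of "\<lambda>x. \<alpha> * x"]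
  have ginv: "?g (y + (2 * pi * real m * of_int k, 0)) = ?g y" for y k
    using inv[of "fst y" k] by simp
  have const: "?G s * ?E s = ?G 0 * ?E 0"
  proof (rule zero_derivative_const[OF jump_set_finite[OF J]])
    have "continuous_on UNIV ?g" by (intro continuous_intros)
    from solution_invariant_continuous[OF sol ginv this]
    have 1: "continuous_on UNIV ?G" .
    have 2: "continuous_on UNIV ?E" by (intro continuous_intros prim_jump_cont[OF Jw])
    show "continuous_on UNIV (\<lambda>s. ?G s * ?E s)" by (rule continuous_on_mult[OF 1 2])
    fix s assume s: "s \<notin> J"
    have "has_velocity p \<gamma> (f0 (\<gamma> s) + u s *\<^sub>R f1 (\<gamma> s)) s"
      using sol isCont_off_jumps[OF J s] unfolding solution_def by blast
    from invariant_derivative[OF this] obtain y where y: "p y = \<gamma> s"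
      and D: "\<And>(g :: pt \<Rightarrow> complex) g'. (\<forall>x k. g (x + (2 * pi * real m * of_int k, 0)) = g x) \<Longrightarrow>
        (g has_derivative g') (at y) \<Longrightarrow>
        ((\<lambda>r. g (lift_pt p (\<gamma> r))) has_vector_derivative g' (f0 (\<gamma> s) + u s *\<^sub>R f1 (\<gamma> s))) (at s)"
      by blast
    have dg: "(?g has_derivative (\<lambda>h. ?g y * (\<i> * of_real (\<omega> * fst h)))) (at y)"
      by (intro has_derivative_cexp) (auto intro!: derivative_eq_intros)
    have gi: "\<forall>y k. ?g (y + (2 * pi * real m * of_int k, 0)) = ?g y" using ginv by blast
    have "(?G has_vector_derivative
        ?g y * (\<i> * of_real (\<omega> * fst (f0 (\<gamma> s) + u s *\<^sub>R f1 (\<gamma> s))))) (at s)"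
      by (rule D[OF gi dg])
    then have "(?G has_vector_derivative ?g y * (\<i> * of_real (\<omega> * (u s * \<alpha>)))) (at s)"
      unfolding y[symmetric] field_sum by simp
    moreover have "?g y = ?G s"
      by (rule invariant_eq[of ?g, OF ginv]) (use y p_lift solution_range[OF sol] in simp)
    ultimately have dG: "(?G has_vector_derivative ?G s * (\<i> * of_real (\<omega> * (u s * \<alpha>)))) (at s)" by simp
    have "(prim ?w has_vector_derivative ?w s) (at s)"
      by (rule prim_deriv[OF jump_set_integrable[OF Jw] isCont_off_jumps[OF Jw s]])
    from has_vector_derivative_phase[OF has_vector_derivative_mult_right[OF this, of "- \<omega>"]]
    have dE: "(?E has_vector_derivative \<i> * of_real (- \<omega> * ?w s) * ?E s) (at s)" .
    have "g * (\<i> * of_real (- \<omega> * ?w s) * e) + g * (\<i> * of_real (\<omega> * (u s * \<alpha>))) * e = 0" for g e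
      by (simp add: algebra_simps)
    with has_vector_derivative_mult[OF dG dE]
    show "((\<lambda>s. ?G s * ?E s) has_vector_derivative 0) (at s)" by simp
  qed
  have G0: "?G 0 = exp (\<i> * of_real (\<omega> * fst x))"
  proof -
    have "\<gamma> 0 = p (up x)" using sol by (simp add: solution_def)
    then have "?g (lift_pt p (\<gamma> 0)) = ?g (up x)"
      using p_lift by (intro invariant_eq[of ?g, OF ginv]) simp
    then show ?thesis by simp
  qed
  have E: "?E s * exp (\<i> * of_real (\<omega> * prim ?w s)) = 1"
    by (simp add: exp_add[symmetric])
  have "?G s = ?G s * (?E s * exp (\<i> * of_real (\<omega> * prim ?w s)))"
    unfolding E by simp
  also have "\<dots> = exp (\<i> * of_real (\<omega> * fst x)) * ?E 0 * exp (\<i> * of_real (\<omega> * prim ?w s))"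
    unfolding mult.assoc[symmetric] const G0 ..
  finally have "?G s = exp (\<i> * of_real (\<omega> * fst x)) * exp (\<i> * of_real (\<omega> * prim ?w s))"
    by simp
  then show ?thesis by (simp add: exp_add[symmetric] algebra_simps)
qed

text \<open>The coordinate \<open>z\<close> is also constant on the fibres, and with the phase \<open>e\<^sup>\<i>\<^sup>t\<close> known it satisfies the
  linear equation that determines it.\<close>

lemma solution_zcoord:
  assumes J: "jump_set J u" and sol: "solution p f0 f1 u (p (up x)) \<gamma>"
  shows "zcoord (lift_pt p (\<gamma> s)) = snd (zflow lam (\<lambda>s. \<alpha> * u s) s x)"
proof (rule snd_zflow_unique[OF jump_set_comp[OF J, of "\<lambda>x. \<alpha> * x"]])
  let ?w = "\<lambda>s. \<alpha> * u s"
  show "continuous_on UNIV (\<lambda>s. zcoord (lift_pt p (\<gamma> s)))"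
    by (rule solution_invariant_continuous[OF sol zcoord_translate continuous_zcoord])
  have "\<gamma> 0 = p (up x)" using sol by (simp add: solution_def)
  then have "zcoord (lift_pt p (\<gamma> 0)) = zcoord (up x)"
    using p_lift by (intro invariant_eq[of zcoord, OF zcoord_translate]) simp
  then show "zcoord (lift_pt p (\<gamma> 0)) = snd x" by simp
  fix s assume s: "s \<notin> J"
  have "has_velocity p \<gamma> (f0 (\<gamma> s) + u s *\<^sub>R f1 (\<gamma> s)) s"
    using sol isCont_off_jumps[OF J s] unfolding solution_def by blast
  from invariant_derivative[OF this] obtain y where y: "p y = \<gamma> s"
    and D: "\<And>(g :: pt \<Rightarrow> complex) g'. (\<forall>x k. g (x + (2 * pi * real m * of_int k, 0)) = g x) \<Longrightarrow>
      (g has_derivative g') (at y) \<Longrightarrow>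
      ((\<lambda>r. g (lift_pt p (\<gamma> r))) has_vector_derivative g' (f0 (\<gamma> s) + u s *\<^sub>R f1 (\<gamma> s))) (at s)"
    by blast
  let ?e = "exp (\<i> * of_real (fst y))"
  have e: "?e = exp (\<i> * of_real (fst (zflow lam ?w s x)))"
  proof -
    have "?e = exp (\<i> * of_real (fst (lift_pt p (\<gamma> s))))"
      by (rule invariant_eq[of "\<lambda>y. exp (\<i> * of_real (fst y))"])
        (use exp_multiple y p_lift solution_range[OF sol] in simp_all)
    also have "\<dots> = exp (\<i> * of_real (fst (zflow lam ?w s x)))"
      using solution_phase[OF J sol, of 1 s] exp_multiple by (simp add: zflow_def)
    finally show ?thesis .
  qed
  have zy: "zcoord y = zcoord (lift_pt p (\<gamma> s))"
    by (rule invariant_eq[of zcoord, OF zcoord_translate]) (use y p_lift solution_range[OF sol] in simp)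
  let ?o = "\<lambda>h :: pt. - (of_real (fst h) * ?e * (eta / of_real \<alpha>))"
  have "((\<lambda>y :: pt. offset (fst y)) has_derivative ?o) (at y)"
    by (rule offset_has_derivative) (auto intro!: derivative_eq_intros)
  from has_derivative_divide'[OF has_derivative_add[OF bounded_linear.has_derivative[OF bounded_linear_cx
        has_derivative_snd[OF has_derivative_ident]] this] has_derivative_const kappa0]
  have "(zcoord has_derivative (\<lambda>h. (cx (snd h) + ?o h) / kappa)) (at y)"
    using kappa0 by (simp add: zcoord_def[abs_def])
  from D[OF _ this] have
    "((\<lambda>s. zcoord (lift_pt p (\<gamma> s))) has_vector_derivative
      (lam * cx (snd y) - \<i> * (?e - 1) * xi + of_real (u s) * ?e * eta
        - of_real (u s * \<alpha>) * ?e * (eta / of_real \<alpha>)) / kappa) (at s)"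
    using zcoord_translate unfolding y[symmetric] field_sum by simp
  moreover have "lam * cx (snd y) - \<i> * (?e - 1) * xi + of_real (u s) * ?e * eta
        - of_real (u s * \<alpha>) * ?e * (eta / of_real \<alpha>) = kappa * (lam * zcoord y + ?e - 1)"
  proof -
    have "of_real (u s * \<alpha>) * ?e * (eta / of_real \<alpha>) = of_real (u s) * ?e * eta"
      using \<alpha> by simp
    moreover have "kappa * zcoord y = cx (snd y) + offset (fst y)"
      using kappa0 by (simp add: zcoord_def)
    then have "kappa * (lam * zcoord y + ?e - 1) = lam * cx (snd y) + (lam * offset (fst y) + kappa * (?e - 1))"
      by (metis (no_types, opaque_lifting) add.assoc add_diff_eq distrib_left mult.left_commute)
    ultimately show ?thesis unfolding offset_kappa by (simp only:) simp
  qed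
  ultimately show "((\<lambda>s. zcoord (lift_pt p (\<gamma> s))) has_vector_derivative
      lam * zcoord (lift_pt p (\<gamma> s)) + exp (\<i> * of_real (fst (zflow lam ?w s x))) - 1) (at s)"
    using kappa0 zy e by simp
qed

text \<open>Uniqueness of solutions in the quotient. The phases determine \<open>t\<close> up to a multiple of \<open>2 \<pi> m\<close>: for
  \<open>m > 0\<close> the frequency \<open>1 / m\<close> suffices, and for \<open>m = 0\<close> every frequency is admissible, so that one may be
  taken that is too small for a full turn. Together with \<open>z\<close> this determines the point of the
  quotient.\<close>

theorem solution_iff:
  assumes J: "jump_set J u"
  shows "solution p f0 f1 u (p (up x)) \<gamma> \<longleftrightarrow> \<gamma> = (\<lambda>s. p (up (zflow lam (\<lambda>s. \<alpha> * u s) s x)))"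
proof
  assume sol: "solution p f0 f1 u (p (up x)) \<gamma>"
  show "\<gamma> = (\<lambda>s. p (up (zflow lam (\<lambda>s. \<alpha> * u s) s x)))"
  proof
    fix s
    let ?z = "zflow lam (\<lambda>s. \<alpha> * u s) s x"
    let ?l = "lift_pt p (\<gamma> s)"
    define d where "d = fst ?l - fst ?z"
    have phase: "exp (\<i> * of_real (\<omega> * d)) = 1"
      if "\<And>t k. exp (\<i> * complex_of_real (\<omega> * (t + 2 * pi * real m * of_int k))) = exp (\<i> * of_real (\<omega> * t))" for \<omega>
    proof -
      have "exp (\<i> * of_real (\<omega> * d)) = exp (\<i> * of_real (\<omega> * fst ?l)) / exp (\<i> * of_real (\<omega> * fst ?z))"
        by (simp add: d_def exp_diff[symmetric] algebra_simps)
      also have "\<dots> = 1" using solution_phase[OF J sol that, of s] by (simp add: zflow_def)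
      finally show ?thesis .
    qed
    have turn: "\<exists>k::int. \<omega> * d = 2 * pi * of_int k" if "exp (\<i> * complex_of_real (\<omega> * d)) = 1" for \<omega>
      using that by (auto simp: exp_eq_1)
    have "\<exists>k::int. d = 2 * pi * real m * of_int k"
    proof (cases "m = 0")
      case True
      \<comment> \<open>small enough for \<open>\<bar>\<omega> d\<bar>\<close> to be less than \<open>1\<close>, hence less than a full turn\<close>
      define \<omega> where "\<omega> = 1 / (1 + \<bar>d\<bar>)"
      obtain k :: int where k: "\<omega> * d = 2 * pi * of_int k"
        using turn[OF phase[of \<omega>]] True by auto
      have "\<bar>\<omega> * d\<bar> < 1" by (simp add: \<omega>_def abs_mult)
      then have "2 * pi * \<bar>of_int k\<bar> < 1" using k by (simp add: abs_mult)
      have "\<not> \<bar>real_of_int k\<bar> \<ge> 1"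
      proof
        assume "\<bar>real_of_int k\<bar> \<ge> 1"
        then have "2 * pi * 1 \<le> 2 * pi * \<bar>real_of_int k\<bar>" by (intro mult_left_mono) auto
        then show False using \<open>2 * pi * \<bar>of_int k\<bar> < 1\<close> pi_ge_two by linarith
      qed
      then have "k = 0" by linarith
      moreover have "1 + \<bar>d\<bar> > 0" by linarith
      then have "\<omega> \<noteq> 0" by (simp add: \<omega>_def)
      ultimately have "d = 0" using k by simp
      then show ?thesis using True by simp
    next
      case False
      have "exp (\<i> * complex_of_real (1 / real m * (t + 2 * pi * real m * of_int k))) =
          exp (\<i> * of_real (1 / real m * t))" for t k
      proof -
        have "1 / real m * (t + 2 * pi * real m * of_int k) = 1 / real m * t + 2 * pi * of_int k"
          using False by (simp add: field_simps)
        then show ?thesis by (simp only: exp_period)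
      qed
      from turn[OF phase[OF this]] show ?thesis using False by (auto simp: field_simps)
    qed
    then obtain k :: int where k: "d = 2 * pi * real m * of_int k" ..
    have "?l = up (fst ?l, zcoord ?l)" by simp
    also have "(fst ?l, zcoord ?l) = ?z + (2 * pi * real m * of_int k, 0)"
      using solution_zcoord[OF J sol, of s] k by (simp add: d_def prod_eq_iff)
    finally have "?l = up ?z + (2 * pi * real m * of_int k, 0)" by (simp only: up_translate)
    then have "p ?l = p (up ?z)" using fibre by blast
    then show "\<gamma> s = p (up ?z)" using p_lift solution_range[OF sol] by simp
  qed
qed (use solution_zflow[OF J] in simp)

end

section \<open>Change of coordinates and maximal pre-control sets\<close>

text \<open>From the rotating coordinates \<open>(t, r)\<close>, centred at the constant solution \<open>1 / lam\<close> of
  \<open>z' = lam z - 1\<close>, back to the coordinates \<open>(t, z)\<close> of the normal form.\<close>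

definition unrotate :: "complex \<Rightarrow> real \<times> complex \<Rightarrow> real \<times> complex" where
  "unrotate lam x = (fst x, exp (\<i> * of_real (fst x)) * snd x + 1 / lam)"

lemma zflow_unrotate:
  assumes J: "jump_set J w" and lam: "lam \<noteq> 0"
  shows "zflow lam w s (unrotate lam x) = unrotate lam (flow lam w s x)"
proof -
  let ?P = "prim (\<lambda>\<sigma>. inverse (multiplier lam w \<sigma>))"
  define g where "g s = exp (\<i> * of_real (fst x)) * (exp (lam * of_real s) * (snd x + ?P s)) + 1 / lam" for s
  have g': "(g has_vector_derivative lam * g s + exp (\<i> * of_real (fst (zflow lam w s (unrotate lam x)))) - 1) (at s)" for s
  proof -
    from has_vector_derivative_add[OF has_vector_derivative_mult_right[OF has_vector_derivative_mult[OF
        has_vector_derivative_exp_real[of lam s]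
        has_vector_derivative_add[OF has_vector_derivative_const[of "snd x"] prim_inverse_multiplier_deriv[OF J]]],
        of "exp (\<i> * of_real (fst x))"] has_vector_derivative_const[of "1 / lam"]]
    have "(g has_vector_derivative exp (\<i> * of_real (fst x)) *
        (exp (lam * of_real s) * (0 + inverse (multiplier lam w s)) + lam * exp (lam * of_real s) * (snd x + ?P s)) + 0) (at s)"
      unfolding g_def[abs_def] .
    moreover have "exp (lam * of_real s) * inverse (multiplier lam w s) = exp (\<i> * of_real (prim w s))"
      by (simp add: multiplier_def exp_minus[symmetric] exp_add[symmetric])
    then have "exp (\<i> * of_real (fst x)) * (exp (lam * of_real s) * inverse (multiplier lam w s)) =
        exp (\<i> * of_real (fst (zflow lam w s (unrotate lam x))))"
      by (simp add: zflow_def unrotate_def exp_add[symmetric] algebra_simps)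
    then have "exp (\<i> * of_real (fst x)) *
        (exp (lam * of_real s) * (0 + inverse (multiplier lam w s)) + lam * exp (lam * of_real s) * (snd x + ?P s)) + 0
        = lam * g s + exp (\<i> * of_real (fst (zflow lam w s (unrotate lam x)))) - 1"
      using lam by (simp add: g_def distrib_left mult.assoc mult.left_commute[of lam])
    ultimately show ?thesis by simp
  qed
  have "g s = snd (zflow lam w s (unrotate lam x))"
  proof (rule snd_zflow_unique[OF J _ g'])
    show "continuous_on UNIV g"
      using g' by (meson continuous_at_imp_continuous_on has_vector_derivative_continuous)
    show "g 0 = snd (unrotate lam x)" by (simp add: g_def unrotate_def)
  qed
  moreover have "exp (\<i> * of_real (fst x + prim w s)) * multiplier lam w s = exp (\<i> * of_real (fst x)) * exp (lam * of_real s)"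
    by (simp add: multiplier_def exp_add[symmetric] algebra_simps)
  then have "g s = snd (unrotate lam (flow lam w s x))"
    unfolding g_def unrotate_def flow_def fst_conv snd_conv mult.assoc[symmetric] by (simp only:)
  ultimately show ?thesis
    by (simp add: prod_eq_iff) (simp add: zflow_def unrotate_def flow_def)
qed

lemma exp_cancel: "exp a * (exp (- a) * z) = (z :: complex)"
  by (metis exp_minus_inverse mult.assoc mult.left_neutral)

lemma controls_scale:
  assumes "c \<noteq> 0"
  shows "(\<lambda>s. c * u s) \<in> controls ((*) c ` \<Omega>) \<longleftrightarrow> u \<in> controls \<Omega>"
proof -
  have "(\<exists>J. jump_set J (\<lambda>s. c * u s)) \<longleftrightarrow> (\<exists>J. jump_set J u)"
    using assms by (simp add: jump_set_def)
  moreover have "range (\<lambda>s. c * u s) \<subseteq> (*) c ` \<Omega> \<longleftrightarrow> range u \<subseteq> \<Omega>"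
    using assms by auto
  ultimately show ?thesis by (simp add: controls_iff)
qed

text \<open>The union of a chain of pre-control sets is one again: any two of its points lie in a common member,
  so (ii) holds, and (i) can be verified in a single member. Hence Zorn's lemma applies.\<close>

lemma pre_control_set_extends:
  assumes "pre_control_set p f0 f1 \<Omega> D0"
  shows "\<exists>D. control_set p f0 f1 \<Omega> D \<and> D0 \<subseteq> D"
proof -
  let ?A = "{D. pre_control_set p f0 f1 \<Omega> D \<and> D0 \<subseteq> D}"
  have "\<exists>M\<in>?A. \<forall>X\<in>?A. M \<subseteq> X \<longrightarrow> X = M"
  proof (rule subset_Zorn_nonempty)
    show "?A \<noteq> {}" using assms by blast
    fix \<C> assume ne: "\<C> \<noteq> {}" and ch: "subset.chain ?A \<C>"
    have sub: "\<C> \<subseteq> ?A" using ch by (simp add: subset.chain_def)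
    have lin: "X \<subseteq> Y \<or> Y \<subseteq> X" if "X \<in> \<C>" "Y \<in> \<C>" for X Y
    proof -
      have "X \<subset> Y \<or> X = Y \<or> Y \<subset> X" using ch that unfolding subset.chain_def by blast
      then show ?thesis by blast
    qed
    have pre: "X \<subseteq> range p" "\<forall>x\<in>X. \<exists>u\<in>controls \<Omega>. \<exists>\<gamma>. solution p f0 f1 u x \<gamma> \<and> \<gamma> ` {0..} \<subseteq> X"
      "\<forall>x\<in>X. X \<subseteq> quot_top p closure_of pos_orbit p f0 f1 \<Omega> x" if "X \<in> \<C>" for X
      using sub that unfolding pre_control_set_def by auto
    have "pre_control_set p f0 f1 \<Omega> (\<Union>\<C>)"
      unfolding pre_control_set_def
    proof (intro conjI ballI)
      show "\<Union>\<C> \<subseteq> range p" using pre(1) by blast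
      fix x assume "x \<in> \<Union>\<C>"
      then obtain X where X: "X \<in> \<C>" "x \<in> X" by blast
      obtain u \<gamma> where "u \<in> controls \<Omega>" "solution p f0 f1 u x \<gamma>" "\<gamma> ` {0..} \<subseteq> X"
        using pre(2)[OF X(1)] X(2) by blast
      moreover have "X \<subseteq> \<Union>\<C>" using X by blast
      ultimately show "\<exists>u\<in>controls \<Omega>. \<exists>\<gamma>. solution p f0 f1 u x \<gamma> \<and> \<gamma> ` {0..} \<subseteq> \<Union>\<C>"
        by (meson order_trans)
      show "\<Union>\<C> \<subseteq> quot_top p closure_of pos_orbit p f0 f1 \<Omega> x"
      proof
        fix y assume "y \<in> \<Union>\<C>"
        then obtain Y where Y: "Y \<in> \<C>" "y \<in> Y" by blast
        from lin[OF X(1) Y(1)] show "y \<in> quot_top p closure_of pos_orbit p f0 f1 \<Omega> x"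
          using pre(3)[OF X(1)] pre(3)[OF Y(1)] X Y by blast
      qed
    qed
    moreover have "D0 \<subseteq> \<Union>\<C>" using sub ne by blast
    ultimately show "\<Union>\<C> \<in> ?A" by blast
  qed
  then obtain M where M: "M \<in> ?A" and max: "\<forall>X\<in>?A. M \<subseteq> X \<longrightarrow> X = M" ..
  have "control_set p f0 f1 \<Omega> M"
    unfolding control_set_def
  proof (intro conjI allI impI)
    fix X assume "pre_control_set p f0 f1 \<Omega> X" "M \<subseteq> X"
    moreover from this have "X \<in> ?A" using M by blast
    ultimately show "X = M" using max by blast
  qed (use M in blast)
  then show ?thesis using M by blast
qed

section \<open>Control sets for nonzero determinant\<close>

context planar_lcs
begin

text \<open>The coordinates \<open>(t, r)\<close> cover the state space, and the deck transformations are still translations of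
  \<open>t\<close>, because \<open>e\<^sup>\<i>\<^sup>t\<close> has period \<open>2 \<pi>\<close>.\<close>

definition cover :: "real \<times> complex \<Rightarrow> 'm" where
  "cover x = p (up (unrotate lam x))"

definition period :: real where
  "period = 2 * pi * real m"

lemma unrotate_translate:
  "unrotate lam (x + (period * of_int k, 0)) = unrotate lam x + (period * of_int k, 0)"
  using exp_multiple[of "fst x" k] by (simp add: unrotate_def period_def)

lemma cover_translate: "cover (x + (period * of_int k, 0)) = cover x"
proof -
  have "up (unrotate lam (x + (period * of_int k, 0))) = up (unrotate lam x) + (2 * pi * real m * of_int k, 0)"
    unfolding unrotate_translate by (simp add: period_def up_translate)
  then show ?thesis unfolding cover_def using fibre by blast
qed

lemma inj_up: "up x = up y \<Longrightarrow> x = y"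
  by (metis fst_up zcoord_up prod_eq_iff)

lemma cover_eq: "cover x = cover y \<longleftrightarrow> (\<exists>k::int. x = y + (period * of_int k, 0))"
proof
  assume "cover x = cover y"
  then obtain k :: int where "up (unrotate lam x) = up (unrotate lam y) + (2 * pi * real m * of_int k, 0)"
    unfolding cover_def using fibre by blast
  then have "up (unrotate lam x) = up (unrotate lam (y + (period * of_int k, 0)))"
    unfolding unrotate_translate by (simp add: period_def up_translate)
  then have "unrotate lam x = unrotate lam (y + (period * of_int k, 0))" by (rule inj_up)
  then have "x = y + (period * of_int k, 0)"
    by (auto simp: unrotate_def prod_eq_iff)
  then show "\<exists>k::int. x = y + (period * of_int k, 0)" ..
qed (use cover_translate in blast)

definition cover_section :: "pt \<Rightarrow> real \<times> complex" where
  "cover_section y = (fst y, exp (- (\<i> * of_real (fst y))) * (zcoord y - 1 / lam))"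

lemma cover_section: "cover (cover_section y) = p y"
proof -
  have "unrotate lam (cover_section y) = (fst y, zcoord y)"
    by (simp add: unrotate_def cover_section_def exp_cancel)
  then show ?thesis by (simp add: cover_def)
qed

lemma range_cover: "range cover = range p"
proof
  show "range p \<subseteq> range cover" using cover_section by (metis image_subsetI rangeI)
qed (auto simp: cover_def)

text \<open>The coordinate change from \<open>(t, r)\<close> to \<open>(t, v)\<close> is a homeomorphism, so the quotient topology may be
  computed with either covering.\<close>

lemma openin_cover: "openin (quot_top p) U \<longleftrightarrow> U \<subseteq> range p \<and> open (cover -` U)"
proof -
  have "open (cover -` U)" if "open (p -` U)"
  proof -
    have "continuous_on UNIV (\<lambda>x. up (unrotate lam x))"
      unfolding unrotate_def by (intro continuous_up continuous_intros)
    then have "open ((\<lambda>x. up (unrotate lam x)) -` (p -` U))" using that by (simp add: open_vimage)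
    moreover have "(\<lambda>x. up (unrotate lam x)) -` (p -` U) = cover -` U" by (auto simp: cover_def)
    ultimately show ?thesis by simp
  qed
  moreover have "open (p -` U)" if "open (cover -` U)"
  proof -
    have "continuous_on UNIV cover_section"
      unfolding cover_section_def[abs_def] by (intro continuous_intros continuous_zcoord)
    then have "open (cover_section -` (cover -` U))" using that by (simp add: open_vimage)
    moreover have "cover_section -` (cover -` U) = p -` U"
      by (rule Set.set_eqI) (simp only: vimage_eq cover_section)
    ultimately show ?thesis by simp
  qed
  ultimately show ?thesis unfolding openin_quot_top by blast
qed

lemma cover_vimage_image: "cover -` (cover ` S) = saturate period S"
proof (rule Set.set_eqI)
  fix x
  have "x \<in> cover -` (cover ` S) \<longleftrightarrow> (\<exists>y\<in>S. cover x = cover y)" by blast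
  then show "x \<in> cover -` (cover ` S) \<longleftrightarrow> x \<in> saturate period S"
    unfolding cover_eq saturate_def by blast
qed

lemma open_saturate:
  assumes "open N"
  shows "open (saturate T N)"
proof -
  have "saturate T N = (\<Union>k::int. (\<lambda>x. x + (T * of_int k, 0)) ` N)"
    unfolding saturate_def by blast
  moreover have "open ((\<lambda>x. x + (T * of_int k, 0)) ` N)" for k
    using open_translation[OF assms, of "(T * of_int k, 0)"] by (simp add: add.commute)
  ultimately show ?thesis by auto
qed

lemma openin_cover_image: "open N \<Longrightarrow> openin (quot_top p) (cover ` N)"
  unfolding openin_cover cover_vimage_image using open_saturate range_cover by auto

text \<open>The covering is continuous, and it is open because saturations of open sets are open.\<close>

lemma closure_of_cover:
  "cover x \<in> quot_top p closure_of (cover ` S) \<longleftrightarrow> x \<in> closure (saturate period S)"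
proof
  assume L: "cover x \<in> quot_top p closure_of (cover ` S)"
  show "x \<in> closure (saturate period S)"
    unfolding closure_iff_nhds_not_empty
  proof (intro allI impI)
    fix A N assume "N \<subseteq> A" "open N" "x \<in> N"
    have "\<forall>U. cover x \<in> U \<and> openin (quot_top p) U \<longrightarrow> (\<exists>y. y \<in> cover ` S \<and> y \<in> U)"
      using L by (simp add: in_closure_of)
    moreover have "cover x \<in> cover ` N" using \<open>x \<in> N\<close> by (rule imageI)
    ultimately obtain y where y: "y \<in> cover ` S" "y \<in> cover ` N"
      using openin_cover_image[OF \<open>open N\<close>] by meson
    then obtain n where n: "n \<in> N" "y = cover n" by (elim imageE)
    then have "n \<in> cover -` (cover ` S)" using y by simp
    then have "n \<in> saturate period S" by (simp only: cover_vimage_image)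
    then show "saturate period S \<inter> A \<noteq> {}" using n(1) \<open>N \<subseteq> A\<close> by blast
  qed
next
  assume R: "x \<in> closure (saturate period S)"
  show "cover x \<in> quot_top p closure_of (cover ` S)"
    unfolding in_closure_of
  proof (intro conjI allI impI)
    show "cover x \<in> topspace (quot_top p)"
      using range_cover rangeI[of cover x] by (simp add: topspace_quot_top)
    fix U assume U: "cover x \<in> U \<and> openin (quot_top p) U"
    then have "open (cover -` U)" "x \<in> cover -` U" by (simp_all add: openin_cover)
    then have "saturate period S \<inter> cover -` U \<noteq> {}"
      using R[unfolded closure_iff_nhds_not_empty, THEN spec[of _ "cover -` U"],
          THEN spec[of _ "cover -` U"]] by simp
    then obtain y where y: "y \<in> cover -` U" "y \<in> cover -` (cover ` S)"
      unfolding cover_vimage_image[symmetric] by (meson IntE ex_in_conv)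
    then show "\<exists>y. y \<in> cover ` S \<and> y \<in> U"
      by (intro exI[of _ "cover y"]) simp
  qed
qed

lemma interior_of_cover:
  assumes "D \<subseteq> range p"
  shows "quot_top p interior_of D \<noteq> {} \<longleftrightarrow> interior (cover -` D) \<noteq> {}"
proof
  assume "quot_top p interior_of D \<noteq> {}"
  then obtain q U where U: "q \<in> U" "openin (quot_top p) U" "U \<subseteq> D" unfolding interior_of_def by blast
  then obtain x where "cover x = q" using range_cover unfolding openin_cover by (metis imageE subsetD)
  moreover have "cover -` U \<subseteq> interior (cover -` D)"
    using U unfolding openin_cover by (intro interior_maximal) auto
  ultimately show "interior (cover -` D) \<noteq> {}" using U by blast
next
  assume "interior (cover -` D) \<noteq> {}"
  then obtain x where x: "x \<in> interior (cover -` D)" by blast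
  have "cover ` interior (cover -` D) \<subseteq> D" using interior_subset by blast
  then have "cover x \<in> quot_top p interior_of D"
    using x openin_cover_image[OF open_interior, of "cover -` D"] unfolding interior_of_def by blast
  then show "quot_top p interior_of D \<noteq> {}" by blast
qed

lemma cover_solution:
  assumes lam: "lam \<noteq> 0" and J: "jump_set J u"
  shows "solution p f0 f1 u (cover x) \<gamma> \<longleftrightarrow> \<gamma> = (\<lambda>s. cover (flow lam (\<lambda>s. \<alpha> * u s) s x))"
  unfolding cover_def solution_iff[OF J]
  by (simp add: zflow_unrotate[OF jump_set_comp[OF J] lam])

lemma pos_orbit_cover:
  assumes lam: "lam \<noteq> 0"
  shows "pos_orbit p f0 f1 \<Omega> (cover x) = cover ` orb lam ((*) \<alpha> ` \<Omega>) x"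
proof (intro equalityI subsetI)
  fix y assume "y \<in> pos_orbit p f0 f1 \<Omega> (cover x)"
  then obtain \<gamma> S u where *: "y = \<gamma> S" "S > 0" "u \<in> controls \<Omega>" "solution p f0 f1 u (cover x) \<gamma>"
    unfolding pos_orbit_def by blast
  obtain J where "jump_set J u" using * control_jumps by blast
  then have "\<gamma> = (\<lambda>s. cover (flow lam (\<lambda>s. \<alpha> * u s) s x))" using * cover_solution[OF lam] by blast
  then have "y = cover (flow lam (\<lambda>s. \<alpha> * u s) S x)" using * by simp
  moreover have "(\<lambda>s. \<alpha> * u s) \<in> controls ((*) \<alpha> ` \<Omega>)" using * controls_scale[OF \<alpha>] by blast
  ultimately show "y \<in> cover ` orb lam ((*) \<alpha> ` \<Omega>) x" using * orb_flow by blast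
next
  fix y assume "y \<in> cover ` orb lam ((*) \<alpha> ` \<Omega>) x"
  then obtain w S where *: "w \<in> controls ((*) \<alpha> ` \<Omega>)" "0 < S" "y = cover (flow lam w S x)"
    unfolding orb_def by blast
  define u where "u s = w s / \<alpha>" for s
  have w: "w = (\<lambda>s. \<alpha> * u s)" using \<alpha> by (simp add: u_def)
  then have u: "u \<in> controls \<Omega>" using * controls_scale[OF \<alpha>] by simp
  then obtain J where "jump_set J u" using control_jumps by blast
  then have "solution p f0 f1 u (cover x) (\<lambda>s. cover (flow lam w s x))"
    using cover_solution[OF lam] w by blast
  then show "y \<in> pos_orbit p f0 f1 \<Omega> (cover x)" using * u unfolding pos_orbit_def
    by (intro CollectI exI[of _ "\<lambda>s. cover (flow lam w s x)"] exI[of _ S] exI[of _ u]) simp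
qed

text \<open>By uniqueness of solutions all trajectories in the quotient are images of trajectories of the flow;
  the factor \<open>\<alpha>\<close> rescales the control range so that \<open>t' = u\<close>.\<close>

lemma pre_control_set_cover:
  assumes lam: "lam \<noteq> 0"
  shows "pre_control_set p f0 f1 \<Omega> D \<longleftrightarrow>
    D \<subseteq> range p \<and> recurrent lam ((*) \<alpha> ` \<Omega>) period (cover -` D)"
proof (cases "D \<subseteq> range p")
  case True
  let ?U = "(*) \<alpha> ` \<Omega>"
  have all: "(\<forall>q\<in>D. P q) \<longleftrightarrow> (\<forall>x\<in>cover -` D. P (cover x))" for P
  proof (intro iffI ballI)
    fix q assume P: "\<forall>x\<in>cover -` D. P (cover x)" and q: "q \<in> D"
    then obtain x where "q = cover x" using True range_cover by (metis imageE subsetD)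
    then show "P q" using P q by simp
  qed simp
  have "(\<exists>u\<in>controls \<Omega>. \<exists>\<gamma>. solution p f0 f1 u (cover x) \<gamma> \<and> \<gamma> ` {0..} \<subseteq> D) \<longleftrightarrow>
      (\<exists>w\<in>controls ?U. \<forall>s\<ge>0. flow lam w s x \<in> cover -` D)" (is "?L \<longleftrightarrow> ?R") for x
  proof
    assume ?L
    then obtain u \<gamma> where *: "u \<in> controls \<Omega>" "solution p f0 f1 u (cover x) \<gamma>" "\<gamma> ` {0..} \<subseteq> D" by blast
    obtain J where "jump_set J u" using * control_jumps by blast
    then have "\<gamma> = (\<lambda>s. cover (flow lam (\<lambda>s. \<alpha> * u s) s x))" using * cover_solution[OF lam] by blast
    then have "\<forall>s\<ge>0. flow lam (\<lambda>s. \<alpha> * u s) s x \<in> cover -` D" using * by auto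
    moreover have "(\<lambda>s. \<alpha> * u s) \<in> controls ?U" using * controls_scale[OF \<alpha>] by blast
    ultimately show ?R by blast
  next
    assume ?R
    then obtain w where *: "w \<in> controls ?U" "\<forall>s\<ge>0. flow lam w s x \<in> cover -` D" by blast
    define u where "u s = w s / \<alpha>" for s
    have w: "w = (\<lambda>s. \<alpha> * u s)" using \<alpha> by (simp add: u_def)
    then have u: "u \<in> controls \<Omega>" using * controls_scale[OF \<alpha>] by simp
    then obtain J where "jump_set J u" using control_jumps by blast
    then have "solution p f0 f1 u (cover x) (\<lambda>s. cover (flow lam w s x))"
      using cover_solution[OF lam] w by blast
    moreover have "(\<lambda>s. cover (flow lam w s x)) ` {0..} \<subseteq> D" using * by auto
    ultimately show ?L using u by blast
  qed
  moreover have sub: "D \<subseteq> X \<longleftrightarrow> (\<forall>y\<in>cover -` D. cover y \<in> X)" for X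
    using all[of "\<lambda>q. q \<in> X"] by blast
  have "D \<subseteq> quot_top p closure_of pos_orbit p f0 f1 \<Omega> (cover x) \<longleftrightarrow>
      cover -` D \<subseteq> closure (saturate period (orb lam ?U x))" for x
    unfolding sub pos_orbit_cover[OF lam] closure_of_cover by blast
  ultimately show ?thesis
    using True unfolding pre_control_set_def recurrent_def all by simp
qed (simp add: pre_control_set_def)

text \<open>A recurrent set that contains every recurrent set with interior points is the only candidate, and it is
  maximal because any larger recurrent set has interior points as well.\<close>

theorem control_sets_cover:
  assumes lam: "lam \<noteq> 0" and int: "interior C \<noteq> {}"
    and trans: "\<And>x a. x \<in> C \<Longrightarrow> x + (a, 0) \<in> C"
    and rec: "recurrent lam ((*) \<alpha> ` \<Omega>) period C"
    and max: "\<And>B. recurrent lam ((*) \<alpha> ` \<Omega>) period B \<Longrightarrow> interior B \<noteq> {} \<Longrightarrow> B \<subseteq> C"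
  shows "control_set p f0 f1 \<Omega> D \<and> quot_top p interior_of D \<noteq> {} \<longleftrightarrow> D = cover ` C"
proof -
  have C: "cover -` (cover ` C) = C"
  proof -
    have "saturate period C \<subseteq> C" using trans unfolding saturate_def by blast
    then show ?thesis unfolding cover_vimage_image using subset_saturate[of C period] by blast
  qed
  have CR: "cover ` C \<subseteq> range p" using range_cover by blast
  have pre: "pre_control_set p f0 f1 \<Omega> (cover ` C)"
    unfolding pre_control_set_cover[OF lam] C using rec CR by blast
  have below: "D \<subseteq> cover ` C" if D: "pre_control_set p f0 f1 \<Omega> D" "interior (cover -` D) \<noteq> {}" for D
  proof -
    have "cover -` D \<subseteq> C" "D \<subseteq> range p" using D max unfolding pre_control_set_cover[OF lam] by auto
    then show ?thesis using range_cover by (metis image_mono image_vimage_eq inf.absorb1)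
  qed
  show ?thesis
  proof
    assume L: "control_set p f0 f1 \<Omega> D \<and> quot_top p interior_of D \<noteq> {}"
    then have D: "pre_control_set p f0 f1 \<Omega> D" by (simp add: control_set_def)
    then have "D \<subseteq> range p" by (simp add: pre_control_set_def)
    then have "interior (cover -` D) \<noteq> {}" using L interior_of_cover by simp
    then have "D \<subseteq> cover ` C" using below D by blast
    then show "D = cover ` C" using L pre unfolding control_set_def by blast
  next
    assume R: "D = cover ` C"
    have "D' = cover ` C" if D': "pre_control_set p f0 f1 \<Omega> D'" "cover ` C \<subseteq> D'" for D'
    proof -
      have "C \<subseteq> cover -` D'" using D' by blast
      then have "interior (cover -` D') \<noteq> {}" using int interior_mono by blast
      then show ?thesis using below D' by blast
    qed
    then show "control_set p f0 f1 \<Omega> D \<and> quot_top p interior_of D \<noteq> {}"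
      using pre int R CR unfolding control_set_def interior_of_cover[OF CR] by (simp add: interior_of_cover C)
  qed
qed

section \<open>Control sets for zero determinant\<close>

text \<open>For \<open>lam = 0\<close> this is a Lyapunov function: the real part of \<open>z' = e\<^sup>\<i>\<^sup>t - 1\<close> is never positive.\<close>

definition height :: "'m \<Rightarrow> real" where
  "height q = Re (zcoord (lift_pt p q))"

lemma height_p [simp]: "height (p x) = Re (zcoord x)"
proof -
  have "zcoord (lift_pt p (p x)) = zcoord x"
    by (rule invariant_eq[of zcoord, OF zcoord_translate]) (simp add: p_lift)
  then show ?thesis by (simp add: height_def)
qed

lemma continuous_height: "continuous_map (quot_top p) euclideanreal height"
proof -
  have "continuous_map (quot_top p) euclidean (zcoord \<circ> lift_pt p)"
    by (rule invariant_continuous[OF zcoord_translate continuous_zcoord])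
  moreover have "continuous_map euclidean euclideanreal Re" by (simp add: continuous_on_Re)
  ultimately have "continuous_map (quot_top p) euclideanreal (Re \<circ> (zcoord \<circ> lift_pt p))"
    by (rule continuous_map_compose)
  then show ?thesis by (simp add: o_def height_def[abs_def])
qed

lemma zflow_height_antimono:
  assumes lam: "lam = 0" and J: "jump_set J w" and S: "0 < S"
  shows "Re (snd (zflow lam w S x)) \<le> Re (snd x)"
proof -
  have "Re (snd (zflow lam w S x)) \<le> Re (snd (zflow lam w 0 x))"
  proof (rule DERIV_nonpos_imp_nonincreasing[of 0 S "\<lambda>s. Re (snd (zflow lam w s x))"])
    fix s assume "0 \<le> s" "s \<le> S"
    have "((\<lambda>s. Re (snd (zflow lam w s x))) has_real_derivative cos (fst (zflow lam w s x)) - 1) (at s)"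
      using bounded_linear.has_vector_derivative[OF bounded_linear_Re snd_zflow_deriv[OF J, of lam x s]]
      by (simp add: lam Re_exp has_real_derivative_iff_has_vector_derivative)
    then show "\<exists>y. ((\<lambda>s. Re (snd (zflow lam w s x))) has_real_derivative y) (at s) \<and> y \<le> 0"
      by (metis cos_le_one diff_le_0_iff_le)
  qed (use S in simp)
  then show ?thesis by simp
qed

lemma pos_orbit_height:
  assumes lam: "lam = 0" and y: "y \<in> pos_orbit p f0 f1 \<Omega> (p x)"
  shows "height y \<le> height (p x)"
proof -
  obtain \<gamma> S u where *: "y = \<gamma> S" "S > 0" "u \<in> controls \<Omega>" "solution p f0 f1 u (p x) \<gamma>"
    using y unfolding pos_orbit_def by blast
  obtain J where J: "jump_set J u" using * control_jumps by blast
  have "y = p (up (zflow lam (\<lambda>s. \<alpha> * u s) S (fst x, zcoord x)))"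
    using solution_iff[OF J, of "(fst x, zcoord x)"] * by simp
  then show ?thesis
    using zflow_height_antimono[OF lam jump_set_comp[OF J, of "\<lambda>x. \<alpha> * x"] *(2), of "(fst x, zcoord x)"]
    by simp
qed

text \<open>The points approximately reachable from \<open>x\<close> lie in the closed set where the height is at most that of
  \<open>x\<close>; in a pre-control set this holds in both directions.\<close>

lemma pre_control_set_height:
  assumes lam: "lam = 0" and D: "pre_control_set p f0 f1 \<Omega> D" and xy: "x \<in> D" "y \<in> D"
  shows "height x = height y"
proof -
  have le: "height y \<le> height x" if xD: "x \<in> D" and yD: "y \<in> D" for x y
  proof -
    have "D \<subseteq> range p" and cl_D: "D \<subseteq> quot_top p closure_of pos_orbit p f0 f1 \<Omega> x"
      using xD D by (simp_all add: pre_control_set_def)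
    then obtain x' where x': "x = p x'" using xD by blast
    have cl: "closedin (quot_top p) {q \<in> topspace (quot_top p). height q \<in> {..height x}}"
      by (rule closedin_continuous_map_preimage[OF continuous_height]) simp
    have "pos_orbit p f0 f1 \<Omega> x \<subseteq> {q \<in> topspace (quot_top p). height q \<in> {..height x}}"
    proof
      fix z assume z: "z \<in> pos_orbit p f0 f1 \<Omega> x"
      then obtain \<gamma> S u where "z = \<gamma> S" "solution p f0 f1 u x \<gamma>" unfolding pos_orbit_def by blast
      then have "z \<in> range p" using solution_range by simp
      then show "z \<in> {q \<in> topspace (quot_top p). height q \<in> {..height x}}"
        using pos_orbit_height[OF lam] z x' by (simp add: topspace_quot_top)
    qed
    from closure_of_minimal[OF this cl] show ?thesis
      using yD cl_D by blast
  qed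
  show ?thesis using le xy by (meson antisym)
qed

text \<open>The height varies in the direction of the real part of \<open>z\<close>, so its level sets contain no open set.\<close>

lemma constant_height_interior:
  assumes c: "\<And>q. q \<in> D \<Longrightarrow> height q = c"
  shows "quot_top p interior_of D = {}"
proof (rule ccontr)
  assume "quot_top p interior_of D \<noteq> {}"
  then obtain q U where U: "q \<in> U" "openin (quot_top p) U" "U \<subseteq> D" unfolding interior_of_def by blast
  then obtain x where x: "q = p x" unfolding openin_quot_top by blast
  define v where "v e = up (fst x, zcoord x + of_real e)" for e
  have "continuous_on UNIV v"
    unfolding v_def[abs_def] by (intro continuous_up continuous_intros)
  then have "open (v -` (p -` U))" using U by (simp add: open_vimage openin_quot_top)
  moreover have "0 \<in> v -` (p -` U)" using U x by (simp add: v_def)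
  ultimately obtain d where d: "d > 0" "ball 0 d \<subseteq> v -` (p -` U)" using openE by blast
  have "d / 2 \<in> ball 0 d" using d by simp
  then have "p (v (d / 2)) \<in> D" using d U by blast
  then have "height (p (v (d / 2))) = height q" using c U by (metis subsetD)
  then show False using d x by (simp add: v_def)
qed

text \<open>With the control switched off the points with \<open>t = 0\<close> are at rest, so each is a pre-control set by
  itself and lies in a control set. Equilibria of different heights lie in different control sets.\<close>

theorem singular_control_sets:
  assumes lam: "lam = 0" and 0: "0 \<in> \<Omega>"
  shows "infinite {D. control_set p f0 f1 \<Omega> D \<and> quot_top p interior_of D = {}}"
proof -
  have "\<exists>D. control_set p f0 f1 \<Omega> D \<and> p (up (0, of_real c)) \<in> D" for c :: real
  proof -
    let ?q = "p (up (0, of_real c))"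
    have u: "(\<lambda>_. 0) \<in> controls \<Omega>" by (rule const_control[OF 0])
    have z: "prim (\<lambda>_. 0 :: 'b::banach) s = 0" for s by (simp add: prim_def)
    have sol: "solution p f0 f1 (\<lambda>_. 0) ?q (\<lambda>_. ?q)"
      using solution_zflow[OF jump_set_const[of 0], of "(0, of_real c)"]
      by (simp add: zflow_def z lam)
    have "?q \<in> pos_orbit p f0 f1 \<Omega> ?q"
      unfolding pos_orbit_def using u sol by (intro CollectI exI[of _ "\<lambda>_. ?q"] exI[of _ 1]) auto
    then have "?q \<in> quot_top p closure_of pos_orbit p f0 f1 \<Omega> ?q"
      by (auto simp: in_closure_of topspace_quot_top)
    then have "pre_control_set p f0 f1 \<Omega> {?q}"
      unfolding pre_control_set_def using u sol by auto
    then show ?thesis using pre_control_set_extends by blast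
  qed
  then obtain D where D: "\<And>c. control_set p f0 f1 \<Omega> (D c)" "\<And>c :: real. p (up (0, of_real c)) \<in> D c"
    by metis
  have height: "height q = c" if "q \<in> D c" for q c
  proof -
    have "pre_control_set p f0 f1 \<Omega> (D c)" using D(1)[of c] by (simp add: control_set_def)
    from pre_control_set_height[OF lam this that D(2)] show ?thesis by simp
  qed
  have "inj D"
  proof (rule injI)
    fix c c' assume "D c = D c'"
    then show "c = c'" using height[OF D(2)[of c, unfolded \<open>D c = D c'\<close>]] by simp
  qed
  moreover have "range D \<subseteq> {D. control_set p f0 f1 \<Omega> D \<and> quot_top p interior_of D = {}}"
    using D(1) constant_height_interior height by blast
  ultimately show ?thesis
    using infinite_UNIV_char_0 finite_imageD finite_subset by blast
qed

end

section \<open>Linear control systems on the two groups\<close>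

lemma proj_fibre: "proj n x = proj n y \<longleftrightarrow> (\<exists>k::int. x = y + (2 * pi * real n * of_int k, 0))"
proof -
  obtain t v t' v' where x: "x = (t, v)" and y: "y = (t', v')" by (cases x, cases y)
  have in_self: "(t, v) \<in> proj n (t, v)" for t v
    unfolding proj_eq by (auto intro: exI[of _ 0])
  show ?thesis
  proof
    assume "proj n x = proj n y"
    then have "(t, v) \<in> proj n (t', v')" using in_self x y by metis
    then obtain k :: int where "t = t' + 2 * of_int k * real n * pi" "v = v'"
      unfolding proj_eq by auto
    then show "\<exists>k::int. x = y + (2 * pi * real n * of_int k, 0)"
      by (intro exI[of _ k]) (simp add: x y)
  next
    assume "\<exists>k::int. x = y + (2 * pi * real n * of_int k, 0)"
    then obtain k :: int where k: "t = t' + 2 * pi * real n * of_int k" "v = v'" by (auto simp: x y)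
    have "{t + 2 * of_int l * real n * pi |l :: int. True} = {t' + 2 * of_int l * real n * pi |l :: int. True}"
    proof (intro equalityI subsetI)
      fix s assume "s \<in> {t + 2 * of_int l * real n * pi |l :: int. True}"
      then obtain l :: int where "s = t + 2 * of_int l * real n * pi" by blast
      then have "s = t' + 2 * of_int (k + l) * real n * pi" by (simp add: k algebra_simps)
      then show "s \<in> {t' + 2 * of_int l * real n * pi |l :: int. True}" by blast
    next
      fix s assume "s \<in> {t' + 2 * of_int l * real n * pi |l :: int. True}"
      then obtain l :: int where "s = t' + 2 * of_int l * real n * pi" by blast
      then have "s = t + 2 * of_int (l - k) * real n * pi" by (simp add: k algebra_simps)
      then show "s \<in> {t + 2 * of_int l * real n * pi |l :: int. True}" by blast
    qed
    then show "proj n x = proj n y" unfolding x y proj_eq k(2) by simp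
  qed
qed

text \<open>All that matters about the control range is that it is a neighbourhood of \<open>0\<close>; this survives the
  rescaling by \<open>\<alpha>\<close>, of either sign.\<close>

lemma scaled_interval_contains_zero:
  fixes c :: real
  assumes "um < 0" "0 < up" "c \<noteq> 0"
  shows "\<exists>d>0. {-d..d} \<subseteq> (*) c ` {um..up}"
proof (intro exI conjI subsetI)
  let ?e = "min (- um) up"
  show "\<bar>c\<bar> * ?e > 0" using assms by simp
  fix x assume "x \<in> {- (\<bar>c\<bar> * ?e)..\<bar>c\<bar> * ?e}"
  then have "\<bar>x\<bar> \<le> \<bar>c\<bar> * ?e" by auto
  then have "\<bar>x / c\<bar> \<le> ?e" 
    using assms by (subst abs_divide, subst pos_divide_le_eq) (simp_all add: mult.commute)
  then have "x / c \<in> {um..up}" unfolding abs_le_iff atLeastAtMost_iff by linarith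
  then show "x \<in> (*) c ` {um..up}" using assms by (intro image_eqI[of _ _ "x / c"]) auto
qed

theorem theorem5p1:
  fixes n :: nat and A :: "real ^ 2 ^ 2" and \<xi> \<eta> :: "real ^ 2" and \<alpha> um up :: real
    and X Y :: "pt \<Rightarrow> pt" and Xn Yn :: "pt set \<Rightarrow> pt" and \<Omega> :: "real set"
  assumes "n \<ge> 1" and "A ** theta = theta ** A"
    and "um < 0" and "0 < up" and "\<Omega> = {um..up}"
    and "X = linear_field A \<xi>" and "Y = invariant_field \<alpha> \<eta>"
    and "Xn = descend (proj n) X" and "Yn = descend (proj n) Y"
    and "LARC (proj n) Xn Yn"
  shows "(det A \<noteq> 0 \<longrightarrow>
      (\<exists>C_SE C_G.
        (\<forall>D. control_set (proj n) Xn Yn \<Omega> D \<and> quot_top (proj n) interior_of D \<noteq> {} \<longleftrightarrow> D = C_SE) \<and>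
        (\<forall>D. control_set id X Y \<Omega> D \<and> interior D \<noteq> {} \<longleftrightarrow> D = C_G) \<and>
        proj n -` C_SE = C_G)) \<and>
    (det A = 0 \<longrightarrow>
      infinite {D. control_set (proj n) Xn Yn \<Omega> D \<and> quot_top (proj n) interior_of D = {}})"
proof -
  define lam where "lam = Complex (A $ 1 $ 1) (A $ 2 $ 1)"
  define kappa where "kappa = - \<i> * (cx \<xi> + lam * cx \<eta> / of_real \<alpha>)"
  have X: "X = affine_field (0, lam, - \<i> * cx \<xi>, \<i> * cx \<xi>)"
    unfolding assms(6) lam_def by (rule linear_field_affine[OF commutes_theta(1)[OF assms(2)]])
  have Y: "Y = affine_field (\<alpha>, 0, cx \<eta>, 0)"
    unfolding assms(7) by (rule invariant_field_affine)
  have det: "det A = 0 \<longleftrightarrow> lam = 0"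
    using commutes_theta(2)[OF assms(2)] by (simp add: lam_def)
  note nondegenerate = LARC_nondegenerate[OF assms(10)[unfolded assms(8,9) X Y]]
  have "kappa = - \<i> * (of_real \<alpha> * cx \<xi> + lam * cx \<eta>) / of_real \<alpha>"
    using nondegenerate(1) by (simp add: kappa_def field_simps)
  then have kappa0: "kappa \<noteq> 0" using nondegenerate by simp
  interpret SE: planar_lcs "proj n" n Xn Yn \<alpha> lam "cx \<xi>" "cx \<eta>" kappa
  proof
    show "Xn (proj n x) = affine_field (0, lam, - \<i> * cx \<xi>, \<i> * cx \<xi>) x"
      "Yn (proj n x) = affine_field (\<alpha>, 0, cx \<eta>, 0) x" for x
      unfolding assms(8,9) X Y by (rule descend_affine_field)+
  qed (rule proj_fibre nondegenerate kappa_def kappa0)+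
  interpret G: planar_lcs id 0 X Y \<alpha> lam "cx \<xi>" "cx \<eta>" kappa
  proof
    show "id x = id y \<longleftrightarrow> (\<exists>k::int. x = y + (2 * pi * real 0 * of_int k, 0))" for x y :: pt
      by (simp add: zero_prod_def[symmetric])
    show "X (id x) = affine_field (0, lam, - \<i> * cx \<xi>, \<i> * cx \<xi>) x"
      "Y (id x) = affine_field (\<alpha>, 0, cx \<eta>, 0) x" for x
      by (simp_all add: X Y)
  qed (rule nondegenerate kappa_def kappa0)+
  obtain d where d: "d > 0" "{-d..d} \<subseteq> (*) \<alpha> ` \<Omega>"
    using scaled_interval_contains_zero[OF assms(3,4) nondegenerate(1)] assms(5) by blast
  show ?thesis
  proof (intro conjI impI)
    assume "det A \<noteq> 0"
    then have lam: "lam \<noteq> 0" using det by simp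
    obtain C where C: "interior C \<noteq> {}" "\<And>x a. x \<in> C \<Longrightarrow> x + (a, 0) \<in> C"
        "\<And>T. recurrent lam ((*) \<alpha> ` \<Omega>) T C"
        "\<And>T B. recurrent lam ((*) \<alpha> ` \<Omega>) T B \<Longrightarrow> interior B \<noteq> {} \<Longrightarrow> B \<subseteq> C"
      using recurrent_core[OF lam d] by metis
    have cover: "SE.cover x = proj n (G.cover x)" for x
      by (simp add: SE.cover_def G.cover_def)
    have "proj n -` (SE.cover ` C) = G.cover ` C"
    proof (intro equalityI subsetI)
      fix g assume "g \<in> proj n -` (SE.cover ` C)"
      then obtain c where c: "c \<in> C" "proj n g = SE.cover c" by blast
      obtain c' where g: "g = G.cover c'" using G.cover_section[of g] by (metis id_apply)
      then have "SE.cover c' = SE.cover c" using c cover by simp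
      then obtain k :: int where "c' = c + (SE.period * of_int k, 0)" using SE.cover_eq by blast
      then show "g \<in> G.cover ` C" using g C(2) c by blast
    next
      fix g assume "g \<in> G.cover ` C"
      then show "g \<in> proj n -` (SE.cover ` C)" using cover by auto
    qed
    moreover have "control_set (proj n) Xn Yn \<Omega> D \<and> quot_top (proj n) interior_of D \<noteq> {} \<longleftrightarrow>
        D = SE.cover ` C" for D
      by (rule SE.control_sets_cover[OF lam C(1,2,3,4)])
    moreover have "control_set id X Y \<Omega> D \<and> interior D \<noteq> {} \<longleftrightarrow> D = G.cover ` C" for D
      using G.control_sets_cover[OF lam C(1,2,3,4), where D = D] unfolding quot_top_id by simp
    ultimately show "\<exists>C_SE C_G.
        (\<forall>D. control_set (proj n) Xn Yn \<Omega> D \<and> quot_top (proj n) interior_of D \<noteq> {} \<longleftrightarrow> D = C_SE) \<and>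
        (\<forall>D. control_set id X Y \<Omega> D \<and> interior D \<noteq> {} \<longleftrightarrow> D = C_G) \<and>
        proj n -` C_SE = C_G"
      by blast
  next
    assume "det A = 0"
    then have "lam = 0" using det by simp
    moreover have "0 \<in> \<Omega>" using assms(3,4,5) by simp
    ultimately show "infinite {D. control_set (proj n) Xn Yn \<Omega> D \<and> quot_top (proj n) interior_of D = {}}"
      by (rule SE.singular_control_sets)
  qed
qed

end
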